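(* Let $L$ be an extremal Type~II lattice of rank $40$ or $80$. Then $L$ is generated (as a $\mathbb{Z}$-module) by its vectors of norm $\min(L)+2$, where $\min(L)$ denotes the minimal nonzero norm of $L$.
   Context: A lattice of rank $n$ is a free $\mathbb{Z}$-module of rank $n$ equipped with a positive-definite inner product $\langle\cdot,\cdot\rangle: L\times L\to\mathbb{R}$; the norm of $x\in L$ is $\langle x,x\rangle$. $L$ is even if $\langle x,x\rangle\in 2\mathbb{Z}$ for all $x\in L$. The dual is $L^*=\{x'\in L\otimes\mathbb{R}: \langle x,x'\rangle\in\mathbb{Z}\text{ for all } x\in L\}$, and $L$ is self-dual if $L=L^*$. A Type~II lattice is an even self-dual lattice. The minimal norm $\min(L)$ is the smallest norm of a nonzero vector of $L$. For a Type~II lattice of rank $n$ one has $\min(L)\le 2\lfloor n/24\rfloor+2$, and $L$ is called extremal if equality holds, i.e. $\min(L)=2\lfloor n/24\rfloor+2$ (so $\min(L)=4$ for $n=40$ and $\min(L)=8$ for $n=80$). *)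

theory Defs
  imports "HOL-Analysis.Analysis"
begin

text \<open>
  A lattice is realised inside a real inner product space, whose inner product restricts to that of
  the lattice. The space need not be the real span of the lattice, so its dimension is not
  prescribed. Throughout, the norm of a vector \<open>x\<close> is \<open>x \<bullet> x\<close>, not \<open>norm x\<close>.
\<close>

definition int_span :: "'a::real_vector set \<Rightarrow> 'a set" where
  "int_span S = module.span (\<lambda>(k::int) x. of_int k *\<^sub>R x) S"

lemma module_int_scaleR:
  "module (\<lambda>(k::int) (x::'a::real_vector). of_int k *\<^sub>R x)"
  by unfold_locales (simp_all add: scaleR_add_right scaleR_add_left)

text \<open>
  The basis is required to be independent over the reals, not just over the integers: this is what
  makes the real span of \<open>L\<close> a copy of \<open>L \<otimes> \<real>\<close>, with the inner product positive definite on it.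
\<close>

definition lattice_of_rank :: "nat \<Rightarrow> 'a::real_inner set \<Rightarrow> bool" where
  "lattice_of_rank n L \<longleftrightarrow> (\<exists>B. finite B \<and> independent B \<and> card B = n \<and> L = int_span B)"

definition even_lattice :: "'a::real_inner set \<Rightarrow> bool" where
  "even_lattice L \<longleftrightarrow> (\<forall>x\<in>L. \<exists>k::int. x \<bullet> x = 2 * of_int k)"

definition dual_lattice :: "'a::real_inner set \<Rightarrow> 'a set" where
  "dual_lattice L = {x' \<in> span L. \<forall>x\<in>L. x \<bullet> x' \<in> \<int>}"

definition self_dual :: "'a::real_inner set \<Rightarrow> bool" where
  "self_dual L \<longleftrightarrow> L = dual_lattice L"

definition type_II_lattice :: "nat \<Rightarrow> 'a::real_inner set \<Rightarrow> bool" where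
  "type_II_lattice n L \<longleftrightarrow> lattice_of_rank n L \<and> even_lattice L \<and> self_dual L"

definition min_norm :: "'a::real_inner set \<Rightarrow> real" where
  "min_norm L = (LEAST r. \<exists>x\<in>L. x \<noteq> 0 \<and> r = x \<bullet> x)"

definition extremal_type_II :: "nat \<Rightarrow> 'a::real_inner set \<Rightarrow> bool" where
  "extremal_type_II n L \<longleftrightarrow>
     type_II_lattice n L \<and> min_norm L = 2 * of_int \<lfloor>real n / 24\<rfloor> + 2"

end

theory Submission
  imports Defs "HOL-Complex_Analysis.Complex_Analysis" "HOL-Probability.Characteristic_Functions"
begin

text \<open>
  Let \<open>N\<close> be the minimal norm and suppose that the lattice \<open>M\<close> spanned by the vectors of norm
  \<open>N + 2\<close> is not all of \<open>L\<close>. A shortest vector \<open>v\<close> of \<open>L\<close> outside \<open>M\<close> can have only very few inner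
  products with the vectors of norm \<open>N\<close> and \<open>N + 2\<close>. On the other hand, the theta series of \<open>L\<close>
  weighted by the zonal harmonic polynomials with pole \<open>v\<close> are modular forms vanishing to order \<open>N\<close>
  in \<open>exp (\<i> * pi * \<tau>)\<close>; dividing them by a power of \<open>\<Delta>\<close> leaves weight negative, 0, 2 or 4, so their next
  coefficients vanish or are proportional. These design relations for the inner
  products of \<open>v\<close> with the two shells contradict the bounds, by a linear programming certificate.

  Modularity is obtained from Poisson summation: the coefficients in \<open>u\<close> of
  \<open>\<Sum>x\<in>L. exp (\<i> * pi * \<tau> * (x \<bullet> x)) * cos (2 * pi * u * (x \<bullet> v))\<close> form a Jacobi-like family, and the
  heat operator turns such a family into one of weight larger by 2. The proof needs no dimension
  formula: a modular function vanishing at infinity is zero by the maximum principle.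
\<close>

subsection \<open>Poisson summation for Gaussians\<close>

text \<open>Write the rank as 2k and the minimal norm as 2m. In both ranks k = 10m, so degree 2\<nu>
  has weight below 12m for \<nu> < m, and weight 12m, 12m + 2, 12m + 4 for \<nu> = m, m + 1, m + 2.
  Forms vanishing to order 2m are zero in weight below 12m and in weight 12m + 2, and multiples of
  \<Delta>^m and E4 * \<Delta>^m in weights 12m and 12m + 4; the ratios of consecutive coefficients
  there are -24m and 240 - 24m. This makes 2m + 2 relations. The unknowns are the numbers of vectors
  of either shell with a given |inner product| with \<open>v\<close>. If \<open>v\<close> is not
  minimal, the values are 0..m and 0..m+1. If \<open>v\<close> is minimal, it lies in the first
  shell itself, which adds the value 2m there, while the value m disappears from the second shell.
  Either way there are 2m + 3 unknowns, one more than relations, and the contradiction must come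
  from signs. A nonminimal \<open>v\<close> has norm at least 2m + 4, with no upper bound at hand,
  so its certificate is polynomial in the norm of \<open>v\<close>; the minimal case has a numerical
  one.\<close>

definition zero_fourier :: "(real \<Rightarrow> complex) \<Rightarrow> bool" where
  "zero_fourier h \<longleftrightarrow> continuous_on {0..1} h \<and>
     (\<forall>m::int. integral {0..1} (\<lambda>x. h x * cis (2 * pi * of_int m * x)) = 0)"

lemma zero_fourier_add:
  assumes "zero_fourier g" "zero_fourier h"
  shows "zero_fourier (\<lambda>x. g x + h x)"
proof -
  have "integral {0..1} (\<lambda>x. (g x + h x) * cis (2 * pi * of_int m * x)) = 0" for m :: int
  proof -
    have "integral {0..1} (\<lambda>x. g x * cis (2 * pi * of_int m * x) + h x * cis (2 * pi * of_int m * x)) =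
      integral {0..1} (\<lambda>x. g x * cis (2 * pi * of_int m * x)) +
      integral {0..1} (\<lambda>x. h x * cis (2 * pi * of_int m * x))"
      using assms unfolding zero_fourier_def
      by (intro integral_add integrable_continuous_real continuous_intros) auto
    then show ?thesis
      using assms by (simp add: zero_fourier_def ring_distribs)
  qed
  then show ?thesis
    using assms by (auto simp: zero_fourier_def intro!: continuous_intros)
qed

lemma zero_fourier_mult_const:
  assumes "zero_fourier h"
  shows "zero_fourier (\<lambda>x. h x * c)"
proof -
  have "(\<lambda>x. (h x * c) * cis (2 * pi * of_int m * x)) = (\<lambda>x. (h x * cis (2 * pi * of_int m * x)) * c)" for m :: int
    by (simp add: mult_ac)
  then show ?thesis
    using assms unfolding zero_fourier_def by (auto intro!: continuous_intros)
qed

lemma zero_fourier_mult_cis: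
  assumes "zero_fourier h"
  shows "zero_fourier (\<lambda>x. h x * cis (2 * pi * of_int k * x))"
proof -
  have "(\<lambda>x. (h x * cis (2 * pi * of_int k * x)) * cis (2 * pi * of_int m * x))
      = (\<lambda>x. h x * cis (2 * pi * of_int (k + m) * x))" for m :: int
    by (simp add: cis_mult ring_distribs mult.assoc)
  then show ?thesis
    using assms unfolding zero_fourier_def by (simp only:) (auto intro!: continuous_intros)
qed

text \<open>On the circle a real linear functional is a combination of \<open>cis y\<close> and
  \<open>cis (- y)\<close>, and these factors only shift the index of the Fourier coefficients. Sums
  and products follow by induction; \<open>h\<close> stays arbitrary so that the factors of a
  product can be absorbed one after the other.\<close>

lemma zero_fourier_mult_polynomial:
  fixes p :: "complex \<Rightarrow> real"
  assumes "real_polynomial_function p" "zero_fourier h"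
  shows "zero_fourier (\<lambda>x. h x * of_real (p (cis (2 * pi * x))))"
  using assms
proof (induction arbitrary: h)
  case (linear f)
  \<comment> \<open>Euler's formulas for cos and sin give
    \<open>f (cis y) = cis y * a + cis (- y) * b\<close>.\<close>
  define a where "a = (complex_of_real (f 1) - \<i> * of_real (f \<i>)) / 2"
  define b where "b = (complex_of_real (f 1) + \<i> * of_real (f \<i>)) / 2"
  interpret f: bounded_linear f by fact
  have eq: "complex_of_real (f (cis y)) = cis y * a + cis (- y) * b" for y
  proof -
    have "f (cis y) = f (cos y *\<^sub>R 1 + sin y *\<^sub>R \<i>)"
      by (rule arg_cong[of _ _ f]) (simp add: complex_eq_iff)
    also have "\<dots> = cos y * f 1 + sin y * f \<i>"
      by (simp add: f.add f.scaleR)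
    finally show ?thesis
      by (simp add: a_def b_def complex_eq_iff) (simp add: field_simps)
  qed
  have "zero_fourier (\<lambda>x. (h x * cis (2 * pi * of_int 1 * x)) * a + (h x * cis (2 * pi * of_int (-1) * x)) * b)"
    by (intro zero_fourier_add zero_fourier_mult_const zero_fourier_mult_cis linear)
  then show ?case
    by (simp add: eq ring_distribs mult.assoc)
next
  case (const c)
  then show ?case by (rule zero_fourier_mult_const)
next
  case (add f g)
  then show ?case
    using zero_fourier_add[OF add.IH(1)[OF add.prems] add.IH(2)[OF add.prems]]
    by (simp add: ring_distribs)
next
  case (mult f g)
  then show ?case
    using mult.IH(2)[OF mult.IH(1)[OF mult.prems]] by (simp add: mult.assoc)
qed

lemma periodic_int:
  assumes "\<And>x::real. h (x + 1) = h x"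
  shows "h (x + of_int m) = (h x :: 'b)"
proof -
  have nat: "h (y + of_nat n) = h y" for y n
  proof (induction n)
    case (Suc n)
    then show ?case using assms[of "y + of_nat n"] by (simp add: add_ac)
  qed auto
  show ?thesis
  proof (cases "m \<ge> 0")
    case True
    then show ?thesis using nat[of x "nat m"] by simp
  next
    case False
    then show ?thesis using nat[of "x + of_int m" "nat (-m)"] by simp
  qed
qed

text \<open>The factor is \<open>h (Arg w / (2 * pi))\<close>. On the negative real axis, where
  \<open>Arg\<close> jumps, periodicity permits replacing \<open>Arg w\<close> by
  \<open>Arg (- w) + pi\<close>, which is continuous there.\<close>

lemma periodic_factor_circle:
  fixes h :: "real \<Rightarrow> complex"
  assumes cont: "continuous_on UNIV h" and per: "\<And>x. h (x + 1) = h x"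
  obtains f where "continuous_on (sphere 0 1) f" "\<And>x. f (cis (2 * pi * x)) = h x"
proof
  let ?f = "\<lambda>w. h (Arg w / (2 * pi))"
  have perc: "h x = h y" if "cis (2 * pi * x) = cis (2 * pi * y)" for x y
  proof -
    have "cis (2 * pi * x - 2 * pi * y) = 1"
      using that by (simp flip: cis_divide)
    then obtain n :: int where "2 * pi * x - 2 * pi * y = n * (2 * pi)"
      by (auto simp: complex_eq_iff) (metis cos_one_2pi_int mult.commute mult.assoc)
    then have "2 * pi * (x - (y + n)) = 0"
      by (simp add: algebra_simps)
    then have "x = y + n"
      by simp
    then show ?thesis
      using periodic_int[of h y n, OF per] by simp
  qed
  show f: "?f (cis (2 * pi * x)) = h x" for x
    by (rule perc) (simp add: cis_Arg)
  have hc: "isCont h x" for x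
    using cont by (simp add: continuous_on_eq_continuous_at)
  show "continuous_on (sphere 0 1) ?f"
  proof (rule continuous_at_imp_continuous_on, rule ballI)
    fix z :: complex assume "z \<in> sphere 0 1"
    then have z: "z \<noteq> 0" by auto
    show "isCont ?f z"
    proof (cases "z \<in> \<real>\<^sub>\<le>\<^sub>0")
      case False
      then show ?thesis
        by (intro isCont_o2[OF _ hc] continuous_intros continuous_at_Arg) auto
    next
      case True
      have mz: "- z \<notin> \<real>\<^sub>\<le>\<^sub>0"
        using True z by (auto elim!: nonpos_Reals_cases simp: complex_nonpos_Reals_iff complex_eq_iff)
      have "isCont (\<lambda>w. Arg (- w)) z"
        using isCont_o2[of z uminus Arg] continuous_at_Arg[OF mz] by simp
      then have "isCont (\<lambda>w. h (Arg (- w) / (2 * pi) + 1/2)) z"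
        by (intro isCont_o2[OF _ hc] continuous_intros) auto
      moreover have "eventually (\<lambda>w. ?f w = h (Arg (- w) / (2 * pi) + 1/2)) (nhds z)"
      proof -
        have "eventually (\<lambda>w. w \<noteq> 0) (nhds z)"
          using z by (intro t1_space_nhds) auto
        then show ?thesis
        proof eventually_elim
          case (elim w)
          show ?case
          proof (rule perc)
            have "cis (2 * pi * (Arg (- w) / (2 * pi) + 1/2)) = cis (Arg (- w)) * cis pi"
              unfolding cis_mult by (simp add: distrib_left)
            also have "\<dots> = sgn w"
              using elim by (simp add: cis_Arg sgn_minus)
            finally show "cis (2 * pi * (Arg w / (2 * pi))) = cis (2 * pi * (Arg (- w) / (2 * pi) + 1/2))"
              using elim by (simp add: cis_Arg)
          qed
        qed
      qed
      ultimately show ?thesis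
        by (subst isCont_cong)
    qed
  qed
qed

text \<open>By Stone-Weierstrass the conjugate of \<open>h\<close>, seen on the circle, is within
  \<open>e\<close> of a polynomial. Since \<open>h\<close> is orthogonal to that polynomial, the
  integral of |h|^2 is at most \<open>e\<close> times that of |h|, for every
  \<open>e > 0\<close>.\<close>

lemma fourier_uniqueness:
  fixes h :: "real \<Rightarrow> complex"
  assumes cont: "continuous_on UNIV h" and per: "\<And>x. h (x + 1) = h x"
    and zero: "\<And>m::int. integral {0..1} (\<lambda>x. h x * cis (2 * pi * of_int m * x)) = 0"
  shows "h x = 0"
proof -
  have c01 [continuous_intros]: "continuous_on {0..1} h"
    using cont continuous_on_subset by blast
  have zf: "zero_fourier h"
    using zero c01 by (auto simp: zero_fourier_def)
  obtain f where f: "continuous_on (sphere 0 1) f" "\<And>x. f (cis (2 * pi * x)) = cnj (h x)"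
    using periodic_factor_circle[of "\<lambda>x. cnj (h x)"] cont per by (auto intro: continuous_intros)
  define K where "K = integral {0..1} (\<lambda>x. norm (h x))"
  define J where "J = integral {0..1} (\<lambda>x. (norm (h x))\<^sup>2)"
  have K: "K \<ge> 0" unfolding K_def
    by (intro integral_nonneg integrable_continuous_real continuous_intros) auto
  have Jle: "J \<le> e * K" if e: "e > 0" for e
  proof -
    obtain g where g: "polynomial_function g" "\<And>w. w \<in> sphere 0 1 \<Longrightarrow> norm (f w - g w) < e"
      using Stone_Weierstrass_polynomial_function[OF _ f(1) e] by auto
    define p where "p = (\<lambda>x. g (cis (2 * pi * x)))"
    have "real_polynomial_function (Re \<circ> g)" "real_polynomial_function (Im \<circ> g)"
      using g(1) unfolding polynomial_function_def by (auto simp: bounded_linear_Re bounded_linear_Im)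
    then have "zero_fourier (\<lambda>x. h x * of_real ((Re \<circ> g) (cis (2 * pi * x))) +
                 (h x * of_real ((Im \<circ> g) (cis (2 * pi * x)))) * \<i>)"
      by (intro zero_fourier_add zero_fourier_mult_polynomial zero_fourier_mult_const zf)
    also have "(\<lambda>x. h x * of_real ((Re \<circ> g) (cis (2 * pi * x))) +
                 (h x * of_real ((Im \<circ> g) (cis (2 * pi * x)))) * \<i>) = (\<lambda>x. h x * p x)"
      by (auto simp: p_def complex_eq_iff algebra_simps)
    finally have z: "zero_fourier (\<lambda>x. h x * p x)" .
    then have hp0: "integral {0..1} (\<lambda>x. h x * p x) = 0"
      and [continuous_intros]: "continuous_on {0..1} (\<lambda>x. h x * p x)"
      unfolding zero_fourier_def by (auto dest: spec[of _ 0])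
    have "of_real J = integral {0..1} (\<lambda>x. h x * cnj (h x))"
    proof -
      have "of_real J = integral {0..1} (\<lambda>x. complex_of_real ((norm (h x))\<^sup>2))"
        unfolding J_def
        by (subst integral_linear [OF _ bounded_linear_of_real, symmetric, unfolded o_def])
          (auto intro!: integrable_continuous_real continuous_intros)
      then show ?thesis by (simp only: complex_norm_square)
    qed
    also have "\<dots> = integral {0..1} (\<lambda>x. h x * cnj (h x)) - integral {0..1} (\<lambda>x. h x * p x)"
      using hp0 by simp
    also have "\<dots> = integral {0..1} (\<lambda>x. h x * cnj (h x) - h x * p x)"
      by (rule integral_diff [symmetric]) (intro integrable_continuous_real continuous_intros)+
    also have "norm \<dots> \<le> integral {0..1} (\<lambda>x. e * norm (h x))"
    proof (rule integral_norm_bound_integral)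
      fix x :: real
      have "norm (f (cis (2 * pi * x)) - g (cis (2 * pi * x))) < e"
        by (rule g(2)) auto
      then have "norm (h x) * norm (cnj (h x) - p x) \<le> norm (h x) * e"
        by (intro mult_left_mono) (auto simp: p_def f)
      then show "norm (h x * cnj (h x) - h x * p x) \<le> e * norm (h x)"
        by (simp flip: norm_mult add: ring_distribs mult.commute)
    qed (intro integrable_continuous_real continuous_intros)+
    finally show ?thesis
      by (simp add: K_def)
  qed
  have "J \<le> 0"
  proof (rule field_le_epsilon)
    fix e :: real assume "e > 0"
    have "J \<le> (e / (K + 1)) * K"
      using \<open>e > 0\<close> K by (intro Jle) auto
    also have "\<dots> \<le> e"
      using \<open>e > 0\<close> K by (simp add: field_simps)
    finally show "J \<le> 0 + e" by simp
  qed
  moreover have "J \<ge> 0" unfolding J_def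
    by (intro integral_nonneg integrable_continuous_real continuous_intros) auto
  ultimately have J0: "J = 0" by simp
  have z01: "h y = 0" if "y \<in> {0..1}" for y
  proof -
    have "(norm (h y))\<^sup>2 = 0"
      using J0 that unfolding J_def
      by (subst (asm) integral_eq_0_iff) (auto intro!: continuous_intros)
    then show ?thesis by simp
  qed
  have "h x = h (frac x)"
    using periodic_int[of h "frac x" "\<lfloor>x\<rfloor>", OF per] by (simp add: frac_def)
  then show ?thesis
    using z01[of "frac x"] frac_lt_1[of x] by (auto simp: frac_ge_0 less_imp_le)
qed

section \<open>Gaussian integrals and the one-dimensional Poisson formula\<close>

lemma gaussian_integrable:
  assumes "t > 0"
  shows "integrable lborel (\<lambda>x. exp (- (pi * t * x\<^sup>2)))"
proof -
  have "integrable lborel std_normal_density"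
    using std_normal_moment_even[of 0] by (auto simp: has_bochner_integral_iff)
  then have "integrable lborel (\<lambda>x. std_normal_density (0 + sqrt (2 * pi * t) * x))"
    using assms by (subst lborel_integrable_real_affine_iff) auto
  then have "integrable lborel (\<lambda>x. sqrt (2 * pi) * std_normal_density (0 + sqrt (2 * pi * t) * x))"
    by (rule integrable_mult_right)
  also have "(\<lambda>x. sqrt (2 * pi) * std_normal_density (0 + sqrt (2 * pi * t) * x)) = (\<lambda>x. exp (- (pi * t * x\<^sup>2)))"
    using assms by (auto simp: std_normal_density_def power_mult_distrib)
  finally show ?thesis .
qed

text \<open>This is the characteristic function of the standard normal distribution, rescaled by
  \<open>c = sqrt (2 * pi * t)\<close>, which turns the exponent x^2 / 2 into pi * t * x^2.\<close>

lemma gaussian_fourier: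
  assumes t: "t > 0"
  shows "integrable lborel (\<lambda>x. of_real (exp (- (pi * t * x\<^sup>2))) * cis (2 * pi * y * x))"
    and "(\<integral>x. of_real (exp (- (pi * t * x\<^sup>2))) * cis (2 * pi * y * x) \<partial>lborel) =
           complex_of_real (exp (- (pi * y\<^sup>2 / t)) / sqrt t)"
proof -
  have [measurable]: "cis \<in> borel_measurable borel"
    by (intro borel_measurable_continuous_onI continuous_intros)
  show "integrable lborel (\<lambda>x. of_real (exp (- (pi * t * x\<^sup>2))) * cis (2 * pi * y * x))"
    by (rule Bochner_Integration.integrable_bound[OF gaussian_integrable[OF t]]) (auto simp: norm_mult)
  define c where "c = sqrt (2 * pi * t)"
  define u where "u = 2 * pi * y / c"
  have c: "c > 0" "c\<^sup>2 = 2 * pi * t" using t by (auto simp: c_def)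
  have "complex_of_real (exp (- (u\<^sup>2) / 2)) = char std_normal_distribution u"
    by (simp add: char_std_normal_distribution)
  also have "\<dots> = (\<integral>x. std_normal_density x *\<^sub>R iexp (u * x) \<partial>lborel)"
    unfolding char_def by (subst integral_density) auto
  also have "\<dots> = c *\<^sub>R (\<integral>x. std_normal_density (0 + c * x) *\<^sub>R iexp (u * (0 + c * x)) \<partial>lborel)"
    using c by (subst lborel_integral_real_affine[of c _ 0]) auto
  also have "(\<lambda>x. std_normal_density (0 + c * x) *\<^sub>R iexp (u * (0 + c * x))) =
     (\<lambda>x. complex_of_real (1 / sqrt (2 * pi)) * (of_real (exp (- (pi * t * x\<^sup>2))) * cis (2 * pi * y * x)))"
  proof
    fix x :: real
    have "u * (c * x) = 2 * pi * y * x" using c by (simp add: u_def)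
    moreover have "- (c * x)\<^sup>2 / 2 = - (pi * t * x\<^sup>2)"
      by (simp add: power_mult_distrib c)
    ultimately show "std_normal_density (0 + c * x) *\<^sub>R iexp (u * (0 + c * x)) =
        complex_of_real (1 / sqrt (2 * pi)) * (of_real (exp (- (pi * t * x\<^sup>2))) * cis (2 * pi * y * x))"
      unfolding std_normal_density_def cis_conv_exp add_0 by (simp only: scaleR_conv_of_real of_real_mult mult.assoc)
  qed
  also have "c *\<^sub>R (\<integral>x. complex_of_real (1 / sqrt (2 * pi)) * (of_real (exp (- (pi * t * x\<^sup>2))) * cis (2 * pi * y * x)) \<partial>lborel) =
     of_real (c / sqrt (2 * pi)) * (\<integral>x. of_real (exp (- (pi * t * x\<^sup>2))) * cis (2 * pi * y * x) \<partial>lborel)"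
    by (simp add: scaleR_conv_of_real)
  also have "c / sqrt (2 * pi) = sqrt t"
    by (simp add: c_def real_sqrt_mult)
  also have "- (u\<^sup>2) / 2 = - (pi * y\<^sup>2 / t)"
    using t by (simp add: u_def power_divide c power_mult_distrib) (simp add: field_simps power2_eq_square)
  finally show "(\<integral>x. of_real (exp (- (pi * t * x\<^sup>2))) * cis (2 * pi * y * x) \<partial>lborel) =
           complex_of_real (exp (- (pi * y\<^sup>2 / t)) / sqrt t)"
    using t by (simp add: field_simps)
qed

lemma summable_on_int_power_abs:
  fixes r :: real
  assumes "0 \<le> r" "r < 1"
  shows "(\<lambda>n::int. r ^ nat \<bar>n\<bar>) summable_on UNIV"
proof -
  have s: "(\<lambda>n::nat. r ^ n) summable_on UNIV"
    using assms by (simp add: summable_on_UNIV_nonneg_real_iff)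
  have 1: "(\<lambda>n::int. r ^ nat \<bar>n\<bar>) summable_on range int"
    by (subst summable_on_reindex) (auto simp: o_def s)
  have 2: "(\<lambda>n::int. r ^ nat \<bar>n\<bar>) summable_on range (\<lambda>n. - int n)"
    by (subst summable_on_reindex) (auto simp: o_def s inj_on_def)
  have "(UNIV :: int set) = range int \<union> range (\<lambda>n. - int n)"
    by (auto simp: image_iff) (metis int_cases2)
  then show ?thesis
    using summable_on_union[OF 1 2] by simp
qed

text \<open>From 0 \<le> (n + 2z)^2 and |n| \<le> n^2 one gets (n + z)^2 \<ge> |n| / 2 - R^2. The
  resulting geometric majorant does not depend on the shift, as the Weierstrass M-test
  requires.\<close>

lemma gaussian_shift_bound:
  fixes n :: int and t z R :: real
  assumes "t > 0" "\<bar>z\<bar> \<le> R"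
  shows "exp (- (pi * t * (of_int n + z)\<^sup>2)) \<le> exp (pi * t * R\<^sup>2) * exp (- (pi * t / 2)) ^ nat \<bar>n\<bar>"
proof -
  have "\<bar>n\<bar> * 1 \<le> \<bar>n\<bar> * \<bar>n\<bar>"
    by (cases "n = 0") (simp, intro mult_left_mono, auto)
  then have "\<bar>n\<bar> \<le> n\<^sup>2"
    by (simp add: power2_eq_square abs_mult_self_eq)
  then have n: "\<bar>real_of_int n\<bar> \<le> (real_of_int n)\<^sup>2"
    by (metis of_int_abs of_int_le_iff of_int_power)
  have "z\<^sup>2 \<le> R\<^sup>2"
    using assms by (metis abs_ge_zero power2_abs power_mono)
  moreover have "0 \<le> (of_int n + 2 * z)\<^sup>2" by simp
  ultimately have "(of_int n + z)\<^sup>2 \<ge> \<bar>real_of_int n\<bar> / 2 - R\<^sup>2"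
    using n by (simp add: power2_eq_square algebra_simps)
  then have "pi * t * (of_int n + z)\<^sup>2 \<ge> pi * t * (\<bar>real_of_int n\<bar> / 2 - R\<^sup>2)"
    using assms by (intro mult_left_mono) auto
  then have "exp (- (pi * t * (of_int n + z)\<^sup>2)) \<le> exp (pi * t * R\<^sup>2 + of_nat (nat \<bar>n\<bar>) * (- (pi * t / 2)))"
    by (simp add: algebra_simps)
  also have "\<dots> = exp (pi * t * R\<^sup>2) * exp (- (pi * t / 2)) ^ nat \<bar>n\<bar>"
    unfolding exp_add exp_of_nat_mult ..
  finally show ?thesis .
qed

lemma summable_gaussian_bound:
  fixes t :: real
  assumes "t > 0"
  shows "(\<lambda>n::int. C * exp (- (pi * t / 2)) ^ nat \<bar>n\<bar>) summable_on UNIV"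
  using assms by (intro summable_on_cmult_right summable_on_int_power_abs) auto

lemma summable_gaussian_int:
  fixes t z :: real
  assumes "t > 0"
  shows "(\<lambda>n::int. exp (- (pi * t * (of_int n + z)\<^sup>2))) summable_on UNIV"
  by (rule summable_on_comparison_test[OF summable_gaussian_bound[OF assms, of "exp (pi * t * \<bar>z\<bar>\<^sup>2)"]])
     (use gaussian_shift_bound[OF assms, of z "\<bar>z\<bar>"] in auto)

text \<open>Links unordered sums over the integers to limits of integrals. The intervals are
  half-open because the unit intervals starting at -N, ..., N - 1 tile [-N, N].\<close>

lemma filterlim_symmetric_int_intervals:
  "filterlim (\<lambda>N. {- int N..<int N}) (finite_subsets_at_top UNIV) sequentially"
  unfolding filterlim_finite_subsets_at_top
proof (intro allI impI)
  fix X :: "int set" assume X: "finite X \<and> X \<subseteq> UNIV"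
  have "X \<subseteq> {- int N..<int N}" if "N \<ge> nat (Max (insert 0 (abs ` X))) + 1" for N
  proof
    fix x assume "x \<in> X"
    then have "\<bar>x\<bar> \<le> Max (insert 0 (abs ` X))"
      using X by (intro Max_ge) auto
    then show "x \<in> {- int N..<int N}" using that by auto
  qed
  then show "\<forall>\<^sub>F N in sequentially. finite {- int N..<int N} \<and> X \<subseteq> {- int N..<int N} \<and> {- int N..<int N} \<subseteq> UNIV"
    unfolding eventually_sequentially by blast
qed

text \<open>Unfolding: the partial sum over \<open>{- int N..<int N}\<close> integrates over [0, 1]
  to the integral of \<phi> over [-N, N]. The majorant \<open>M\<close> gives uniform convergence on
  one side, integrability gives the limit on the other.\<close>

lemma integral_periodization:
  fixes \<phi> :: "real \<Rightarrow> complex"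
  assumes cont: "continuous_on UNIV \<phi>" and int: "integrable lborel \<phi>"
    and bound: "\<And>n z. z \<in> {0..1} \<Longrightarrow> norm (\<phi> (of_int n + z)) \<le> M n" and M: "M summable_on UNIV"
  shows "integral {0..1} (\<lambda>z. \<Sum>\<^sub>\<infinity>n::int. \<phi> (of_int n + z)) = (\<integral>x. \<phi> x \<partial>lborel)"
proof -
  have c: "continuous_on A \<phi>" for A using cont continuous_on_subset by blast
  have u: "uniform_limit {0..1} (\<lambda>X z. \<Sum>n\<in>X. \<phi> (of_int n + z)) (\<lambda>z. \<Sum>\<^sub>\<infinity>n::int. \<phi> (of_int n + z)) (finite_subsets_at_top UNIV)"
    by (rule Weierstrass_m_test_general[OF _ M]) (use bound in auto)
  obtain I J where IJ: "\<And>X. ((\<lambda>z. \<Sum>n\<in>X. \<phi> (of_int n + z)) has_integral I X) {0..1}"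
    "((\<lambda>z. \<Sum>\<^sub>\<infinity>n::int. \<phi> (of_int n + z)) has_integral J) {0..1}"
    "(I \<longlongrightarrow> J) (finite_subsets_at_top UNIV)"
    by (rule uniform_limit_integral[OF u])
       (auto intro!: continuous_on_sum continuous_on_compose2[OF cont] continuous_intros)
  have I: "I {- int N..<int N} = integral {- real N..real N} \<phi>" for N
  proof -
    have "((\<lambda>z. \<Sum>n\<in>{- int N..<int N}. \<phi> (of_int n + z)) has_integral integral {- real N..real N} \<phi>) {0..1}"
    proof (induction N)
      case (Suc N)
      have shift: "((\<lambda>z. \<phi> (of_int n + z)) has_integral integral {of_int n..of_int n + 1} \<phi>) {0..1}" for n :: int
      proof -
        have "(\<phi> has_integral integral {of_int n..of_int n + 1} \<phi>) {of_int n..of_int n + 1}"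
          by (intro integrable_integral integrable_continuous_real c)
        from has_integral_affinity'[OF this[folded cbox_interval], of 1 "of_int n"] show ?thesis
          by (simp add: add.commute)
      qed
      have set: "{- int (Suc N)..<int (Suc N)} = insert (int N) (insert (- int N - 1) {- int N..<int N})"
        by auto
      have sum_eq: "(\<Sum>n\<in>{- int (Suc N)..<int (Suc N)}. h n) =
          h (int N) + (h (- int N - 1) + (\<Sum>n\<in>{- int N..<int N}. h n))" for h :: "int \<Rightarrow> complex"
        unfolding set by (subst sum.insert; simp)+
      have "((\<lambda>z. \<phi> (of_int (int N) + z) + (\<phi> (of_int (- int N - 1) + z) + (\<Sum>n\<in>{- int N..<int N}. \<phi> (of_int n + z))))
         has_integral integral {of_int (int N)..of_int (int N) + 1} \<phi> +
          (integral {of_int (- int N - 1)..of_int (- int N - 1) + 1} \<phi> + integral {- real N..real N} \<phi>)) {0..1}"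
        by (intro has_integral_add shift Suc.IH)
      also have "integral {of_int (- int N - 1)..of_int (- int N - 1) + 1} \<phi> + integral {- real N..real N} \<phi> =
        integral {- real N - 1..real N} \<phi>"
        using Henstock_Kurzweil_Integration.integral_combine[of "- real N - 1" "- real N" "real N" \<phi>]
        by (simp add: integrable_continuous_real c)
      also have "integral {of_int (int N)..of_int (int N) + 1} \<phi> + integral {- real N - 1..real N} \<phi> =
        integral {- real N - 1..real N + 1} \<phi>"
        using Henstock_Kurzweil_Integration.integral_combine[of "- real N - 1" "real N" "real N + 1" \<phi>]
        by (simp add: integrable_continuous_real c add.commute)
      also have "{- real N - 1..real N + 1} = {- real (Suc N)..real (Suc N)}" by auto
      finally show ?case
        by (simp only: sum_eq)
    qed auto
    then show ?thesis
      using IJ(1) has_integral_unique by blast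
  qed
  have "(\<lambda>N. I {- int N..<int N}) \<longlonglongrightarrow> J"
    by (rule filterlim_compose[OF IJ(3) filterlim_symmetric_int_intervals])
  moreover have "(\<lambda>N. I {- int N..<int N}) \<longlonglongrightarrow> (\<integral>x. \<phi> x \<partial>lborel)"
    unfolding I
  proof (rule LIMSEQ_I)
    fix e :: real assume "e > 0"
    have "(\<phi> has_integral (\<integral>x. \<phi> x \<partial>lborel)) UNIV"
      by (rule has_integral_integral_lborel[OF int])
    then obtain B where B: "B > 0" "\<And>a b. ball 0 B \<subseteq> cbox a b \<Longrightarrow>
        \<exists>z. (\<phi> has_integral z) (cbox a b) \<and> norm (z - (\<integral>x. \<phi> x \<partial>lborel)) < e"
      using \<open>e > 0\<close> by (subst (asm) has_integral') auto
    have "norm (integral {- real N..real N} \<phi> - (\<integral>x. \<phi> x \<partial>lborel)) < e" if "N \<ge> nat \<lceil>B\<rceil>" for N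
    proof -
      have "ball 0 B \<subseteq> cbox (- real N) (real N)"
        using that by (auto simp: dist_norm)
      from B(2)[OF this] show ?thesis
        by (auto dest: integral_unique)
    qed
    then show "\<exists>N0. \<forall>N\<ge>N0. norm (integral {- real N..real N} \<phi> - (\<integral>x. \<phi> x \<partial>lborel)) < e"
      by blast
  qed
  ultimately have "J = (\<integral>x. \<phi> x \<partial>lborel)"
    using LIMSEQ_unique by blast
  then show ?thesis using IJ(2) by (simp add: integral_unique)
qed

lemma integral_cis_int:
  "integral {0..1} (\<lambda>x. cis (2 * pi * of_int k * x)) = (if k = 0 then 1 else 0)"
proof (cases "k = 0")
  case False
  define c where "c = \<i> * of_real (2 * pi * of_int k)"
  have c0: "c \<noteq> 0" using False by (simp add: c_def)
  have "((\<lambda>x. cis (2 * pi * of_int k * x)) has_integral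
      cis (2 * pi * of_int k * 1) / c - cis (2 * pi * of_int k * 0) / c) {0..1}"
  proof (rule fundamental_theorem_of_calculus)
    fix x :: real
    have "((\<lambda>z. exp (c * z) / c) has_field_derivative exp (c * of_real x)) (at (of_real x))"
      using c0 by (auto intro!: derivative_eq_intros)
    from has_vector_derivative_real_field[OF this]
    have "((\<lambda>x. exp (c * of_real x) / c) has_vector_derivative exp (c * of_real x)) (at x within {0..1})" .
    moreover have "cis (2 * pi * of_int k * x) = exp (c * of_real x)" for x
      by (simp add: cis_conv_exp c_def mult_ac)
    ultimately show "((\<lambda>x. cis (2 * pi * of_int k * x) / c) has_vector_derivative cis (2 * pi * of_int k * x)) (at x within {0..1})"
      by simp
  qed auto
  also have "cis (2 * pi * of_int k * 1) = 1"
    using cis_multiple_2pi[of "of_int k"] by (simp add: mult_ac)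
  finally show ?thesis using False by (auto dest: integral_unique)
qed auto

text \<open>As functions of \<open>z\<close> both sides are continuous, have period 1 and share
  their Fourier coefficients. The twist \<open>w\<close> is kept next to the shift \<open>z\<close>
  because the induction over the rank of a lattice produces both.\<close>

theorem poisson_gaussian_int:
  fixes t z w :: real
  assumes t: "t > 0"
  shows "(\<Sum>\<^sub>\<infinity>n::int. of_real (exp (- (pi * t * (of_int n + z)\<^sup>2))) * cis (2 * pi * w * (of_int n + z))) =
    of_real (1 / sqrt t) * (\<Sum>\<^sub>\<infinity>m::int. of_real (exp (- (pi * (of_int m - w)\<^sup>2 / t))) * cis (2 * pi * of_int m * z))"
proof -
  define f where "f = (\<lambda>x. complex_of_real (exp (- (pi * t * x\<^sup>2))) * cis (2 * pi * w * x))"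
  define F where "F = (\<lambda>z. \<Sum>\<^sub>\<infinity>n::int. f (of_int n + z))"
  define g where "g = (\<lambda>(m::int) z. complex_of_real (1 / sqrt t * exp (- (pi * (of_int m - w)\<^sup>2 / t))) * cis (2 * pi * of_int m * z))"
  define G where "G = (\<lambda>z. \<Sum>\<^sub>\<infinity>m::int. g m z)"
  have fc [continuous_intros]: "continuous_on A f" for A
    unfolding f_def by (intro continuous_intros)
  have fb: "norm (f (of_int n + z)) \<le> exp (pi * t * R\<^sup>2) * exp (- (pi * t / 2)) ^ nat \<bar>n\<bar>" if "\<bar>z\<bar> \<le> R" for z R n
    using gaussian_shift_bound[OF t that, of n] by (simp add: f_def norm_mult)
  have gs: "(\<lambda>m::int. 1 / sqrt t * exp (- (pi * (of_int m - w)\<^sup>2 / t))) summable_on UNIV"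
    using summable_gaussian_int[of "1 / t" "- w"] t by (intro summable_on_cmult_right) auto
  have gb: "norm (g m z) \<le> 1 / sqrt t * exp (- (pi * (of_int m - w)\<^sup>2 / t))" for m z
    unfolding g_def norm_mult norm_of_real norm_cis using t by simp
  have gU: "uniform_limit A (\<lambda>X z. \<Sum>m\<in>X. g m z) G (finite_subsets_at_top UNIV)" for A
    unfolding G_def by (rule Weierstrass_m_test_general[OF gb gs])
  have gc [continuous_intros]: "continuous_on A (g m)" for A m
    unfolding g_def by (intro continuous_intros)
  have Gc [continuous_intros]: "continuous_on A G" for A
    by (rule uniform_limit_theorem[OF _ gU]) (auto intro!: always_eventually continuous_intros)
  \<comment> \<open>The majorant is uniform in \<open>z\<close> only on bounded sets, so continuity
    is shown on every \<open>{-R..R}\<close> first.\<close>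
  have FcR: "continuous_on {-R..R} F" for R
  proof (rule uniform_limit_theorem)
    show "uniform_limit {-R..R} (\<lambda>X z. \<Sum>n\<in>X. f (of_int n + z)) F (finite_subsets_at_top UNIV)"
      unfolding F_def by (rule Weierstrass_m_test_general[OF fb[of _ R] summable_gaussian_bound[OF t]]) auto
  qed (auto intro!: always_eventually continuous_on_sum continuous_on_compose2[OF fc] continuous_intros)
  have Fc: "continuous_on UNIV F"
  proof (rule continuous_at_imp_continuous_on, rule ballI)
    fix z :: real
    show "isCont F z"
      by (rule continuous_on_interior[OF FcR[of "\<bar>z\<bar> + 1"]]) (auto simp: interior_atLeastAtMost_real)
  qed
  have Fp: "F (z + 1) = F z" for z
    unfolding F_def
    by (rule infsum_reindex_bij_witness[of _ "\<lambda>n. n - 1" "\<lambda>n. n + 1"]) (auto simp: add_ac)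
  have Gp: "G (z + 1) = G z" for z
  proof -
    have "g m (z + 1) = g m z" for m
      using cis_multiple_2pi[of "of_int m"] by (simp add: g_def ring_distribs mult_ac flip: cis_mult)
    then show ?thesis by (simp add: G_def)
  qed
  \<comment> \<open>The character takes the same value at x and n + x, so it moves under the sum and
    merely replaces \<open>w\<close> by \<open>w + of_int m\<close> in the periodized
    Gaussian.\<close>
  have Fm: "integral {0..1} (\<lambda>x. F x * cis (2 * pi * of_int m * x)) = of_real (exp (- (pi * (w + of_int m)\<^sup>2 / t)) / sqrt t)" for m
  proof -
    define \<phi> where "\<phi> = (\<lambda>x. complex_of_real (exp (- (pi * t * x\<^sup>2))) * cis (2 * pi * (w + of_int m) * x))"
    have \<phi>: "\<phi> x = f x * cis (2 * pi * of_int m * x)" for x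
      by (simp add: \<phi>_def f_def mult.assoc cis_mult ring_distribs)
    have "F x * cis (2 * pi * of_int m * x) = (\<Sum>\<^sub>\<infinity>n::int. \<phi> (of_int n + x))" for x
    proof -
      have "cis (2 * pi * of_int m * (of_int n + x)) = cis (2 * pi * of_int m * x)" for n
        using cis_multiple_2pi[of "of_int (m * n)"] by (simp add: ring_distribs mult_ac flip: cis_mult)
      then show ?thesis
        unfolding F_def \<phi> by (simp add: infsum_cmult_left')
    qed
    then have "integral {0..1} (\<lambda>x. F x * cis (2 * pi * of_int m * x)) = integral {0..1} (\<lambda>x. \<Sum>\<^sub>\<infinity>n::int. \<phi> (of_int n + x))"
      by simp
    also have "\<dots> = (\<integral>x. \<phi> x \<partial>lborel)"
    proof (rule integral_periodization)
      show "continuous_on UNIV \<phi>" unfolding \<phi>_def by (intro continuous_intros)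
      show "integrable lborel \<phi>" unfolding \<phi>_def by (rule gaussian_fourier(1)[OF t])
      show "(\<lambda>n::int. exp (pi * t * 1\<^sup>2) * exp (- (pi * t / 2)) ^ nat \<bar>n\<bar>) summable_on UNIV"
        by (rule summable_gaussian_bound[OF t])
      show "norm (\<phi> (of_int n + z)) \<le> exp (pi * t * 1\<^sup>2) * exp (- (pi * t / 2)) ^ nat \<bar>n\<bar>" if "z \<in> {0..1}" for n z
        using fb[of z 1 n] that by (simp add: \<phi> norm_mult)
    qed
    also have "\<dots> = of_real (exp (- (pi * (w + of_int m)\<^sup>2 / t)) / sqrt t)"
      unfolding \<phi>_def by (rule gaussian_fourier(2)[OF t])
    finally show ?thesis .
  qed
  have Gm: "integral {0..1} (\<lambda>x. G x * cis (2 * pi * of_int m * x)) = of_real (exp (- (pi * (w + of_int m)\<^sup>2 / t)) / sqrt t)" for m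
  proof -
    have u: "uniform_limit {0..1} (\<lambda>X z. \<Sum>k\<in>X. g k z * cis (2 * pi * of_int m * z)) (\<lambda>z. \<Sum>\<^sub>\<infinity>k. g k z * cis (2 * pi * of_int m * z)) (finite_subsets_at_top UNIV)"
      by (rule Weierstrass_m_test_general[OF _ gs]) (use gb in \<open>auto simp: norm_mult\<close>)
    obtain I J where IJ: "\<And>X. ((\<lambda>z. \<Sum>k\<in>X. g k z * cis (2 * pi * of_int m * z)) has_integral I X) {0..1}"
      "((\<lambda>z. \<Sum>\<^sub>\<infinity>k. g k z * cis (2 * pi * of_int m * z)) has_integral J) {0..1}"
      "(I \<longlongrightarrow> J) (finite_subsets_at_top UNIV)"
      by (rule uniform_limit_integral[OF u]) (auto intro!: continuous_intros)
    define c where "c = complex_of_real (exp (- (pi * (w + of_int m)\<^sup>2 / t)) / sqrt t)"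
    \<comment> \<open>By orthogonality only the term with index \<open>- m\<close> survives, so the
      integrals of the partial sums are eventually constant.\<close>
    have I: "I X = c" if "finite X" "- m \<in> X" for X
    proof -
      have "(- m - w)\<^sup>2 = (w + m)\<^sup>2"
        by (simp add: power2_eq_square algebra_simps)
      then have "integral {0..1} (\<lambda>z. g k z * cis (2 * pi * of_int m * z)) = (if k = - m then c else 0)" for k
        using integral_cis_int[of "k + m"]
        by (auto simp: g_def c_def mult.assoc cis_mult ring_distribs)
      then have "integral {0..1} (\<lambda>z. \<Sum>k\<in>X. g k z * cis (2 * pi * of_int m * z)) = (\<Sum>k\<in>X. if k = - m then c else 0)"
        using that by (subst integral_sum) (auto intro!: integrable_continuous_real continuous_intros)
      then show ?thesis
        using IJ(1)[of X] that by (simp add: integral_unique)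
    qed
    have "eventually (\<lambda>X. I X = c) (finite_subsets_at_top UNIV)"
      unfolding eventually_finite_subsets_at_top by (rule exI[of _ "{- m}"]) (auto simp: I)
    then have "(I \<longlongrightarrow> c) (finite_subsets_at_top UNIV)"
      by (rule tendsto_eventually)
    then have "J = c"
      using IJ(3) tendsto_unique[OF finite_subsets_at_top_neq_bot] by metis
    then show ?thesis
      using IJ(2) by (simp add: G_def c_def infsum_cmult_left' integral_unique)
  qed
  have "F z - G z = 0"
  proof (rule fourier_uniqueness)
    fix m :: int
    have [continuous_intros]: "continuous_on {0..1} F"
      using Fc continuous_on_subset by blast
    have "integral {0..1} (\<lambda>x. F x * cis (2 * pi * of_int m * x) - G x * cis (2 * pi * of_int m * x)) =
       integral {0..1} (\<lambda>x. F x * cis (2 * pi * of_int m * x)) - integral {0..1} (\<lambda>x. G x * cis (2 * pi * of_int m * x))"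
      by (intro integral_diff integrable_continuous_real continuous_intros)
    then show "integral {0..1} (\<lambda>x. (F x - G x) * cis (2 * pi * of_int m * x)) = 0"
      by (simp add: Fm Gm left_diff_distrib)
  qed (auto intro!: continuous_intros Fc simp: Fp Gp)
  then have "F z = G z" by simp
  moreover have "G z = of_real (1 / sqrt t) * (\<Sum>\<^sub>\<infinity>m::int. of_real (exp (- (pi * (of_int m - w)\<^sup>2 / t))) * cis (2 * pi * of_int m * z))"
    unfolding G_def g_def of_real_mult mult.assoc by (rule infsum_cmult_right')
  ultimately show ?thesis
    unfolding F_def f_def by simp
qed

subsection \<open>Poisson summation over a lattice\<close>

lemma int_span_empty [simp]: "int_span {} = {0::'a::real_vector}"
proof -
  interpret module "\<lambda>(k::int) (x::'a). of_int k *\<^sub>R x" by (rule module_int_scaleR)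
  show ?thesis by (simp add: int_span_def)
qed

lemma int_span_insert: "int_span (insert b S) = {x + of_int k *\<^sub>R b | x k. x \<in> int_span S}"
proof -
  interpret module "\<lambda>(k::int) (x::'a). of_int k *\<^sub>R x" by (rule module_int_scaleR)
  show ?thesis
    unfolding int_span_def span_insert
  proof (intro set_eqI iffI)
    fix x assume "x \<in> {x. \<exists>k. x - of_int k *\<^sub>R b \<in> span S}"
    then obtain k :: int where "x - of_int k *\<^sub>R b \<in> span S" by blast
    then have "\<exists>y k. x = y + of_int k *\<^sub>R b \<and> y \<in> span S"
      by (intro exI[of _ "x - of_int k *\<^sub>R b"] exI[of _ k]) simp
    then show "x \<in> {x + of_int k *\<^sub>R b |x k. x \<in> span S}" by blast
  next
    fix x assume "x \<in> {x + of_int k *\<^sub>R b |x k. x \<in> span S}"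
    then obtain y and k :: int where "x = y + of_int k *\<^sub>R b" "y \<in> span S" by blast
    then show "x \<in> {x. \<exists>k. x - of_int k *\<^sub>R b \<in> span S}" by (auto intro!: exI[of _ k])
  qed
qed

lemma int_span_subset_span: "int_span S \<subseteq> span S"
proof -
  interpret module "\<lambda>(k::int) (x::'a). of_int k *\<^sub>R x" by (rule module_int_scaleR)
  have "subspace (Real_Vector_Spaces.span S)" unfolding subspace_def
    by (auto intro: Real_Vector_Spaces.span_add Real_Vector_Spaces.span_scale Real_Vector_Spaces.span_zero)
  then show ?thesis unfolding int_span_def
    by (intro span_minimal) (auto intro: Real_Vector_Spaces.span_base)
qed

lemma span_int_span: "span (int_span S) = span S"
proof -
  interpret module "\<lambda>(k::int) (x::'a). of_int k *\<^sub>R x" by (rule module_int_scaleR)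
  have "S \<subseteq> int_span S" unfolding int_span_def by (rule span_superset)
  then show ?thesis
    by (metis Real_Vector_Spaces.span_mono Real_Vector_Spaces.span_span int_span_subset_span subset_antisym)
qed

lemma mem_dual_int_span_insert:
  "y \<in> dual_lattice (int_span (insert b S)) \<longleftrightarrow>
     y \<in> span (insert b S) \<and> (\<forall>x\<in>int_span S. x \<bullet> y \<in> \<int>) \<and> b \<bullet> y \<in> \<int>"
proof -
  have z: "0 \<in> int_span S" 
  proof -
    interpret module "\<lambda>(k::int) (x::'a). of_int k *\<^sub>R x" by (rule module_int_scaleR)
    show ?thesis unfolding int_span_def by (rule span_zero)
  qed
  have "x \<bullet> y \<in> \<int>" if "\<forall>x\<in>int_span (insert b S). x \<bullet> y \<in> \<int>" "x \<in> int_span S" for x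
    using that unfolding int_span_insert by (force intro: exI[of _ 0])
  moreover have "b \<bullet> y \<in> \<int>" if "\<forall>x\<in>int_span (insert b S). x \<bullet> y \<in> \<int>"
  proof -
    have "0 + of_int 1 *\<^sub>R b \<in> int_span (insert b S)" unfolding int_span_insert using z by blast
    then show ?thesis using that by auto
  qed
  ultimately show ?thesis
    unfolding dual_lattice_def span_int_span
    by (auto simp: int_span_insert inner_add_left)
qed

text \<open>One Gram-Schmidt step per generator: the new direction is \<open>b\<close> minus its
  projection \<open>q\<close>. Only the finite set \<open>S\<close> matters; the ambient space may
  be infinite-dimensional and incomplete.\<close>

lemma finite_span_projection:
  fixes S :: "'a::real_inner set"
  assumes "finite S"
  shows "\<exists>p\<in>span S. \<forall>y\<in>span S. (x - p) \<bullet> y = 0"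
  using assms
proof (induction S arbitrary: x rule: finite_induct)
  case (insert b S)
  obtain q where q: "q \<in> span S" "\<And>y. y \<in> span S \<Longrightarrow> (b - q) \<bullet> y = 0"
    using insert.IH by blast
  obtain p where p: "p \<in> span S" "\<And>y. y \<in> span S \<Longrightarrow> (x - p) \<bullet> y = 0"
    using insert.IH by blast
  define d where "d = b - q"
  define c where "c = (x \<bullet> d) / (d \<bullet> d)"
  have sub: "span S \<subseteq> span (insert b S)" by (intro span_mono) auto
  have d: "d \<in> span (insert b S)"
    unfolding d_def using q sub by (intro span_diff) (auto intro: span_base)
  \<comment> \<open>If \<open>d = 0\<close>, the quotient defining \<open>c\<close> is 0 and both
    sides vanish.\<close>
  have cd: "c * (d \<bullet> d) = x \<bullet> d" by (cases "d = 0") (auto simp: c_def)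
  show ?case
  proof (intro bexI[of _ "p + c *\<^sub>R d"] ballI)
    show "p + c *\<^sub>R d \<in> span (insert b S)"
      using p d sub by (intro span_add span_scale) auto
    fix y assume "y \<in> span (insert b S)"
    then obtain k where k: "y - k *\<^sub>R b \<in> span S" by (auto simp: span_insert)
    define y' where "y' = y - k *\<^sub>R b + k *\<^sub>R q"
    have y': "y' \<in> span S" unfolding y'_def using k q by (intro span_add span_scale)
    have y: "y = y' + k *\<^sub>R d" by (simp add: y'_def d_def algebra_simps)
    have "p \<bullet> d = 0" using q(2)[OF p(1)] by (simp add: d_def inner_commute)
    then show "(x - (p + c *\<^sub>R d)) \<bullet> y = 0"
      using p(2)[OF y'] q(2)[OF y'] cd
      by (simp add: y inner_diff_left inner_add_left inner_add_right d_def[symmetric])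
  qed
qed (auto simp: span_empty)

lemma infsum_complex_of_real:
  assumes "f summable_on A"
  shows "(\<Sum>\<^sub>\<infinity>x\<in>A. complex_of_real (f x)) = of_real (infsum f A)"
  using assms by (intro infsumI) (simp add: has_sum_of_real_iff)

text \<open>After Poisson summation the shift survives only as a phase of modulus 1, which gives a
  bound independent of \<open>z\<close>.\<close>

lemma gaussian_sum_shift_le:
  fixes t z :: real
  assumes t: "t > 0"
  shows "(\<Sum>\<^sub>\<infinity>n::int. exp (- (pi * t * (of_int n + z)\<^sup>2))) \<le> 1 / sqrt t * (\<Sum>\<^sub>\<infinity>m::int. exp (- (pi * (of_int m)\<^sup>2 / t)))"
proof -
  have s: "(\<lambda>m::int. exp (- (pi * (of_int m)\<^sup>2 / t))) summable_on UNIV"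
    using summable_gaussian_int[of "1 / t" 0] t by simp
  have "(\<Sum>\<^sub>\<infinity>n::int. exp (- (pi * t * (of_int n + z)\<^sup>2))) = norm (\<Sum>\<^sub>\<infinity>n::int. complex_of_real (exp (- (pi * t * (of_int n + z)\<^sup>2))))"
    by (simp only: infsum_complex_of_real[OF summable_gaussian_int[OF t]]) (simp add: infsum_nonneg)
  also have "(\<Sum>\<^sub>\<infinity>n::int. complex_of_real (exp (- (pi * t * (of_int n + z)\<^sup>2)))) =
     of_real (1 / sqrt t) * (\<Sum>\<^sub>\<infinity>m::int. of_real (exp (- (pi * (of_int m)\<^sup>2 / t))) * cis (2 * pi * of_int m * z))"
    using poisson_gaussian_int[OF t, where z = z and w = 0] by simp
  also have "norm \<dots> = 1 / sqrt t * norm (\<Sum>\<^sub>\<infinity>m::int. complex_of_real (exp (- (pi * (of_int m)\<^sup>2 / t))) * cis (2 * pi * of_int m * z))"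
    unfolding norm_mult norm_of_real using t by simp
  also have "norm (\<Sum>\<^sub>\<infinity>m::int. complex_of_real (exp (- (pi * (of_int m)\<^sup>2 / t))) * cis (2 * pi * of_int m * z)) \<le>
     (\<Sum>\<^sub>\<infinity>m::int. norm (complex_of_real (exp (- (pi * (of_int m)\<^sup>2 / t))) * cis (2 * pi * of_int m * z)))"
    by (rule norm_infsum_bound) (use s in \<open>simp add: norm_mult\<close>)
  finally show ?thesis using t by (simp add: norm_mult divide_right_mono)
qed

definition lgauss :: "real \<Rightarrow> 'a::real_inner \<Rightarrow> real" where
  "lgauss t x = exp (- (pi * t * (x \<bullet> x)))"

lemma lgauss_pos [simp]: "lgauss t x > 0" "lgauss t x \<ge> 0" "lgauss t x \<noteq> 0"
  by (auto simp: lgauss_def)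

lemma lgauss_orthogonal:
  assumes "x \<bullet> y = 0"
  shows "lgauss t (x + y) = lgauss t x * lgauss t y"
  using assms by (simp add: lgauss_def inner_add_left inner_add_right inner_commute ring_distribs flip: exp_add)

text \<open>\<open>C\<close> is the reciprocal of the covolume; its value is not tracked, since
  self-duality determines it later. The shift and the twist range over the real span, and
  summability on both sides is included, because the induction over the basis uses all of this for
  smaller lattices.\<close>

definition poisson_holds :: "'a::real_inner set \<Rightarrow> nat \<Rightarrow> real \<Rightarrow> bool" where
  "poisson_holds L n C \<longleftrightarrow> C > 0 \<and> (\<forall>t>0.
     (\<forall>z\<in>span L. (\<lambda>x. lgauss t (x + z)) summable_on L) \<and>
     (\<forall>w\<in>span L. (\<lambda>y. lgauss t (y - w)) summable_on dual_lattice L) \<and>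
     (\<forall>z\<in>span L. \<forall>w\<in>span L.
        (\<Sum>\<^sub>\<infinity>x\<in>L. of_real (lgauss t (x + z)) * cis (2 * pi * (w \<bullet> (x + z)))) =
        complex_of_real (C * (1 / sqrt t) ^ n) *
          (\<Sum>\<^sub>\<infinity>y\<in>dual_lattice L. of_real (lgauss (1 / t) (y - w)) * cis (2 * pi * (y \<bullet> z)))))"

text \<open>Write b = p + d with p in the span of S and d orthogonal to it. The fibre of the new
  lattice over a multiple m of b is the old lattice shifted by m * p, so the hypothesis applies to
  each fibre. After exchanging the sums, the remaining sum over m is one-dimensional, and the phase
  m * (p \<bullet> y) left by the fibre enters its twist.\<close>

lemma poisson_holds_insert:
  fixes S :: "'a::real_inner set"
  assumes S: "finite S" "b \<notin> span S" and IH: "poisson_holds (int_span S) n C"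
  shows "\<exists>C'. poisson_holds (int_span (insert b S)) (Suc n) C'"
proof -
  define L where "L = int_span S"
  define D where "D = dual_lattice L"
  define L1 where "L1 = int_span (insert b S)"
  define D1 where "D1 = dual_lattice L1"
  have spanL: "span L = span S" and spanL1: "span L1 = span (insert b S)"
    by (simp_all add: L_def L1_def span_int_span)
  have LS: "L \<subseteq> span S" unfolding L_def by (rule int_span_subset_span)
  have DS: "D \<subseteq> span S" unfolding D_def dual_lattice_def by (auto simp: spanL)
  obtain p where p: "p \<in> span S" "\<And>y. y \<in> span S \<Longrightarrow> (b - p) \<bullet> y = 0"
    using finite_span_projection[OF S(1)] by blast
  define d where "d = b - p"
  define a where "a = d \<bullet> d"
  have b: "b = p + d" by (simp add: d_def)
  have "d \<noteq> 0" using S(2) p(1) by (auto simp: d_def)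
  then have a: "a > 0" by (simp add: a_def)
  have dz: "d \<bullet> y = 0" "y \<bullet> d = 0" if "y \<in> span S" for y
    using p(2)[OF that] by (simp_all add: d_def inner_commute)
  have decomp: "\<exists>v k. v \<in> span S \<and> y = v + k *\<^sub>R d" if "y \<in> span (insert b S)" for y
  proof -
    from that obtain k where k: "y - k *\<^sub>R b \<in> span S" by (auto simp: span_insert)
    then have "y - k *\<^sub>R b + k *\<^sub>R p \<in> span S" using p by (intro span_add span_scale)
    moreover have "y = (y - k *\<^sub>R b + k *\<^sub>R p) + k *\<^sub>R d" by (simp add: b algebra_simps)
    ultimately show ?thesis by blast
  qed
  have inS1: "v + k *\<^sub>R d \<in> span (insert b S)" if "v \<in> span S" for v k
  proof -
    have "span S \<subseteq> span (insert b S)" by (intro span_mono) auto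
    then show ?thesis unfolding d_def using that p(1)
      by (intro span_add span_scale span_diff) (auto intro: span_base)
  qed
  have uniq: "v = v' \<and> k = k'" if "v + k *\<^sub>R d = v' + k' *\<^sub>R d" "v \<in> span S" "v' \<in> span S" for v v' k k'
  proof -
    have "(v + k *\<^sub>R d) \<bullet> d = (v' + k' *\<^sub>R d) \<bullet> d" using that by simp
    then have "k * a = k' * a" using dz(2) that(2,3) by (simp add: inner_add_left a_def)
    then have "k = k'" using a by simp
    then show ?thesis using that by simp
  qed
  have bijL: "bij_betw (\<lambda>(n::int, x). x + of_int n *\<^sub>R b) (UNIV \<times> L) L1"
  proof -
    have inj: "x = x' \<and> n = n'" if "x \<in> L" "x' \<in> L" "x + of_int n *\<^sub>R b = x' + of_int n' *\<^sub>R b" for x x' and n n' :: int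
    proof -
      have "(x + of_int n *\<^sub>R p) + of_int n *\<^sub>R d = (x' + of_int n' *\<^sub>R p) + of_int n' *\<^sub>R d"
        using that by (simp add: b algebra_simps)
      then have "n = n'"
        using that LS p(1) by (auto dest!: uniq intro: span_add span_scale)
      then show ?thesis using that by simp
    qed
    have "inj_on (\<lambda>(n::int, x). x + of_int n *\<^sub>R b) (UNIV \<times> L)"
    proof (rule inj_onI)
      fix u v :: "int \<times> 'a"
      assume "u \<in> UNIV \<times> L" "v \<in> UNIV \<times> L"
        "(case u of (n, x) \<Rightarrow> x + of_int n *\<^sub>R b) = (case v of (n, x) \<Rightarrow> x + of_int n *\<^sub>R b)"
      then show "u = v"
        using inj[of "snd u" "snd v" "fst u" "fst v"] by (cases u; cases v) auto
    qed
    moreover have "(\<lambda>(n::int, x). x + of_int n *\<^sub>R b) ` (UNIV \<times> L) = L1"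
      unfolding L1_def int_span_insert L_def[symmetric] by (auto simp: image_def; blast)
    ultimately show ?thesis
      unfolding bij_betw_def by blast
  qed
  \<comment> \<open>A vector dual to the enlarged lattice is a dual vector \<open>y\<close> of the
    old one plus a multiple of \<open>d\<close>; the multiple is fixed by requiring the integer
    \<open>m\<close> as inner product with \<open>b\<close>.\<close>
  have bijD: "bij_betw (\<lambda>(y, m::int). y + ((of_int m - p \<bullet> y) / a) *\<^sub>R d) (D \<times> UNIV) D1"
  proof -
    have memD1: "y \<in> D1 \<longleftrightarrow> y \<in> span (insert b S) \<and> (\<forall>x\<in>L. x \<bullet> y \<in> \<int>) \<and> b \<bullet> y \<in> \<int>" for y
      unfolding D1_def L1_def L_def mem_dual_int_span_insert ..
    have memD: "y \<in> D \<longleftrightarrow> y \<in> span S \<and> (\<forall>x\<in>L. x \<bullet> y \<in> \<int>)" for y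
      unfolding D_def dual_lattice_def spanL by auto
    have "y + ((of_int m - p \<bullet> y) / a) *\<^sub>R d \<in> D1" if "y \<in> D" for y and m :: int
    proof -
      have ys: "y \<in> span S" using that memD by blast
      have "x \<bullet> (y + ((of_int m - p \<bullet> y) / a) *\<^sub>R d) = x \<bullet> y" if "x \<in> L" for x
        using dz(2)[of x] that LS by (auto simp: inner_add_right)
      moreover have "b \<bullet> (y + ((of_int m - p \<bullet> y) / a) *\<^sub>R d) = of_int m"
        using a dz(1)[OF ys] dz(2)[OF p(1)] by (simp add: b inner_add_right inner_add_left a_def[symmetric])
      ultimately show ?thesis
        using that memD memD1 inS1[OF ys] by auto
    qed
    moreover have "\<exists>v m. v \<in> D \<and> y = v + ((of_int m - p \<bullet> v) / a) *\<^sub>R d" if y: "y \<in> D1" for y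
    proof -
      obtain v k where v: "v \<in> span S" "y = v + k *\<^sub>R d"
        using decomp y memD1 by blast
      have "x \<bullet> y = x \<bullet> v" if "x \<in> L" for x
        using dz(2)[of x] that LS by (auto simp: v inner_add_right)
      then have vD: "v \<in> D" using y v memD memD1 by auto
      obtain m where m: "b \<bullet> y = of_int m"
        using y memD1 Ints_cases by metis
      have "b \<bullet> y = p \<bullet> v + k * a"
        using dz(1)[OF v(1)] dz(2)[OF p(1)] by (simp add: v b inner_add_right inner_add_left a_def[symmetric])
      then have "k = (of_int m - p \<bullet> v) / a" using a m by (simp add: field_simps)
      then show ?thesis using v vD by blast
    qed
    ultimately have im: "(\<lambda>(y, m::int). y + ((of_int m - p \<bullet> y) / a) *\<^sub>R d) ` (D \<times> UNIV) = D1"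
      by (auto simp: image_def; blast)
    have inj: "y = y' \<and> m = m'" if "y \<in> D" "y' \<in> D"
      "y + ((of_int m - p \<bullet> y) / a) *\<^sub>R d = y' + ((of_int m' - p \<bullet> y') / a) *\<^sub>R d" for y y' and m m' :: int
    proof -
      have "y = y' \<and> (of_int m - p \<bullet> y) / a = (of_int m' - p \<bullet> y') / a"
        using that DS by (intro uniq) auto
      then show ?thesis using a by auto
    qed
    have "inj_on (\<lambda>(y, m::int). y + ((of_int m - p \<bullet> y) / a) *\<^sub>R d) (D \<times> UNIV)"
    proof (rule inj_onI)
      fix u v :: "'a \<times> int"
      assume "u \<in> D \<times> UNIV" "v \<in> D \<times> UNIV"
        "(case u of (y, m) \<Rightarrow> y + ((of_int m - p \<bullet> y) / a) *\<^sub>R d) = (case v of (y, m) \<Rightarrow> y + ((of_int m - p \<bullet> y) / a) *\<^sub>R d)"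
      then show "u = v"
        using inj[of "fst u" "fst v" "snd u" "snd v"] by (cases u; cases v) auto
    qed
    then show ?thesis
      unfolding bij_betw_def using im by blast
  qed
  have C: "C > 0" using IH by (simp add: poisson_holds_def)
  have IH1: "(\<lambda>x. lgauss t (x + z)) summable_on L" if "t > 0" "z \<in> span S" for t z
    using IH that unfolding poisson_holds_def L_def[symmetric] spanL by blast
  have IH2: "(\<lambda>y. lgauss t (y - w)) summable_on D" if "t > 0" "w \<in> span S" for t w
    using IH that unfolding poisson_holds_def L_def[symmetric] spanL D_def by blast
  have IH3: "(\<Sum>\<^sub>\<infinity>x\<in>L. of_real (lgauss t (x + z)) * cis (2 * pi * (w \<bullet> (x + z)))) =
        complex_of_real (C * (1 / sqrt t) ^ n) *
          (\<Sum>\<^sub>\<infinity>y\<in>D. of_real (lgauss (1 / t) (y - w)) * cis (2 * pi * (y \<bullet> z)))"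
    if "t > 0" "z \<in> span S" "w \<in> span S" for t z w
    using IH that unfolding poisson_holds_def L_def[symmetric] spanL D_def by blast
  \<comment> \<open>The fibre over \<open>m\<close> is shifted by \<open>m\<close> times
    \<open>p\<close>, which is unbounded; a bound uniform in the shift makes the sum over the fibres
    converge.\<close>
  have shift_le: "(\<Sum>\<^sub>\<infinity>x\<in>L. lgauss t (x + z)) \<le> C * (1 / sqrt t) ^ n * (\<Sum>\<^sub>\<infinity>y\<in>D. lgauss (1 / t) y)"
    if t: "t > 0" and z: "z \<in> span S" for t z
  proof -
    have s: "lgauss (1 / t) summable_on D" using IH2[of "1 / t" 0] t by (simp add: span_zero)
    have "(\<Sum>\<^sub>\<infinity>x\<in>L. lgauss t (x + z)) = norm (\<Sum>\<^sub>\<infinity>x\<in>L. complex_of_real (lgauss t (x + z)))"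
      by (simp only: infsum_complex_of_real[OF IH1[OF t z]]) (simp add: infsum_nonneg)
    also have "(\<Sum>\<^sub>\<infinity>x\<in>L. complex_of_real (lgauss t (x + z))) = complex_of_real (C * (1 / sqrt t) ^ n) *
          (\<Sum>\<^sub>\<infinity>y\<in>D. of_real (lgauss (1 / t) y) * cis (2 * pi * (y \<bullet> z)))"
      using IH3[OF t z span_zero] by simp
    also have "norm \<dots> = C * (1 / sqrt t) ^ n * norm (\<Sum>\<^sub>\<infinity>y\<in>D. of_real (lgauss (1 / t) y) * cis (2 * pi * (y \<bullet> z)))"
      unfolding norm_mult norm_of_real using t C by simp
    also have "norm (\<Sum>\<^sub>\<infinity>y\<in>D. of_real (lgauss (1 / t) y) * cis (2 * pi * (y \<bullet> z))) \<le>
       (\<Sum>\<^sub>\<infinity>y\<in>D. norm (of_real (lgauss (1 / t) y) * cis (2 * pi * (y \<bullet> z))))"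
      by (rule norm_infsum_bound) (use s in \<open>simp add: norm_mult\<close>)
    finally show ?thesis using t C by (simp add: norm_mult mult_left_mono)
  qed
  have gd: "lgauss t (k *\<^sub>R d) = exp (- (pi * (t * a) * k\<^sup>2))" for t k
    by (simp add: lgauss_def a_def power2_eq_square mult_ac)
  have gx: "lgauss t ((x + of_int m *\<^sub>R b) + (z + \<zeta> *\<^sub>R d)) =
      exp (- (pi * (t * a) * (of_int m + \<zeta>)\<^sup>2)) * lgauss t (x + (of_int m *\<^sub>R p + z))"
    if "x \<in> L" "z \<in> span S" for t x z \<zeta> and m :: int
  proof -
    have "x + of_int m *\<^sub>R p + z \<in> span S"
      using that LS p(1) by (intro span_add span_scale) auto
    moreover have "(x + of_int m *\<^sub>R b) + (z + \<zeta> *\<^sub>R d) = (x + of_int m *\<^sub>R p + z) + (of_int m + \<zeta>) *\<^sub>R d"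
      by (simp add: b algebra_simps)
    ultimately show ?thesis
      using lgauss_orthogonal[of "x + of_int m *\<^sub>R p + z" "(of_int m + \<zeta>) *\<^sub>R d" t] dz
      by (simp add: gd add_ac)
  qed
  have gy: "lgauss t ((y + ((of_int m - p \<bullet> y) / a) *\<^sub>R d) - (w + \<omega> *\<^sub>R d)) =
      lgauss t (y - w) * exp (- (pi * (t / a) * (of_int m - (\<omega> * a + p \<bullet> y))\<^sup>2))"
    if "y \<in> D" "w \<in> span S" for t y w \<omega> and m :: int
  proof -
    have "y - w \<in> span S" using that DS by (intro span_diff) auto
    moreover have e1: "(y + ((of_int m - p \<bullet> y) / a) *\<^sub>R d) - (w + \<omega> *\<^sub>R d) = (y - w) + ((of_int m - p \<bullet> y) / a - \<omega>) *\<^sub>R d"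
      by (simp add: algebra_simps)
    moreover have "(of_int m - p \<bullet> y) / a - \<omega> = (of_int m - (\<omega> * a + p \<bullet> y)) / a"
      using a by (simp add: field_simps)
    moreover have "(t * a) * (k / a)\<^sup>2 = (t / a) * k\<^sup>2" for k
      using a by (simp add: power2_eq_square)
    ultimately show ?thesis
      using lgauss_orthogonal[of "y - w" "((of_int m - p \<bullet> y) / a - \<omega>) *\<^sub>R d" t] dz
      unfolding e1 by (simp add: gd mult.assoc)
  qed
  have sumL: "(\<lambda>(m, x). lgauss t ((x + of_int m *\<^sub>R b) + (z + \<zeta> *\<^sub>R d))) summable_on (UNIV :: int set) \<times> L"
    if t: "t > 0" and z: "z \<in> span S" for t z \<zeta>
  proof (rule summable_on_SigmaI)
    let ?g = "\<lambda>m::int. exp (- (pi * (t * a) * (of_int m + \<zeta>)\<^sup>2)) * (\<Sum>\<^sub>\<infinity>x\<in>L. lgauss t (x + (of_int m *\<^sub>R p + z)))"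
    have zs: "of_int m *\<^sub>R p + z \<in> span S" for m :: int
      using z p(1) by (intro span_add span_scale)
    show "((\<lambda>x. case (m, x) of (m, x) \<Rightarrow> lgauss t ((x + of_int m *\<^sub>R b) + (z + \<zeta> *\<^sub>R d))) has_sum ?g m) L" for m :: int
    proof -
      have "((\<lambda>x. exp (- (pi * (t * a) * (of_int m + \<zeta>)\<^sup>2)) * lgauss t (x + (of_int m *\<^sub>R p + z))) has_sum ?g m) L"
        by (intro has_sum_cmult_right has_sum_infsum IH1 t zs)
      then show ?thesis
        by (rule has_sum_cong[THEN iffD1, rotated]) (simp add: gx z)
    qed
    let ?K = "C * (1 / sqrt t) ^ n * (\<Sum>\<^sub>\<infinity>y\<in>D. lgauss (1 / t) y)"
    have "(\<lambda>m::int. exp (- (pi * (t * a) * (of_int m + \<zeta>)\<^sup>2)) * ?K) summable_on UNIV"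
      using t a by (intro summable_on_cmult_left summable_gaussian_int) auto
    then show "?g summable_on UNIV"
    proof (rule summable_on_comparison_test)
      show "?g m \<le> exp (- (pi * (t * a) * (of_int m + \<zeta>)\<^sup>2)) * ?K" for m :: int
        using shift_le[OF t zs] by (intro mult_left_mono) auto
    qed (auto intro!: mult_nonneg_nonneg infsum_nonneg)
  qed auto
  have sumD: "(\<lambda>(y, m). lgauss t ((y + ((of_int m - p \<bullet> y) / a) *\<^sub>R d) - (w + \<omega> *\<^sub>R d))) summable_on D \<times> (UNIV :: int set)"
    if t: "t > 0" and w: "w \<in> span S" for t w \<omega>
  proof (rule summable_on_SigmaI)
    let ?g = "\<lambda>y. lgauss t (y - w) * (\<Sum>\<^sub>\<infinity>m::int. exp (- (pi * (t / a) * (of_int m - (\<omega> * a + p \<bullet> y))\<^sup>2)))"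
    have ta: "t / a > 0" using t a by simp
    have sg: "(\<lambda>m::int. exp (- (pi * (t / a) * (of_int m - c)\<^sup>2))) summable_on UNIV" for c
      using summable_gaussian_int[OF ta, of "- c"] by (simp only: diff_conv_add_uminus)
    show "((\<lambda>m. case (y, m) of (y, m) \<Rightarrow> lgauss t ((y + ((of_int m - p \<bullet> y) / a) *\<^sub>R d) - (w + \<omega> *\<^sub>R d))) has_sum ?g y) UNIV" if "y \<in> D" for y
    proof -
      have "((\<lambda>m::int. lgauss t (y - w) * exp (- (pi * (t / a) * (of_int m - (\<omega> * a + p \<bullet> y))\<^sup>2))) has_sum ?g y) UNIV"
        by (intro has_sum_cmult_right has_sum_infsum sg)
      then show ?thesis
        by (rule has_sum_cong[THEN iffD1, rotated]) (simp add: gy w that)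
    qed
    let ?K = "1 / sqrt (t / a) * (\<Sum>\<^sub>\<infinity>m::int. exp (- (pi * (of_int m)\<^sup>2 / (t / a))))"
    have "(\<lambda>y. lgauss t (y - w) * ?K) summable_on D"
      by (intro summable_on_cmult_left IH2 t w)
    then show "?g summable_on D"
    proof (rule summable_on_comparison_test)
      fix y
      have "(\<Sum>\<^sub>\<infinity>m::int. exp (- (pi * (t / a) * (of_int m - (\<omega> * a + p \<bullet> y))\<^sup>2))) \<le> ?K"
        using gaussian_sum_shift_le[OF ta, of "- (\<omega> * a + p \<bullet> y)"] by (simp only: diff_conv_add_uminus)
      then show "?g y \<le> lgauss t (y - w) * ?K" by (intro mult_left_mono) auto
    qed (auto intro!: mult_nonneg_nonneg infsum_nonneg)
  qed auto
  have "poisson_holds L1 (Suc n) (C / sqrt a)"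
    unfolding poisson_holds_def spanL1 D1_def[symmetric]
  proof (intro conjI allI impI ballI)
    show "C / sqrt a > 0" using C a by simp
    fix t :: real assume t: "t > 0"
    {
      fix z assume "z \<in> span (insert b S)"
      then obtain z' \<zeta> where z: "z' \<in> span S" "z = z' + \<zeta> *\<^sub>R d" using decomp by blast
      have "(\<lambda>x. lgauss t (x + z)) \<circ> (\<lambda>(n::int, x). x + of_int n *\<^sub>R b) summable_on UNIV \<times> L"
        using sumL[OF t z(1), of \<zeta>] by (simp add: o_def case_prod_unfold z)
      then show "(\<lambda>x. lgauss t (x + z)) summable_on L1"
        using summable_on_reindex_bij_betw[OF bijL, of "\<lambda>x. lgauss t (x + z)"] by (simp add: o_def)
    }
    {
      fix w assume "w \<in> span (insert b S)"
      then obtain w' \<omega> where w: "w' \<in> span S" "w = w' + \<omega> *\<^sub>R d" using decomp by blast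
      have "(\<lambda>y. lgauss t (y - w)) \<circ> (\<lambda>(y, m::int). y + ((of_int m - p \<bullet> y) / a) *\<^sub>R d) summable_on D \<times> UNIV"
        using sumD[OF t w(1), of \<omega>] by (simp add: o_def case_prod_unfold w)
      then show "(\<lambda>y. lgauss t (y - w)) summable_on D1"
        using summable_on_reindex_bij_betw[OF bijD, of "\<lambda>y. lgauss t (y - w)"] by (simp add: o_def)
    }
    fix z w assume zw: "z \<in> span (insert b S)" "w \<in> span (insert b S)"
    obtain z' \<zeta> where z: "z' \<in> span S" "z = z' + \<zeta> *\<^sub>R d" using decomp zw by blast
    obtain w' \<omega> where w: "w' \<in> span S" "w = w' + \<omega> *\<^sub>R d" using decomp zw by blast
    define K where "K = complex_of_real (C * (1 / sqrt t) ^ n)"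
    have ta: "t * a > 0" using t a by simp
    have zs: "of_int m *\<^sub>R p + z' \<in> span S" for m :: int
      using z p(1) by (intro span_add span_scale)
    define e where "e = (\<lambda>m::int. complex_of_real (exp (- (pi * (t * a) * (of_int m + \<zeta>)\<^sup>2))) * cis (2 * pi * (\<omega> * a * (of_int m + \<zeta>))))"
    define h where "h = (\<lambda>y. complex_of_real (lgauss (1 / t) (y - w')) * cis (2 * pi * (y \<bullet> z')))"
    have wx: "w \<bullet> ((x + of_int m *\<^sub>R b) + z) = w' \<bullet> (x + (of_int m *\<^sub>R p + z')) + \<omega> * a * (of_int m + \<zeta>)"
      if "x \<in> L" for x and m :: int
    proof -
      define X where "X = x + (of_int m *\<^sub>R p + z')"
      have X: "X \<in> span S" unfolding X_def using zs[of m] that LS by (intro span_add[of x]) auto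
      have e1: "(x + of_int m *\<^sub>R b) + z = X + (of_int m + \<zeta>) *\<^sub>R d"
        by (simp add: X_def z b algebra_simps)
      show ?thesis unfolding e1 X_def[symmetric] using dz[OF X] dz[OF w(1)]
        by (simp add: w inner_add_left inner_add_right a_def mult_ac)
    qed
    have sL: "(\<lambda>(m, x). complex_of_real (lgauss t ((x + of_int m *\<^sub>R b) + z)) * cis (2 * pi * (w \<bullet> ((x + of_int m *\<^sub>R b) + z))))
        summable_on (UNIV :: int set) \<times> L"
      by (rule abs_summable_summable) (use sumL[OF t z(1), of \<zeta>] in \<open>simp add: case_prod_unfold norm_mult z\<close>)
    have "(\<Sum>\<^sub>\<infinity>x\<in>L1. of_real (lgauss t (x + z)) * cis (2 * pi * (w \<bullet> (x + z)))) =
       (\<Sum>\<^sub>\<infinity>(m, x)\<in>(UNIV :: int set) \<times> L. complex_of_real (lgauss t ((x + of_int m *\<^sub>R b) + z)) * cis (2 * pi * (w \<bullet> ((x + of_int m *\<^sub>R b) + z))))"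
      using infsum_reindex_bij_betw[OF bijL, of "\<lambda>x. complex_of_real (lgauss t (x + z)) * cis (2 * pi * (w \<bullet> (x + z)))"]
      by (simp add: case_prod_unfold)
    also have "\<dots> = (\<Sum>\<^sub>\<infinity>m::int. \<Sum>\<^sub>\<infinity>x\<in>L. complex_of_real (lgauss t ((x + of_int m *\<^sub>R b) + z)) * cis (2 * pi * (w \<bullet> ((x + of_int m *\<^sub>R b) + z))))"
      using infsum_Sigma'_banach[OF sL] by simp
    also have "\<dots> = (\<Sum>\<^sub>\<infinity>m::int. K * (\<Sum>\<^sub>\<infinity>y\<in>D. e m * (h y * cis (2 * pi * (of_int m * (p \<bullet> y))))))"
    proof (rule infsum_cong)
      fix m :: int
      have "(\<Sum>\<^sub>\<infinity>x\<in>L. complex_of_real (lgauss t ((x + of_int m *\<^sub>R b) + z)) * cis (2 * pi * (w \<bullet> ((x + of_int m *\<^sub>R b) + z)))) =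
        (\<Sum>\<^sub>\<infinity>x\<in>L. e m * (complex_of_real (lgauss t (x + (of_int m *\<^sub>R p + z'))) * cis (2 * pi * (w' \<bullet> (x + (of_int m *\<^sub>R p + z'))))))"
        by (intro infsum_cong, subst wx) (simp_all add: z gx e_def ring_distribs mult_ac flip: cis_mult)
      also have "\<dots> = e m * (K * (\<Sum>\<^sub>\<infinity>y\<in>D. complex_of_real (lgauss (1 / t) (y - w')) * cis (2 * pi * (y \<bullet> (of_int m *\<^sub>R p + z')))))"
        by (simp add: infsum_cmult_right' IH3[OF t zs w(1)] K_def)
      also have "\<dots> = K * (\<Sum>\<^sub>\<infinity>y\<in>D. e m * (h y * cis (2 * pi * (of_int m * (p \<bullet> y)))))"
        unfolding infsum_cmult_right' h_def
        by (simp add: mult_ac inner_add_right inner_commute[of p] ring_distribs flip: cis_mult)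
      finally show "(\<Sum>\<^sub>\<infinity>x\<in>L. complex_of_real (lgauss t ((x + of_int m *\<^sub>R b) + z)) * cis (2 * pi * (w \<bullet> ((x + of_int m *\<^sub>R b) + z)))) =
        K * (\<Sum>\<^sub>\<infinity>y\<in>D. e m * (h y * cis (2 * pi * (of_int m * (p \<bullet> y)))))" .
    qed
    also have "\<dots> = K * (\<Sum>\<^sub>\<infinity>m::int. \<Sum>\<^sub>\<infinity>y\<in>D. e m * (h y * cis (2 * pi * (of_int m * (p \<bullet> y)))))"
      by (rule infsum_cmult_right')
    also have "(\<Sum>\<^sub>\<infinity>m::int. \<Sum>\<^sub>\<infinity>y\<in>D. e m * (h y * cis (2 * pi * (of_int m * (p \<bullet> y))))) =
      (\<Sum>\<^sub>\<infinity>y\<in>D. \<Sum>\<^sub>\<infinity>m::int. e m * (h y * cis (2 * pi * (of_int m * (p \<bullet> y)))))"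
    proof (rule infsum_swap_banach, rule abs_summable_summable)
      have "(\<lambda>(m, y). exp (- (pi * (t * a) * (of_int m + \<zeta>)\<^sup>2)) * lgauss (1 / t) (y - w')) summable_on (UNIV :: int set) \<times> D"
      proof (rule summable_on_SigmaI)
        show "((\<lambda>y. case (m, y) of (m, y) \<Rightarrow> exp (- (pi * (t * a) * (of_int m + \<zeta>)\<^sup>2)) * lgauss (1 / t) (y - w')) has_sum
           exp (- (pi * (t * a) * (of_int m + \<zeta>)\<^sup>2)) * (\<Sum>\<^sub>\<infinity>y\<in>D. lgauss (1 / t) (y - w'))) D" for m :: int
          using t w(1) by (auto intro!: has_sum_cmult_right has_sum_infsum IH2)
        show "(\<lambda>m::int. exp (- (pi * (t * a) * (of_int m + \<zeta>)\<^sup>2)) * (\<Sum>\<^sub>\<infinity>y\<in>D. lgauss (1 / t) (y - w'))) summable_on UNIV"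
          by (intro summable_on_cmult_left summable_gaussian_int ta)
      qed auto
      then show "(\<lambda>x. norm (case x of (m, y) \<Rightarrow> e m * (h y * cis (2 * pi * (of_int m * (p \<bullet> y)))))) summable_on (UNIV :: int set) \<times> D"
        by (simp add: case_prod_unfold norm_mult e_def h_def)
    qed
    also have "\<dots> = (\<Sum>\<^sub>\<infinity>y\<in>D. of_real (1 / sqrt (t * a)) * (\<Sum>\<^sub>\<infinity>m::int. complex_of_real (lgauss (1 / t) ((y + ((of_int m - p \<bullet> y) / a) *\<^sub>R d) - w)) *
        cis (2 * pi * ((y + ((of_int m - p \<bullet> y) / a) *\<^sub>R d) \<bullet> z))))"
    proof (rule infsum_cong)
      fix y assume y: "y \<in> D"
      have ys: "y \<in> span S" using y DS by auto
      \<comment> \<open>Total twist in the direction of \<open>d\<close>: \<omega> * a comes from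
        \<open>w\<close> and p \<bullet> y from the fibres. The one-dimensional formula expects the
        phase W * (m + \<zeta>), hence the correction by \<zeta> * (p \<bullet> y) below.\<close>
      define W where "W = \<omega> * a + p \<bullet> y"
      have "(\<Sum>\<^sub>\<infinity>m::int. e m * (h y * cis (2 * pi * (of_int m * (p \<bullet> y))))) =
        (\<Sum>\<^sub>\<infinity>m::int. (h y * cis (- (2 * pi * (\<zeta> * (p \<bullet> y))))) * (complex_of_real (exp (- (pi * (t * a) * (of_int m + \<zeta>)\<^sup>2))) * cis (2 * pi * W * (of_int m + \<zeta>))))"
      proof (rule infsum_cong)
        fix m :: int
        let ?E = "complex_of_real (exp (- (pi * (t * a) * (of_int m + \<zeta>)\<^sup>2)))"
        have c: "cis (2 * pi * (\<omega> * a * (of_int m + \<zeta>))) * cis (2 * pi * (of_int m * (p \<bullet> y))) =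
          cis (- (2 * pi * (\<zeta> * (p \<bullet> y)))) * cis (2 * pi * W * (of_int m + \<zeta>))"
          unfolding cis_mult W_def by (rule arg_cong[of _ _ cis]) (simp add: algebra_simps)
        have "e m * (h y * cis (2 * pi * (of_int m * (p \<bullet> y)))) =
          h y * ?E * (cis (2 * pi * (\<omega> * a * (of_int m + \<zeta>))) * cis (2 * pi * (of_int m * (p \<bullet> y))))"
          unfolding e_def by (simp only: mult_ac)
        also have "\<dots> = (h y * cis (- (2 * pi * (\<zeta> * (p \<bullet> y))))) * (?E * cis (2 * pi * W * (of_int m + \<zeta>)))"
          unfolding c by (simp only: mult_ac)
        finally show "e m * (h y * cis (2 * pi * (of_int m * (p \<bullet> y)))) =
          (h y * cis (- (2 * pi * (\<zeta> * (p \<bullet> y))))) * (?E * cis (2 * pi * W * (of_int m + \<zeta>)))" .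
      qed
      also have "\<dots> = (h y * cis (- (2 * pi * (\<zeta> * (p \<bullet> y))))) * (of_real (1 / sqrt (t * a)) * (\<Sum>\<^sub>\<infinity>m::int. complex_of_real (exp (- (pi * (of_int m - W)\<^sup>2 / (t * a)))) * cis (2 * pi * of_int m * \<zeta>)))"
        by (simp only: infsum_cmult_right' poisson_gaussian_int[OF ta])
      also have "\<dots> = of_real (1 / sqrt (t * a)) * (\<Sum>\<^sub>\<infinity>m::int. (h y * cis (- (2 * pi * (\<zeta> * (p \<bullet> y))))) * (complex_of_real (exp (- (pi * (of_int m - W)\<^sup>2 / (t * a)))) * cis (2 * pi * of_int m * \<zeta>)))"
        unfolding infsum_cmult_right' by (simp only: mult_ac)
      also have "(\<Sum>\<^sub>\<infinity>m::int. (h y * cis (- (2 * pi * (\<zeta> * (p \<bullet> y))))) * (complex_of_real (exp (- (pi * (of_int m - W)\<^sup>2 / (t * a)))) * cis (2 * pi * of_int m * \<zeta>))) =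
        (\<Sum>\<^sub>\<infinity>m::int. complex_of_real (lgauss (1 / t) ((y + ((of_int m - p \<bullet> y) / a) *\<^sub>R d) - w)) *
        cis (2 * pi * ((y + ((of_int m - p \<bullet> y) / a) *\<^sub>R d) \<bullet> z)))"
      proof (rule infsum_cong)
        fix m :: int
        have yz: "(y + ((of_int m - p \<bullet> y) / a) *\<^sub>R d) \<bullet> z = y \<bullet> z' + (of_int m - p \<bullet> y) * \<zeta>"
          using dz[OF ys] dz[OF z(1)] a by (simp add: z inner_add_left inner_add_right a_def[symmetric])
        have c: "cis (2 * pi * ((y + ((of_int m - p \<bullet> y) / a) *\<^sub>R d) \<bullet> z)) =
          cis (2 * pi * (y \<bullet> z')) * cis (- (2 * pi * (\<zeta> * (p \<bullet> y)))) * cis (2 * pi * of_int m * \<zeta>)"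
          unfolding cis_mult yz by (rule arg_cong[of _ _ cis]) (simp add: algebra_simps)
        have g: "lgauss (1 / t) ((y + ((of_int m - p \<bullet> y) / a) *\<^sub>R d) - w) =
          lgauss (1 / t) (y - w') * exp (- (pi * (of_int m - W)\<^sup>2 / (t * a)))"
          using gy[OF y w(1), of "1 / t" m \<omega>] by (simp add: W_def w)
        show "(h y * cis (- (2 * pi * (\<zeta> * (p \<bullet> y))))) * (complex_of_real (exp (- (pi * (of_int m - W)\<^sup>2 / (t * a)))) * cis (2 * pi * of_int m * \<zeta>)) =
          complex_of_real (lgauss (1 / t) ((y + ((of_int m - p \<bullet> y) / a) *\<^sub>R d) - w)) *
        cis (2 * pi * ((y + ((of_int m - p \<bullet> y) / a) *\<^sub>R d) \<bullet> z))"
          unfolding h_def g c of_real_mult by (simp only: mult_ac)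
      qed
      finally show "(\<Sum>\<^sub>\<infinity>m::int. e m * (h y * cis (2 * pi * (of_int m * (p \<bullet> y))))) =
        of_real (1 / sqrt (t * a)) * (\<Sum>\<^sub>\<infinity>m::int. complex_of_real (lgauss (1 / t) ((y + ((of_int m - p \<bullet> y) / a) *\<^sub>R d) - w)) *
        cis (2 * pi * ((y + ((of_int m - p \<bullet> y) / a) *\<^sub>R d) \<bullet> z)))" .
    qed
    also have "\<dots> = of_real (1 / sqrt (t * a)) * (\<Sum>\<^sub>\<infinity>y\<in>D. (\<Sum>\<^sub>\<infinity>m::int. complex_of_real (lgauss (1 / t) ((y + ((of_int m - p \<bullet> y) / a) *\<^sub>R d) - w)) *
        cis (2 * pi * ((y + ((of_int m - p \<bullet> y) / a) *\<^sub>R d) \<bullet> z))))"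
      by (rule infsum_cmult_right')
    also have "(\<Sum>\<^sub>\<infinity>y\<in>D. (\<Sum>\<^sub>\<infinity>m::int. complex_of_real (lgauss (1 / t) ((y + ((of_int m - p \<bullet> y) / a) *\<^sub>R d) - w)) *
        cis (2 * pi * ((y + ((of_int m - p \<bullet> y) / a) *\<^sub>R d) \<bullet> z)))) =
      (\<Sum>\<^sub>\<infinity>(y, m)\<in>D \<times> (UNIV :: int set). complex_of_real (lgauss (1 / t) ((y + ((of_int m - p \<bullet> y) / a) *\<^sub>R d) - w)) *
        cis (2 * pi * ((y + ((of_int m - p \<bullet> y) / a) *\<^sub>R d) \<bullet> z)))"
    proof (rule infsum_Sigma'_banach, rule abs_summable_summable)
      show "(\<lambda>x. norm (case x of (y, m) \<Rightarrow> complex_of_real (lgauss (1 / t) ((y + ((of_int m - p \<bullet> y) / a) *\<^sub>R d) - w)) *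
        cis (2 * pi * ((y + ((of_int m - p \<bullet> y) / a) *\<^sub>R d) \<bullet> z)))) summable_on D \<times> (UNIV :: int set)"
        using sumD[of "1 / t" w' \<omega>] t w(1) by (simp add: case_prod_unfold norm_mult w)
    qed
    also have "\<dots> = (\<Sum>\<^sub>\<infinity>y\<in>D1. of_real (lgauss (1 / t) (y - w)) * cis (2 * pi * (y \<bullet> z)))"
      using infsum_reindex_bij_betw[OF bijD, of "\<lambda>y. complex_of_real (lgauss (1 / t) (y - w)) * cis (2 * pi * (y \<bullet> z))"]
      by (simp add: case_prod_unfold)
    finally show "(\<Sum>\<^sub>\<infinity>x\<in>L1. of_real (lgauss t (x + z)) * cis (2 * pi * (w \<bullet> (x + z)))) =
      complex_of_real (C / sqrt a * (1 / sqrt t) ^ Suc n) * (\<Sum>\<^sub>\<infinity>y\<in>D1. of_real (lgauss (1 / t) (y - w)) * cis (2 * pi * (y \<bullet> z)))"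
      by (simp add: K_def real_sqrt_mult mult_ac)
  qed
  then show ?thesis unfolding L1_def by blast
qed

theorem poisson_lattice:
  fixes B :: "'a::real_inner set"
  assumes "finite B" "independent B"
  shows "\<exists>C. poisson_holds (int_span B) (card B) C"
  using assms
proof (induction B rule: finite_induct)
  case empty
  have "poisson_holds (int_span ({}::'a set)) 0 1"
    by (auto simp: poisson_holds_def dual_lattice_def span_singleton lgauss_def)
  then show ?case by auto
next
  case (insert b S)
  then have "b \<notin> span S" "independent S" by (auto simp: independent_insert)
  then show ?case
    using insert poisson_holds_insert[of S b] by auto
qed

subsection \<open>Inversion of the moments of a theta series\<close>

lemma cosh_sums: "(\<lambda>j. x ^ (2 * j) / fact (2 * j)) sums cosh (x::real)"
proof -
  have "(\<lambda>j. if even (2 * j) then x ^ (2 * j) /\<^sub>R fact (2 * j) else 0) sums cosh x"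
    by (subst sums_mono_reindex[of "\<lambda>j. 2 * j" "\<lambda>n. if even n then x ^ n /\<^sub>R fact n else 0"])
       (auto simp: strict_mono_def cosh_converges elim!: evenE)
  then show ?thesis by (simp add: divide_inverse mult.commute)
qed

text \<open>Applied with \<open>y\<close> the square of \<open>u\<close>, so the identity is
  available for positive \<open>y\<close> only. Dividing by powers of \<open>y\<close> and letting
  \<open>y\<close> tend to 0 from the right isolates one coefficient at a time.\<close>

lemma powser_zero_right:
  fixes d :: "nat \<Rightarrow> real"
  assumes "\<And>y. y > 0 \<Longrightarrow> (\<lambda>j. d j * y ^ j) sums 0"
  shows "d j = 0"
proof (induction j rule: less_induct)
  case (less j)
  have s: "(\<lambda>i. d (i + j) * y ^ i) sums 0" if "y > 0" for y
  proof -
    have "(\<lambda>i. d (i + j) * y ^ (i + j)) sums (0 - (\<Sum>i<j. d i * y ^ i))"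
      using assms[OF that] by (rule sums_split_initial_segment)
    also have "(\<Sum>i<j. d i * y ^ i) = 0" using less by (intro sum.neutral) auto
    finally have "(\<lambda>i. d (i + j) * y ^ (i + j) / y ^ j) sums (0 / y ^ j)"
      by (intro sums_divide) simp
    then show ?thesis using that by (simp add: power_add)
  qed
  define f where "f = (\<lambda>y. \<Sum>i. d (i + j) * y ^ i)"
  have "(f \<longlongrightarrow> d (0 + j)) (at 0)"
  proof (rule powser_limit_0[of 1])
    fix y :: real assume "norm y < 1"
    then have "summable (\<lambda>i. d (i + j) * y ^ i)"
      using powser_inside[of "\<lambda>i. d (i + j)" 1 y] s[of 1] by (auto simp: sums_iff)
    then show "(\<lambda>i. d (i + j) * y ^ i) sums f y" unfolding f_def by (rule summable_sums)
  qed simp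
  then have "(f \<longlongrightarrow> d j) (at_right 0)" by (simp add: filterlim_at_split)
  moreover have "eventually (\<lambda>y. f y = 0) (at_right (0::real))"
    unfolding eventually_at_right_field using s by (auto simp: f_def sums_iff intro!: exI[of _ 1])
  then have "(f \<longlongrightarrow> 0) (at_right 0)" by (rule tendsto_eventually)
  ultimately show ?case using tendsto_unique trivial_limit_at_right_real by blast
qed

text \<open>Up to the factor \<open>(- (4 * pi\<^sup>2)) ^ j\<close>, the coefficient of
  \<open>u ^ (2 * j)\<close> in the sum of
  \<open>lgauss t x * cos (2 * pi * u * (x \<bullet> v))\<close> over the lattice.\<close>

definition moment :: "'a::real_inner set \<Rightarrow> 'a \<Rightarrow> nat \<Rightarrow> real \<Rightarrow> real" where
  "moment L v j t = (\<Sum>\<^sub>\<infinity>x\<in>L. lgauss t x * ((x \<bullet> v) ^ (2 * j) / fact (2 * j)))"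

lemma poisson_holdsD:
  assumes "poisson_holds L n C" "t > 0"
  shows "z \<in> span L \<Longrightarrow> (\<lambda>x. lgauss t (x + z)) summable_on L"
    and "z \<in> span L \<Longrightarrow> w \<in> span L \<Longrightarrow>
        (\<Sum>\<^sub>\<infinity>x\<in>L. of_real (lgauss t (x + z)) * cis (2 * pi * (w \<bullet> (x + z)))) =
        complex_of_real (C * (1 / sqrt t) ^ n) *
          (\<Sum>\<^sub>\<infinity>y\<in>dual_lattice L. of_real (lgauss (1 / t) (y - w)) * cis (2 * pi * (y \<bullet> z)))"
  using assms unfolding poisson_holds_def by blast+

text \<open>Completing the square. An exponential weight is thereby a shifted Gaussian, whose
  summability is part of \<open>poisson_holds\<close>.\<close>

lemma lgauss_exp_shift:
  fixes t c :: real
  assumes "t > 0"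
  shows "lgauss t x * exp (c * (x \<bullet> v)) =
    exp (pi * t * (c / (2 * pi * t))\<^sup>2 * (v \<bullet> v)) * lgauss t (x - (c / (2 * pi * t)) *\<^sub>R v)"
proof -
  define k where "k = c / (2 * pi * t)"
  have c: "c = 2 * pi * t * k" using assms by (simp add: k_def)
  show ?thesis
    unfolding k_def[symmetric] unfolding lgauss_def exp_add[symmetric] c
    by (rule arg_cong[of _ _ exp])
       (simp add: inner_diff_left inner_diff_right inner_commute[of v x] power2_eq_square algebra_simps)
qed

lemma lgauss_exp_summable:
  assumes "poisson_holds L n C" "v \<in> span L" "t > 0"
  shows "(\<lambda>x. lgauss t x * exp (c * (x \<bullet> v))) summable_on L"
proof -
  have "- ((c / (2 * pi * t)) *\<^sub>R v) \<in> span L"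
    using assms by (intro span_neg span_scale)
  then have "(\<lambda>x. lgauss t (x + - ((c / (2 * pi * t)) *\<^sub>R v))) summable_on L"
    by (rule poisson_holdsD(1)[OF assms(1,3)])
  then show ?thesis
    unfolding lgauss_exp_shift[OF assms(3)] by (intro summable_on_cmult_right) simp
qed

lemma lgauss_cosh_summable:
  assumes "poisson_holds L n C" "v \<in> span L" "t > 0"
  shows "(\<lambda>x. lgauss t x * cosh (c * (x \<bullet> v))) summable_on L"
proof -
  have "(\<lambda>x. (lgauss t x * exp (c * (x \<bullet> v)) + lgauss t x * exp (- c * (x \<bullet> v))) * (1 / 2)) summable_on L"
    by (intro summable_on_cmult_left summable_on_add lgauss_exp_summable[OF assms])
  also have "(\<lambda>x. (lgauss t x * exp (c * (x \<bullet> v)) + lgauss t x * exp (- c * (x \<bullet> v))) * (1 / 2)) =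
      (\<lambda>x. lgauss t x * cosh (c * (x \<bullet> v)))"
    by (simp add: cosh_def fun_eq_iff algebra_simps)
  finally show ?thesis .
qed

text \<open>Serves \<open>cos\<close> with \<open>e = - 1\<close> and \<open>cosh\<close> with
  \<open>e = 1\<close>. In both cases the double series is dominated in absolute value by the one
  for \<open>cosh\<close>, which converges, so the sums over \<open>j\<close> and \<open>x\<close>
  may be exchanged.\<close>

lemma moment_series:
  assumes P: "poisson_holds L n C" "v \<in> span L" "t > 0"
    and e: "\<bar>e\<bar> = 1" and F: "\<And>y. (\<lambda>j. e ^ j * (y ^ (2 * j) / fact (2 * j))) sums F y"
  shows "(\<lambda>j. e ^ j * c ^ (2 * j) * moment L v j t) sums (\<Sum>\<^sub>\<infinity>x\<in>L. lgauss t x * F (c * (x \<bullet> v)))"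
    and "summable (\<lambda>j. norm (e ^ j * c ^ (2 * j) * moment L v j t))"
proof -
  define g where "g = (\<lambda>x j. lgauss t x * ((c * (x \<bullet> v)) ^ (2 * j) / fact (2 * j)))"
  have g0: "g x j \<ge> 0" for x j
    unfolding g_def by (intro mult_nonneg_nonneg divide_nonneg_nonneg zero_le_even_power) auto
  have gs: "(\<lambda>(x, j). g x j) summable_on L \<times> UNIV"
  proof (rule summable_on_SigmaI)
    show "((\<lambda>j. case (x, j) of (x, j) \<Rightarrow> g x j) has_sum lgauss t x * cosh (c * (x \<bullet> v))) UNIV" for x
      unfolding prod.case g_def
      by (intro has_sum_cmult_right sums_nonneg_imp_has_sum cosh_sums divide_nonneg_nonneg zero_le_even_power) auto
  qed (use g0 lgauss_cosh_summable[OF P] in auto)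
  then have swapped: "(\<lambda>(j, x). g x j) summable_on UNIV \<times> L"
    by (subst product_swap[symmetric], subst summable_on_reindex) (auto simp: o_def case_prod_unfold)
  have inner: "(\<Sum>\<^sub>\<infinity>x\<in>L. g x j) = c ^ (2 * j) * moment L v j t" for j
    unfolding moment_def g_def infsum_cmult_right'[symmetric] by (simp add: power_mult_distrib mult_ac)
  have "(\<lambda>j. c ^ (2 * j) * moment L v j t) summable_on UNIV"
    using summable_on_Sigma_banach[OF swapped] by (simp add: inner)
  then have "summable (\<lambda>j. c ^ (2 * j) * moment L v j t)"
    by (rule summable_on_imp_summable)
  moreover have nn: "c ^ (2 * j) * moment L v j t \<ge> 0" for j
    unfolding inner[symmetric] by (intro infsum_nonneg g0)
  have "norm (e ^ j * c ^ (2 * j) * moment L v j t) = c ^ (2 * j) * moment L v j t" for j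
    unfolding mult.assoc real_norm_def abs_mult[of "e ^ j"]
    by (simp only: power_abs e power_one mult_1_left abs_of_nonneg[OF nn])
  ultimately show "summable (\<lambda>j. norm (e ^ j * c ^ (2 * j) * moment L v j t))"
    by simp
  have es: "(\<lambda>(x, j). e ^ j * g x j) summable_on L \<times> UNIV"
    by (rule abs_summable_summable)
       (use gs g0 e in \<open>simp add: case_prod_unfold abs_mult power_abs\<close>)
  then have es': "(\<lambda>(j, x). e ^ j * g x j) summable_on UNIV \<times> L"
    by (subst product_swap[symmetric], subst summable_on_reindex) (auto simp: o_def case_prod_unfold)
  have "(\<Sum>\<^sub>\<infinity>x\<in>L. lgauss t x * F (c * (x \<bullet> v))) = (\<Sum>\<^sub>\<infinity>x\<in>L. \<Sum>\<^sub>\<infinity>j. e ^ j * g x j)"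
  proof (rule infsum_cong)
    fix x
    have "((\<lambda>j. e ^ j * ((c * (x \<bullet> v)) ^ (2 * j) / fact (2 * j))) has_sum F (c * (x \<bullet> v))) UNIV"
    proof (rule norm_summable_imp_has_sum[OF _ F])
      have q: "(c * (x \<bullet> v)) ^ (2 * j) / fact (2 * j) \<ge> 0" for j
        by (intro divide_nonneg_nonneg zero_le_even_power) auto
      have "(\<lambda>j. norm (e ^ j * ((c * (x \<bullet> v)) ^ (2 * j) / fact (2 * j)))) = (\<lambda>j. (c * (x \<bullet> v)) ^ (2 * j) / fact (2 * j))"
        unfolding real_norm_def abs_mult[of "e ^ j" for j] by (simp only: power_abs e power_one mult_1_left abs_of_nonneg[OF q])
      then show "summable (\<lambda>j. norm (e ^ j * ((c * (x \<bullet> v)) ^ (2 * j) / fact (2 * j))))"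
        using cosh_sums[of "c * (x \<bullet> v)"] by (simp add: sums_iff)
    qed
    from has_sum_cmult_right[OF this, of "lgauss t x"]
    show "lgauss t x * F (c * (x \<bullet> v)) = (\<Sum>\<^sub>\<infinity>j. e ^ j * g x j)"
      by (intro infsumI[symmetric]) (simp add: g_def mult_ac)
  qed
  also have "\<dots> = (\<Sum>\<^sub>\<infinity>j. \<Sum>\<^sub>\<infinity>x\<in>L. e ^ j * g x j)"
    by (rule infsum_swap_banach[OF es])
  also have "\<dots> = (\<Sum>\<^sub>\<infinity>j. e ^ j * c ^ (2 * j) * moment L v j t)"
    by (simp add: infsum_cmult_right' inner mult.assoc)
  finally have eq: "(\<Sum>\<^sub>\<infinity>x\<in>L. lgauss t x * F (c * (x \<bullet> v))) = (\<Sum>\<^sub>\<infinity>j. e ^ j * c ^ (2 * j) * moment L v j t)" .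
  have "(\<lambda>j. e ^ j * c ^ (2 * j) * moment L v j t) summable_on UNIV"
    using summable_on_Sigma_banach[OF es'] by (simp add: infsum_cmult_right' inner mult.assoc)
  then show "(\<lambda>j. e ^ j * c ^ (2 * j) * moment L v j t) sums (\<Sum>\<^sub>\<infinity>x\<in>L. lgauss t x * F (c * (x \<bullet> v)))"
    unfolding eq by (intro has_sum_imp_sums has_sum_infsum)
qed

lemma int_span_uminus: "x \<in> int_span S \<Longrightarrow> - x \<in> int_span S"
proof -
  interpret module "\<lambda>(k::int) (x::'a). of_int k *\<^sub>R x" by (rule module_int_scaleR)
  show "x \<in> int_span S \<Longrightarrow> - x \<in> int_span S" unfolding int_span_def by (rule span_neg)
qed

text \<open>At \<open>t = 1\<close> with zero shift and twist the formula equates a positive number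
  with \<open>C\<close> times itself, so a self-dual lattice has covolume 1.\<close>

lemma self_dual_poisson:
  assumes "lattice_of_rank n L" "self_dual L"
  shows "poisson_holds L n 1" "dual_lattice L = L" "\<And>x. x \<in> L \<Longrightarrow> - x \<in> L"
proof -
  obtain B where B: "finite B" "independent B" "card B = n" "L = int_span B"
    using assms by (auto simp: lattice_of_rank_def)
  obtain C where C: "poisson_holds L n C" using poisson_lattice[OF B(1,2)] B by auto
  show D: "dual_lattice L = L" using assms by (simp add: self_dual_def)
  show "- x \<in> L" if "x \<in> L" for x
    using that unfolding B(4) by (rule int_span_uminus)
  have "0 \<in> dual_lattice L" by (simp add: dual_lattice_def span_zero)
  then have z: "0 \<in> L" by (simp only: D)
  have s: "lgauss 1 summable_on L"
    using poisson_holdsD(1)[OF C zero_less_one span_zero] by simp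
  have "(\<Sum>\<^sub>\<infinity>x\<in>L. complex_of_real (lgauss 1 x)) = of_real C * (\<Sum>\<^sub>\<infinity>x\<in>L. of_real (lgauss 1 x))"
    using poisson_holdsD(2)[OF C zero_less_one span_zero span_zero] by (simp add: D)
  moreover have "(\<Sum>\<^sub>\<infinity>x\<in>L. complex_of_real (lgauss 1 x)) \<noteq> 0"
  proof -
    have "infsum (lgauss 1) {0::'a} \<le> (\<Sum>\<^sub>\<infinity>x\<in>L. lgauss 1 x)"
      by (rule infsum_mono_neutral) (use s z in simp_all)
    then have "(\<Sum>\<^sub>\<infinity>x\<in>L. lgauss 1 x) \<noteq> 0" by (simp add: lgauss_def)
    then show ?thesis by (simp add: infsum_complex_of_real[OF s])
  qed
  ultimately have "complex_of_real C = 1" by simp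
  then have "C = 1" by simp
  then show "poisson_holds L n 1" using C by simp
qed

text \<open>Poisson summation with shift 0 and twist \<open>u *\<^sub>R v\<close> puts a Gaussian
  centred at \<open>u *\<^sub>R v\<close> on the dual side. Completing the square turns it into an
  exponential weight, and the symmetry of the lattice under negation turns the exponential into
  \<open>cosh\<close>.\<close>

lemma theta_inversion_cosh:
  assumes P: "poisson_holds L n 1" "dual_lattice L = L" "\<And>x. x \<in> L \<Longrightarrow> - x \<in> L"
    and v: "v \<in> span L" and t: "t > 0"
  shows "(\<Sum>\<^sub>\<infinity>x\<in>L. lgauss t x * cos (2 * pi * u * (x \<bullet> v))) =
     (1 / sqrt t) ^ n * exp (- (pi * (v \<bullet> v) / t) * u\<^sup>2) * (\<Sum>\<^sub>\<infinity>x\<in>L. lgauss (1 / t) x * cosh (2 * pi * u / t * (x \<bullet> v)))"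
proof -
  have t': "1 / t > 0" using t by simp
  have uv: "u *\<^sub>R v \<in> span L" using v by (rule span_scale)
  have s: "lgauss t summable_on L"
    using poisson_holdsD(1)[OF P(1) t span_zero] by simp
  define E where "E = exp (- (pi * (v \<bullet> v) / t) * u\<^sup>2)"
  define c where "c = 2 * pi * u / t"
  have k: "c / (2 * pi * (1 / t)) = u" using t by (simp add: c_def)
  have es: "(\<lambda>x. lgauss (1 / t) x * exp (c * (x \<bullet> v))) summable_on L" for c
    by (rule lgauss_exp_summable[OF P(1) v t'])
  have shift: "lgauss (1 / t) (y - u *\<^sub>R v) = E * (lgauss (1 / t) y * exp (c * (y \<bullet> v)))" for y
  proof -
    have "lgauss (1 / t) y * exp (c * (y \<bullet> v)) = exp (pi * (1 / t) * u\<^sup>2 * (v \<bullet> v)) * lgauss (1 / t) (y - u *\<^sub>R v)"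
      unfolding lgauss_exp_shift[OF t'] k ..
    moreover have "E * exp (pi * (1 / t) * u\<^sup>2 * (v \<bullet> v)) = 1"
      unfolding E_def exp_add[symmetric] by (simp add: algebra_simps)
    ultimately show ?thesis by (simp add: mult.assoc[symmetric])
  qed
  have inv: "(\<Sum>\<^sub>\<infinity>y\<in>L. lgauss (1 / t) y * exp (- c * (y \<bullet> v))) = (\<Sum>\<^sub>\<infinity>y\<in>L. lgauss (1 / t) y * exp (c * (y \<bullet> v)))"
    by (rule infsum_reindex_bij_witness[of _ uminus uminus]) (use P(3) in \<open>auto simp: lgauss_def\<close>)
  have "(\<Sum>\<^sub>\<infinity>x\<in>L. complex_of_real (lgauss t x) * cis (2 * pi * ((u *\<^sub>R v) \<bullet> x))) =
      complex_of_real ((1 / sqrt t) ^ n) * (\<Sum>\<^sub>\<infinity>y\<in>L. complex_of_real (lgauss (1 / t) (y - u *\<^sub>R v)))"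
    using poisson_holdsD(2)[OF P(1) t span_zero uv] by (simp add: P(2))
  also have "(\<Sum>\<^sub>\<infinity>y\<in>L. complex_of_real (lgauss (1 / t) (y - u *\<^sub>R v))) = complex_of_real (\<Sum>\<^sub>\<infinity>y\<in>L. lgauss (1 / t) (y - u *\<^sub>R v))"
    by (rule infsum_complex_of_real) (unfold shift, intro summable_on_cmult_right es)
  finally have "Re (\<Sum>\<^sub>\<infinity>x\<in>L. complex_of_real (lgauss t x) * cis (2 * pi * ((u *\<^sub>R v) \<bullet> x))) =
      (1 / sqrt t) ^ n * (\<Sum>\<^sub>\<infinity>y\<in>L. lgauss (1 / t) (y - u *\<^sub>R v))"
    by (simp only: Re_complex_of_real of_real_mult[symmetric])
  also have "Re (\<Sum>\<^sub>\<infinity>x\<in>L. complex_of_real (lgauss t x) * cis (2 * pi * ((u *\<^sub>R v) \<bullet> x))) =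
      (\<Sum>\<^sub>\<infinity>x\<in>L. lgauss t x * cos (2 * pi * u * (x \<bullet> v)))"
  proof (subst infsum_Re[symmetric])
    show "(\<lambda>x. complex_of_real (lgauss t x) * cis (2 * pi * ((u *\<^sub>R v) \<bullet> x))) summable_on L"
      by (rule abs_summable_summable) (use s in \<open>simp add: norm_mult\<close>)
  qed (simp add: inner_commute mult_ac)
  also have "(\<Sum>\<^sub>\<infinity>y\<in>L. lgauss (1 / t) (y - u *\<^sub>R v)) = E * (\<Sum>\<^sub>\<infinity>y\<in>L. lgauss (1 / t) y * exp (c * (y \<bullet> v)))"
    unfolding shift by (rule infsum_cmult_right')
  also have "(\<Sum>\<^sub>\<infinity>y\<in>L. lgauss (1 / t) y * exp (c * (y \<bullet> v))) =
      (\<Sum>\<^sub>\<infinity>y\<in>L. (lgauss (1 / t) y * exp (c * (y \<bullet> v)) + lgauss (1 / t) y * exp (- c * (y \<bullet> v))) * (1 / 2))"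
    by (subst infsum_cmult_left', subst infsum_add[OF es es], subst inv) simp
  also have "\<dots> = (\<Sum>\<^sub>\<infinity>y\<in>L. lgauss (1 / t) y * cosh (c * (y \<bullet> v)))"
    by (simp add: cosh_def algebra_simps)
  finally show ?thesis by (simp add: E_def c_def)
qed

text \<open>Comparison of the coefficients of u^2 in the powers of u^2 on both sides of
  \<open>theta_inversion_cosh\<close>; the sum over \<open>i\<close> is the Cauchy product of the
  exponential factor with the \<open>cosh\<close> series.\<close>

theorem moment_inversion:
  assumes P: "poisson_holds L n 1" "dual_lattice L = L" "\<And>x. x \<in> L \<Longrightarrow> - x \<in> L"
    and v: "v \<in> span L" and t: "t > 0"
  shows "(- (4 * pi\<^sup>2)) ^ j * moment L v j t = (1 / sqrt t) ^ n *
     (\<Sum>i\<le>j. (- (pi * (v \<bullet> v) / t)) ^ i / fact i * ((4 * pi\<^sup>2 / t\<^sup>2) ^ (j - i) * moment L v (j - i) (1 / t)))"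
proof -
  have t': "1 / t > 0" using t by simp
  define b where "b = - (pi * (v \<bullet> v) / t)"
  define d where "d = (\<lambda>j. (- (4 * pi\<^sup>2)) ^ j * moment L v j t - (1 / sqrt t) ^ n *
     (\<Sum>i\<le>j. b ^ i / fact i * ((4 * pi\<^sup>2 / t\<^sup>2) ^ (j - i) * moment L v (j - i) (1 / t))))"
  have "d j = 0"
  proof (rule powser_zero_right)
    fix y :: real assume y: "y > 0"
    define u where "u = sqrt y"
    have u: "u\<^sup>2 = y" using y by (simp add: u_def)
    have u2: "(c * u) ^ (2 * j) = (c\<^sup>2) ^ j * y ^ j" for c j
      by (simp add: power_mult power_mult_distrib u)
    define R where "R = (\<Sum>\<^sub>\<infinity>x\<in>L. lgauss (1 / t) x * cosh (2 * pi / t * u * (x \<bullet> v)))"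
    have 1: "(\<lambda>j. (- 1) ^ j * (2 * pi * u) ^ (2 * j) * moment L v j t) sums (\<Sum>\<^sub>\<infinity>x\<in>L. lgauss t x * cos (2 * pi * u * (x \<bullet> v)))"
      by (rule moment_series(1)[OF P(1) v t]) (use cos_paired in auto)
    have c2: "(\<lambda>j. 1 ^ j * (z ^ (2 * j) / fact (2 * j))) sums cosh z" for z :: real
      using cosh_sums[of z] by simp
    have 2: "(\<lambda>j. 1 ^ j * (2 * pi / t * u) ^ (2 * j) * moment L v j (1 / t)) sums R"
      "summable (\<lambda>j. norm (1 ^ j * (2 * pi / t * u) ^ (2 * j) * moment L v j (1 / t)))"
      unfolding R_def by (rule moment_series[OF P(1) v t' _ c2]; simp)+
    have 3: "summable (\<lambda>i. norm ((b * y) ^ i / fact i))"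
      using summable_norm_exp[of "b * y"] by (simp add: divide_inverse mult.commute)
    have 4: "(\<Sum>i. (b * y) ^ i / fact i) = exp (b * u\<^sup>2)"
      by (simp add: exp_def u divide_inverse mult.commute)
    have "(\<lambda>j. \<Sum>i\<le>j. (b * y) ^ i / fact i * (1 ^ (j - i) * (2 * pi / t * u) ^ (2 * (j - i)) * moment L v (j - i) (1 / t)))
        sums (exp (b * u\<^sup>2) * R)"
      using Cauchy_product_sums[OF 3 2(2)] 2(1) unfolding 4 by (simp add: sums_iff)
    then have 5: "(\<lambda>j. (1 / sqrt t) ^ n * (\<Sum>i\<le>j. (b * y) ^ i / fact i * (1 ^ (j - i) * (2 * pi / t * u) ^ (2 * (j - i)) * moment L v (j - i) (1 / t))))
        sums ((1 / sqrt t) ^ n * (exp (b * u\<^sup>2) * R))"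
      by (rule sums_mult)
    have "(1 / sqrt t) ^ n * (exp (b * u\<^sup>2) * R) = (\<Sum>\<^sub>\<infinity>x\<in>L. lgauss t x * cos (2 * pi * u * (x \<bullet> v)))"
      using theta_inversion_cosh[OF P v t, of u] by (simp add: R_def b_def mult.assoc)
    from sums_diff[OF 1 5[unfolded this]]
    have "(\<lambda>j. (- 1) ^ j * (2 * pi * u) ^ (2 * j) * moment L v j t -
       (1 / sqrt t) ^ n * (\<Sum>i\<le>j. (b * y) ^ i / fact i * (1 ^ (j - i) * (2 * pi / t * u) ^ (2 * (j - i)) * moment L v (j - i) (1 / t)))) sums 0"
      by simp
    also have "(\<lambda>j. (- 1) ^ j * (2 * pi * u) ^ (2 * j) * moment L v j t -
       (1 / sqrt t) ^ n * (\<Sum>i\<le>j. (b * y) ^ i / fact i * (1 ^ (j - i) * (2 * pi / t * u) ^ (2 * (j - i)) * moment L v (j - i) (1 / t)))) =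
       (\<lambda>j. d j * y ^ j)"
    proof
      fix j
      have s: "(\<Sum>i\<le>j. (b * y) ^ i / fact i * (1 ^ (j - i) * (2 * pi / t * u) ^ (2 * (j - i)) * moment L v (j - i) (1 / t))) =
        (\<Sum>i\<le>j. b ^ i / fact i * ((4 * pi\<^sup>2 / t\<^sup>2) ^ (j - i) * moment L v (j - i) (1 / t))) * y ^ j"
        unfolding sum_distrib_right
      proof (rule sum.cong[OF refl])
        fix i assume "i \<in> {..j}"
        then have "y ^ j = y ^ i * y ^ (j - i)" by (simp add: power_add[symmetric])
        moreover have "(2 * pi / t)\<^sup>2 = 4 * pi\<^sup>2 / t\<^sup>2" by (simp add: power_divide power_mult_distrib)
        ultimately show "(b * y) ^ i / fact i * (1 ^ (j - i) * (2 * pi / t * u) ^ (2 * (j - i)) * moment L v (j - i) (1 / t)) =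
          b ^ i / fact i * ((4 * pi\<^sup>2 / t\<^sup>2) ^ (j - i) * moment L v (j - i) (1 / t)) * y ^ j"
          unfolding u2 by (simp only: power_mult_distrib power_one mult_1_left) simp
      qed
      have p: "(- 1) ^ j * (2 * pi * u) ^ (2 * j) = (- (4 * pi\<^sup>2)) ^ j * y ^ j"
        unfolding u2 mult.assoc[symmetric] power_mult_distrib[symmetric] by (simp add: power_mult_distrib)
      show "(- 1) ^ j * (2 * pi * u) ^ (2 * j) * moment L v j t -
       (1 / sqrt t) ^ n * (\<Sum>i\<le>j. (b * y) ^ i / fact i * (1 ^ (j - i) * (2 * pi / t * u) ^ (2 * (j - i)) * moment L v (j - i) (1 / t))) = d j * y ^ j"
        unfolding s p d_def by (simp only: left_diff_distrib right_diff_distrib mult_ac)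
    qed
    finally show "(\<lambda>j. d j * y ^ j) sums 0" .
  qed
  then show ?thesis by (simp add: d_def b_def)
qed

subsection \<open>Functions on the upper half-plane\<close>

abbreviation uhp :: "complex set" where "uhp \<equiv> {\<tau>. Im \<tau> > 0}"

abbreviation at_ii :: "complex filter" where "at_ii \<equiv> filtercomap Im at_top"

text \<open>A square root of the usual q = exp (2 * \<i> * pi * \<tau>), so that the exponent of a
  vector is its norm and series with odd exponents, such as \<theta>3 and \<theta>4, are power
  series too.\<close>

definition nome :: "complex \<Rightarrow> complex" where
  "nome \<tau> = exp (\<i> * of_real pi * \<tau>)"

definition qev :: "complex fps \<Rightarrow> complex \<Rightarrow> complex" where
  "qev F \<tau> = eval_fps F (nome \<tau>)"

lemma open_uhp: "open uhp" and convex_uhp: "convex uhp"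
  using open_halfspace_Im_gt[of 0] convex_halfspace_Im_gt[of 0] by auto

lemma connected_uhp: "connected uhp"
  by (rule convex_connected[OF convex_uhp])

lemma uhp_inversion: "Im \<tau> > 0 \<Longrightarrow> Im (- 1 / \<tau>) > 0"
  by (simp add: Im_divide power2_eq_square add_nonneg_pos zero_less_mult_iff divide_pos_pos)

lemma norm_nome: "norm (nome \<tau>) = exp (- (pi * Im \<tau>))"
  by (simp add: nome_def norm_exp_eq_Re)

lemma norm_nome_less_1: "Im \<tau> > 0 \<Longrightarrow> norm (nome \<tau>) < 1"
  by (simp add: norm_nome)

lemma nome_nonzero [simp]: "nome \<tau> \<noteq> 0"
  by (simp add: nome_def)

lemma nome_imaginary: "nome (\<i> * of_real t) = of_real (exp (- (pi * t)))"
  by (simp add: nome_def exp_of_real[symmetric] mult_ac)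

lemma nome_plus_1: "nome (\<tau> + 1) = - nome \<tau>"
  by (simp add: nome_def ring_distribs exp_add)

lemma nome_tendsto: "(nome \<longlongrightarrow> 0) at_ii"
proof (rule tendsto_norm_zero_cancel)
  have "((\<lambda>y::real. exp (- (pi * y))) \<longlongrightarrow> 0) at_top"
    by (intro filterlim_compose[OF exp_at_bot] filterlim_compose[OF filterlim_uminus_at_bot_at_top]
        filterlim_tendsto_pos_mult_at_top[OF tendsto_const] filterlim_ident) auto
  then show "((\<lambda>\<tau>. norm (nome \<tau>)) \<longlongrightarrow> 0) at_ii"
    unfolding norm_nome by (rule filterlim_compose) (rule filterlim_filtercomap)
qed

lemma eventually_at_ii: "eventually P at_ii \<longleftrightarrow> (\<exists>Y. \<forall>\<tau>. Im \<tau> \<ge> Y \<longrightarrow> P \<tau>)"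
  unfolding eventually_filtercomap eventually_at_top_linorder by blast

lemma at_ii_neq_bot: "at_ii \<noteq> bot"
proof -
  have "\<not> eventually (\<lambda>_. False) at_ii"
    unfolding eventually_at_ii by (metis complex.sel(2) order_refl)
  then show ?thesis by auto
qed

section \<open>Evaluation of power series at the nome\<close>

lemma nome_in_disk: "Im \<tau> > 0 \<Longrightarrow> fps_conv_radius F \<ge> 1 \<Longrightarrow> ereal (norm (nome \<tau>)) < fps_conv_radius F"
  by (metis ereal_less(3) norm_nome_less_1 order_less_le_trans)

lemma nome_in_eball: "Im \<tau> > 0 \<Longrightarrow> fps_conv_radius F \<ge> 1 \<Longrightarrow> nome \<tau> \<in> eball 0 (fps_conv_radius F)"
  using nome_in_disk[of \<tau> F] by simp

lemma conv_radius_mult_ge: "fps_conv_radius F \<ge> 1 \<Longrightarrow> fps_conv_radius G \<ge> 1 \<Longrightarrow> fps_conv_radius (F * G) \<ge> 1"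
  for F G :: "complex fps"
  by (rule order_trans[OF _ fps_conv_radius_mult]) auto

lemma conv_radius_add_ge: "fps_conv_radius F \<ge> 1 \<Longrightarrow> fps_conv_radius G \<ge> 1 \<Longrightarrow> fps_conv_radius (F + G) \<ge> 1"
  for F G :: "complex fps"
  by (rule order_trans[OF _ fps_conv_radius_add]) auto

lemma conv_radius_diff_ge: "fps_conv_radius F \<ge> 1 \<Longrightarrow> fps_conv_radius G \<ge> 1 \<Longrightarrow> fps_conv_radius (F - G) \<ge> 1"
  for F G :: "complex fps"
  by (rule order_trans[OF _ fps_conv_radius_diff]) auto

lemma conv_radius_power_ge: "fps_conv_radius F \<ge> 1 \<Longrightarrow> fps_conv_radius (F ^ n) \<ge> 1"
  for F :: "complex fps"
  by (rule order_trans[OF _ fps_conv_radius_power]) auto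

lemma conv_radius_deriv_ge: "fps_conv_radius F \<ge> 1 \<Longrightarrow> fps_conv_radius (fps_deriv F) \<ge> 1"
  for F :: "complex fps"
  using fps_conv_radius_deriv[of F] by simp

lemmas conv_radius_ge = conv_radius_mult_ge conv_radius_add_ge conv_radius_diff_ge
  conv_radius_power_ge conv_radius_deriv_ge

lemma qev_mult: "Im \<tau> > 0 \<Longrightarrow> fps_conv_radius F \<ge> 1 \<Longrightarrow> fps_conv_radius G \<ge> 1 \<Longrightarrow> qev (F * G) \<tau> = qev F \<tau> * qev G \<tau>"
  unfolding qev_def by (intro eval_fps_mult nome_in_disk)

lemma qev_add: "Im \<tau> > 0 \<Longrightarrow> fps_conv_radius F \<ge> 1 \<Longrightarrow> fps_conv_radius G \<ge> 1 \<Longrightarrow> qev (F + G) \<tau> = qev F \<tau> + qev G \<tau>"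
  unfolding qev_def by (intro eval_fps_add nome_in_disk)

lemma qev_diff: "Im \<tau> > 0 \<Longrightarrow> fps_conv_radius F \<ge> 1 \<Longrightarrow> fps_conv_radius G \<ge> 1 \<Longrightarrow> qev (F - G) \<tau> = qev F \<tau> - qev G \<tau>"
  unfolding qev_def by (intro eval_fps_diff nome_in_disk)

lemma qev_power: "Im \<tau> > 0 \<Longrightarrow> fps_conv_radius F \<ge> 1 \<Longrightarrow> qev (F ^ n) \<tau> = qev F \<tau> ^ n"
  unfolding qev_def by (intro eval_fps_power nome_in_disk)

lemma qev_const [simp]: "qev (fps_const c) \<tau> = c"
  by (simp add: qev_def)

lemma qev_X_power [simp]: "qev (fps_X ^ n) \<tau> = nome \<tau> ^ n"
  by (simp add: qev_def)

lemma holomorphic_nome: "nome holomorphic_on A"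
  unfolding nome_def by (intro holomorphic_intros)

lemma holomorphic_qev [holomorphic_intros]:
  assumes "fps_conv_radius F \<ge> 1" "A \<subseteq> uhp"
  shows "qev F holomorphic_on A"
proof -
  have "(eval_fps F \<circ> nome) holomorphic_on A"
    by (rule holomorphic_on_compose_gen[OF holomorphic_nome holomorphic_on_eval_fps[OF order_refl]])
       (use assms nome_in_eball in blast)
  then show ?thesis by (simp add: qev_def[abs_def] o_def)
qed

lemma qev_has_derivative:
  assumes "fps_conv_radius F \<ge> 1" "Im \<tau> > 0"
  shows "(qev F has_field_derivative qev (fps_const (\<i> * of_real pi) * (fps_X * fps_deriv F)) \<tau>) (at \<tau>)"
proof -
  have n: "(nome has_field_derivative \<i> * of_real pi * nome \<tau>) (at \<tau>)"
    unfolding nome_def by (auto intro!: derivative_eq_intros)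
  have "(eval_fps F has_field_derivative eval_fps (fps_deriv F) (nome \<tau>)) (at (nome \<tau>))"
    by (rule has_field_derivative_eval_fps) (use nome_in_disk assms in auto)
  from DERIV_chain2[OF this n] have "((\<lambda>\<tau>. eval_fps F (nome \<tau>)) has_field_derivative
     eval_fps (fps_deriv F) (nome \<tau>) * (\<i> * of_real pi * nome \<tau>)) (at \<tau>)" .
  also have "eval_fps (fps_deriv F) (nome \<tau>) * (\<i> * of_real pi * nome \<tau>) =
      qev (fps_const (\<i> * of_real pi)) \<tau> * (qev (fps_X ^ 1) \<tau> * qev (fps_deriv F) \<tau>)"
    unfolding qev_const qev_X_power by (simp add: qev_def)
  also have "\<dots> = qev (fps_const (\<i> * of_real pi) * (fps_X * fps_deriv F)) \<tau>"
    using assms by (simp add: qev_mult conv_radius_ge)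
  finally show ?thesis by (simp add: qev_def[abs_def])
qed

lemma qev_tendsto:
  assumes "fps_conv_radius F \<ge> 1"
  shows "(qev F \<longlongrightarrow> fps_nth F 0) at_ii"
proof -
  have "0 < fps_conv_radius F"
    using assms by (rule order_less_le_trans[rotated]) simp
  then have "isCont (eval_fps F) 0"
    using continuous_on_eval_fps[of F]
    by (subst (asm) continuous_on_eq_continuous_at) (auto simp: zero_ereal_def dest!: bspec[of _ _ 0])
  then have "(eval_fps F \<longlongrightarrow> eval_fps F 0) (nhds 0)"
    by (simp add: isCont_def tendsto_at_iff_tendsto_nhds)
  from filterlim_compose[OF this nome_tendsto] show ?thesis
    by (simp add: qev_def[abs_def] eval_fps_at_0)
qed

text \<open>Carries identities obtained by Poisson summation for real \<open>t\<close> over to all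
  of the upper half-plane: the imaginary half-axis accumulates at \<i>.\<close>

lemma uhp_continuation:
  assumes "f holomorphic_on uhp" "g holomorphic_on uhp"
    and "\<And>t. t > 0 \<Longrightarrow> f (\<i> * of_real t) = g (\<i> * of_real t)" and "Im \<tau> > 0"
  shows "f \<tau> = g \<tau>"
proof -
  have "f \<tau> - g \<tau> = 0"
  proof (rule analytic_continuation[of "\<lambda>\<tau>. f \<tau> - g \<tau>" uhp "(\<lambda>t. \<i> * of_real t) ` {0<..}" \<i> \<tau>])
    show "\<i> islimpt (\<lambda>t. \<i> * of_real t) ` {0<..}"
      unfolding islimpt_approachable
    proof (intro allI impI)
      fix e :: real assume "e > 0"
      then show "\<exists>x'\<in>(\<lambda>t. \<i> * complex_of_real t) ` {0<..}. x' \<noteq> \<i> \<and> dist x' \<i> < e"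
      proof (intro bexI[of _ "\<i> * of_real (1 + e / 2)"] conjI)
        have "dist (\<i> * of_real (1 + e / 2)) \<i> = norm (\<i> * of_real (e / 2))"
          unfolding dist_norm by (rule arg_cong[of _ _ norm]) (simp add: ring_distribs)
        also have "\<dots> = e / 2"
          unfolding norm_mult norm_of_real using \<open>e > 0\<close> by simp
        finally show "dist (\<i> * of_real (1 + e / 2)) \<i> < e" using \<open>e > 0\<close> by simp
        show "\<i> * of_real (1 + e / 2) \<noteq> \<i>" using \<open>e > 0\<close> by (simp add: complex_eq_iff)
        show "\<i> * of_real (1 + e / 2) \<in> (\<lambda>t. \<i> * of_real t) ` {0<..}"
          using \<open>e > 0\<close> by (intro imageI) auto
      qed
    qed
  qed (use assms open_uhp connected_uhp in \<open>auto intro!: holomorphic_intros\<close>)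
  then show ?thesis by simp
qed

section \<open>Reduction by the modular group and its consequences for weights 0 and 2\<close>

lemma modular_reduction [consumes 1, case_names translate invert fundamental]:
  assumes "Im \<tau> > 0"
    and translate: "\<And>\<tau>. Im \<tau> > 0 \<Longrightarrow> P (\<tau> + 1) \<longleftrightarrow> P \<tau>"
    and invert: "\<And>\<tau>. Im \<tau> > 0 \<Longrightarrow> P (- 1 / \<tau>) \<Longrightarrow> P \<tau>"
    and fund: "\<And>\<tau>. Im \<tau> \<ge> 1 / 2 \<Longrightarrow> \<bar>Re \<tau>\<bar> \<le> 1 / 2 \<Longrightarrow> P \<tau>"
  shows "P \<tau>"
proof -
  have nat: "P (\<tau> + of_nat n) \<longleftrightarrow> P \<tau>" if "Im \<tau> > 0" for n \<tau>
  proof (induction n)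
    case (Suc n)
    have "P (\<tau> + of_nat n + 1) \<longleftrightarrow> P (\<tau> + of_nat n)"
      using that by (intro translate) simp
    then show ?case using Suc.IH by (simp add: add_ac)
  qed simp
  have int: "P (\<tau> + of_int n) \<longleftrightarrow> P \<tau>" if "Im \<tau> > 0" for n \<tau>
  proof (cases "n \<ge> 0")
    case True
    then show ?thesis using nat[of \<tau> "nat n"] that by simp
  next
    case False
    then show ?thesis using nat[of "\<tau> + of_int n" "nat (- n)"] that by simp
  qed
  \<comment> \<open>After translation to |Re| \<le> 1/2, a point with Im < 1/2 has squared modulus
    at most 1/2, so the inversion at least doubles its height. Stopping at height 1/2 instead of
    sqrt 3 / 2 is what guarantees this fixed factor.\<close>
  have level: "P \<tau>" if "Im \<tau> \<ge> 1 / 2 / 2 ^ N" for N \<tau>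
    using that
  proof (induction N arbitrary: \<tau>)
    case 0
    define \<sigma> where "\<sigma> = \<tau> + of_int (- round (Re \<tau>))"
    have "\<bar>Re \<sigma>\<bar> \<le> 1 / 2" using of_int_round_abs_le[of "Re \<tau>"] by (simp add: \<sigma>_def abs_minus_commute)
    then have "P \<sigma>" using 0 by (intro fund) (auto simp: \<sigma>_def)
    moreover have "P \<sigma> \<longleftrightarrow> P \<tau>"
      unfolding \<sigma>_def using 0 by (intro int) simp
    ultimately show ?case by simp
  next
    case (Suc N)
    have pos: "Im \<tau> > 0"
      by (rule less_le_trans[OF _ Suc.prems]) simp
    define \<sigma> where "\<sigma> = \<tau> + of_int (- round (Re \<tau>))"
    have s: "\<bar>Re \<sigma>\<bar> \<le> 1 / 2" "Im \<sigma> = Im \<tau>"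
      using of_int_round_abs_le[of "Re \<tau>"] by (simp_all add: \<sigma>_def abs_minus_commute)
    have "P \<sigma>"
    proof (cases "Im \<tau> \<ge> 1 / 2")
      case True
      then show ?thesis using s by (intro fund) auto
    next
      case False
      have "(Re \<sigma>)\<^sup>2 \<le> (1 / 2)\<^sup>2"
        using s(1) by (metis abs_le_square_iff abs_of_nonneg divide_nonneg_nonneg zero_le_numeral zero_le_one)
      moreover have "(Im \<sigma>)\<^sup>2 \<le> (1 / 2)\<^sup>2"
        using False pos s by (intro power_mono) auto
      moreover define R where "R = (Re \<sigma>)\<^sup>2 + (Im \<sigma>)\<^sup>2"
      ultimately have R: "R \<le> 1 / 2"
        by (simp add: power2_eq_square)
      have R0: "R > 0"
        using pos s by (simp add: R_def add_nonneg_pos)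
      have "1 / 2 / 2 ^ N * R \<le> 1 / 2 / 2 ^ N * (1 / 2)"
        using R by (intro mult_left_mono) auto
      also have "1 / 2 / 2 ^ N * (1 / 2) = (1 / 2 / 2 ^ Suc N :: real)"
        by simp
      also have "\<dots> \<le> Im \<sigma>"
        unfolding s(2) by (rule Suc.prems)
      finally have "1 / 2 / 2 ^ N \<le> Im \<sigma> / R"
        using R0 by (simp only: pos_le_divide_eq)
      moreover have "Im (- 1 / \<sigma>) = Im \<sigma> / R"
        by (simp add: Im_divide R_def)
      ultimately have "Im (- 1 / \<sigma>) \<ge> 1 / 2 / 2 ^ N"
        by (simp only:)
      then have "P (- 1 / \<sigma>)" by (rule Suc.IH)
      then show ?thesis using pos s by (auto intro: invert[of \<sigma>])
    qed
    moreover have "P \<sigma> \<longleftrightarrow> P \<tau>"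
      unfolding \<sigma>_def using pos by (rule int)
    ultimately show ?case by simp
  qed
  obtain N where "(1 / 2) ^ N < 2 * Im \<tau>"
    using real_arch_pow_inv[of "2 * Im \<tau>" "1 / 2"] assms(1) by auto
  then have "1 / 2 / 2 ^ N \<le> Im \<tau>"
    by (simp add: power_divide field_simps)
  then show ?thesis by (rule level)
qed

text \<open>High up in the strip |h| stays below its value at \<tau>, so only the compact box
  \<open>K\<close> is left, where |h| has a maximum. Invariance makes it a maximum over the whole
  half-plane, hence \<open>h\<close> is constant, and the constant contradicts the smallness high
  up.\<close>

theorem modular_function_vanishes:
  assumes hol: "h holomorphic_on uhp"
    and T: "\<And>\<tau>. Im \<tau> > 0 \<Longrightarrow> h (\<tau> + 1) = h \<tau>"
    and S: "\<And>\<tau>. Im \<tau> > 0 \<Longrightarrow> h (- 1 / \<tau>) = h \<tau>"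
    and lim: "(h \<longlongrightarrow> 0) at_ii" and "Im \<tau> > 0"
  shows "h \<tau> = 0"
proof (rule ccontr)
  assume nz: "h \<tau> \<noteq> 0"
  then have "eventually (\<lambda>\<sigma>. norm (h \<sigma>) < norm (h \<tau>)) at_ii"
    using lim unfolding tendsto_iff by (auto dest!: spec[of _ "norm (h \<tau>)"])
  then obtain Y where Y: "\<And>\<sigma>. Im \<sigma> \<ge> Y \<Longrightarrow> norm (h \<sigma>) < norm (h \<tau>)"
    unfolding eventually_at_ii by blast
  define K where "K = cbox (Complex (- 1 / 2) (1 / 2)) (Complex (1 / 2) (max Y (1 / 2)))"
  have memK: "\<sigma> \<in> K \<longleftrightarrow> \<bar>Re \<sigma>\<bar> \<le> 1 / 2 \<and> 1 / 2 \<le> Im \<sigma> \<and> Im \<sigma> \<le> max Y (1 / 2)" for \<sigma>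
    by (auto simp: K_def in_cbox_complex_iff)
  have "continuous_on K (\<lambda>\<sigma>. norm (h \<sigma>))"
    by (intro continuous_on_norm holomorphic_on_imp_continuous_on holomorphic_on_subset[OF hol]) (auto simp: memK)
  moreover have "compact K" unfolding K_def by (rule compact_cbox)
  moreover have "Complex 0 (1 / 2) \<in> K" by (simp add: memK)
  ultimately obtain \<sigma>\<^sub>0 where s0: "\<sigma>\<^sub>0 \<in> K" "\<And>\<sigma>. \<sigma> \<in> K \<Longrightarrow> norm (h \<sigma>) \<le> norm (h \<sigma>\<^sub>0)"
    using continuous_attains_sup[of K "\<lambda>\<sigma>. norm (h \<sigma>)"] by blast
  have bound: "norm (h \<sigma>) \<le> max (norm (h \<sigma>\<^sub>0)) (norm (h \<tau>))" if "Im \<sigma> \<ge> 1 / 2" "\<bar>Re \<sigma>\<bar> \<le> 1 / 2" for \<sigma>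
    using Y[of \<sigma>] s0(2)[of \<sigma>] that by (cases "Im \<sigma> \<ge> Y") (auto simp: memK)
  have strict: "norm (h \<sigma>) \<le> norm (h \<sigma>\<^sub>0) \<or> norm (h \<sigma>) < norm (h \<tau>)" if "Im \<sigma> > 0" for \<sigma>
    using that
  proof (induction rule: modular_reduction)
    case (fundamental \<sigma>)
    then show ?case using Y[of \<sigma>] s0(2)[of \<sigma>] by (cases "Im \<sigma> \<ge> Y") (auto simp: memK)
  next
    case (translate \<sigma>)
    then show ?case by (simp only: T)
  next
    case (invert \<sigma>)
    then show ?case by (simp only: S)
  qed
  have le: "norm (h \<sigma>) \<le> norm (h \<sigma>\<^sub>0)" if "Im \<sigma> > 0" for \<sigma>
    using strict[OF that] strict[OF \<open>Im \<tau> > 0\<close>] by linarith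
  have "h constant_on uhp"
    by (rule maximum_modulus_principle[OF hol open_uhp connected_uhp open_uhp order_refl, of \<sigma>\<^sub>0])
       (use s0 le in \<open>auto simp: memK\<close>)
  then have "h \<sigma> = h \<tau>" if "Im \<sigma> > 0" for \<sigma>
    using that \<open>Im \<tau> > 0\<close> unfolding constant_on_def by auto
  then show False
    using Y[of "Complex 0 (max Y 1)"] by simp
qed

text \<open>The differential of weight 2 is invariant, so a primitive \<open>G\<close> of
  \<open>g\<close> changes by a constant under the translation and under the inversion. The constant
  for the translation is also the mean of \<open>g\<close> over a horizontal unit segment, which
  tends to \<open>c\<close>; it therefore suffices to show that this period is 0.\<close>

theorem weight_2_limit_zero:
  assumes hol: "g holomorphic_on uhp"
    and T: "\<And>\<tau>. Im \<tau> > 0 \<Longrightarrow> g (\<tau> + 1) = g \<tau>"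
    and S: "\<And>\<tau>. Im \<tau> > 0 \<Longrightarrow> g (- 1 / \<tau>) = \<tau>\<^sup>2 * g \<tau>"
    and lim: "(g \<longlongrightarrow> c) at_ii"
  shows "c = 0"
proof -
  obtain G where "\<And>\<tau>. \<tau> \<in> uhp \<Longrightarrow> (G has_field_derivative g \<tau>) (at \<tau> within uhp)"
    using holomorphic_convex_primitive'[OF convex_uhp open_uhp hol] by blast
  then have G: "(G has_field_derivative g \<tau>) (at \<tau>)" if "Im \<tau> > 0" for \<tau>
    using that at_within_open[OF _ open_uhp] by auto
  have const: "\<exists>a. \<forall>\<tau>\<in>uhp. H \<tau> = a" if "\<And>\<tau>. Im \<tau> > 0 \<Longrightarrow> (H has_field_derivative 0) (at \<tau>)" for H :: "complex \<Rightarrow> complex"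
    using has_field_derivative_zero_constant[OF convex_uhp, of H] that has_field_derivative_at_within by blast
  have "\<exists>a. \<forall>\<tau>\<in>uhp. G (\<tau> + 1) - G \<tau> = a"
  proof (rule const)
    fix \<tau> assume "Im \<tau> > 0"
    then show "((\<lambda>\<tau>. G (\<tau> + 1) - G \<tau>) has_field_derivative 0) (at \<tau>)"
      by (auto intro!: derivative_eq_intros DERIV_chain2[OF G] G simp: T)
  qed
  then obtain a where a: "\<And>\<tau>. Im \<tau> > 0 \<Longrightarrow> G (\<tau> + 1) - G \<tau> = a" by auto
  have "\<exists>b. \<forall>\<tau>\<in>uhp. G (- 1 / \<tau>) - G \<tau> = b"
  proof (rule const)
    fix \<tau> assume \<tau>: "Im \<tau> > 0"
    then have nz: "\<tau> \<noteq> 0" by auto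
    have "((\<lambda>\<tau>. - 1 / \<tau>) has_field_derivative 1 / \<tau>\<^sup>2) (at \<tau>)"
      using nz by (auto intro!: derivative_eq_intros simp: power2_eq_square)
    from DERIV_chain2[OF G[OF uhp_inversion[OF \<tau>]] this]
    have "((\<lambda>\<tau>. G (- 1 / \<tau>)) has_field_derivative g \<tau>) (at \<tau>)"
      using nz unfolding S[OF \<tau>] by simp
    from DERIV_diff[OF this G[OF \<tau>]]
    show "((\<lambda>\<tau>. G (- 1 / \<tau>) - G \<tau>) has_field_derivative 0) (at \<tau>)" by simp
  qed
  then obtain b where b: "\<And>\<tau>. Im \<tau> > 0 \<Longrightarrow> G (- 1 / \<tau>) - G \<tau> = b" by auto
  have "- 1 / \<i> = \<i>" by (simp add: complex_eq_iff)
  then have b0: "b = 0" using b[of \<i>] by simp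
  \<comment> \<open>The fixed points \<open>i\<close> of \<open>S\<close> and \<open>\<rho>\<close> of \<open>ST\<close> kill the two periods of the primitive.\<close>
  define \<rho> where "\<rho> = Complex (- 1 / 2) (sqrt 3 / 2)"
  have r0: "\<rho> + 1 \<noteq> 0" by (simp add: \<rho>_def complex_eq_iff)
  have "\<rho> * (\<rho> + 1) = - 1"
    by (simp add: \<rho>_def complex_eq_iff)
  then have "- 1 / (\<rho> + 1) = \<rho>" using r0 by (metis nonzero_eq_divide_eq)
  then have a0: "a = 0" using a[of \<rho>] b[of "\<rho> + 1"] b0 by (simp add: \<rho>_def)
  \<comment> \<open>Mean value inequality for \<open>G \<tau> - c * \<tau>\<close> on a half-plane
    where its derivative is smaller than \<open>e\<close>: its increment over one translation is
    \<open>- c\<close>, as \<open>G\<close> itself does not change.\<close>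
  have "norm c \<le> e" if "e > 0" for e
  proof -
    have "eventually (\<lambda>\<tau>. norm (g \<tau> - c) < e) at_ii"
      using lim \<open>e > 0\<close> unfolding tendsto_iff dist_norm by blast
    then obtain Y where Y: "\<And>\<tau>. Im \<tau> \<ge> Y \<Longrightarrow> norm (g \<tau> - c) < e"
      unfolding eventually_at_ii by blast
    define A where "A = {\<tau>. Im \<tau> \<ge> max Y 1}"
    define \<tau> where "\<tau> = Complex 0 (max Y 1)"
    have \<tau>: "\<tau> \<in> A" "\<tau> + 1 \<in> A" "Im \<tau> > 0" by (auto simp: A_def \<tau>_def)
    have "norm ((G (\<tau> + 1) - c * (\<tau> + 1)) - (G \<tau> - c * \<tau>)) \<le> e * norm ((\<tau> + 1) - \<tau>)"
    proof (rule field_differentiable_bound[of A])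
      show "convex A" unfolding A_def by (rule convex_halfspace_Im_ge)
      fix z assume z: "z \<in> A"
      then have "Im z > 0" by (auto simp: A_def)
      then show "((\<lambda>z. G z - c * z) has_field_derivative g z - c) (at z within A)"
        by (auto intro!: derivative_eq_intros has_field_derivative_at_within[OF G])
      show "norm (g z - c) \<le> e" using Y[of z] z by (auto simp: A_def)
    qed (use \<tau> in auto)
    also have "(G (\<tau> + 1) - c * (\<tau> + 1)) - (G \<tau> - c * \<tau>) = - c"
      using a[OF \<tau>(3)] a0 by (simp add: ring_distribs)
    finally show ?thesis by simp
  qed
  then have "norm c \<le> 0" by (rule field_le_epsilon[where y = 0, simplified])
  then show ?thesis by simp
qed

subsection \<open>Jacobi-like families\<close>

text \<open>
  The transformation law is that of \<open>\<phi>(\<tau>, u) = (\<Sum>j. A\<^sub>j(\<tau>) * u ^ (2 * j))\<close> under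
  \<open>\<phi>(- 1 / \<tau>, u / \<tau>) = \<tau> ^ k * exp (\<mu> * u\<^sup>2 / \<tau>) * \<phi>(\<tau>, u)\<close>.
\<close>

definition jacobi_like :: "nat \<Rightarrow> complex \<Rightarrow> (nat \<Rightarrow> complex fps) \<Rightarrow> bool" where
  "jacobi_like k \<mu> A \<longleftrightarrow> (\<forall>j. fps_conv_radius (A j) \<ge> 1) \<and>
     (\<forall>j \<tau>. Im \<tau> > 0 \<longrightarrow> qev (A j) (- 1 / \<tau>) =
        (\<Sum>i\<le>j. \<mu> ^ i / fact i * \<tau> ^ (k + 2 * j - i) * qev (A (j - i)) \<tau>))"

text \<open>Coefficient of u^(2j) after applying \<mu> d/d\<tau> - (1/4) * (d^2/du^2 + ((2k - 1)/u)
  d/du) to \<phi>. The second part is a quarter of the radial Laplacian in dimension 2k, which sends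
  u^(2j+2) to 4 (j + 1) (k + j) u^(2j).\<close>

definition heat_step :: "nat \<Rightarrow> complex \<Rightarrow> (nat \<Rightarrow> complex fps) \<Rightarrow> nat \<Rightarrow> complex fps" where
  "heat_step k \<mu> A j = fps_const \<mu> * (fps_const (\<i> * of_real pi) * (fps_X * fps_deriv (A j)))
      - fps_const (of_nat ((j + 1) * (k + j))) * A (j + 1)"

lemma sum_rearrange:
  fixes p n t x u y q :: "nat \<Rightarrow> complex"
  shows "\<mu> * (\<Sum>i\<le>j. p i * (n i * t i * x i + u i * y i)) - B * (w + (\<Sum>i\<le>j. q i * t i * x i)) =
    (\<Sum>i\<le>j. (\<mu> * p i * n i - B * q i) * (t i * x i)) + (\<Sum>i\<le>j. p i * u i * (\<mu> * y i)) - B * w"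
  by (simp add: sum_distrib_left sum.distrib sum_subtractf algebra_simps)

text \<open>Differentiating the law of \<open>A j\<close> yields the expected terms and extra ones
  with a lower power of \<tau>. The factor (j + 1) (k + j) in \<open>heat_step\<close> is such that
  the law of \<open>A (j + 1)\<close> converts the extra terms into exactly those contributions of
  the lower \<open>A\<close> that the new law demands.\<close>

lemma jacobi_like_heat_step:
  assumes A: "jacobi_like k \<mu> A" and k: "k > 0"
  shows "jacobi_like (k + 2) \<mu> (heat_step k \<mu> A)"
proof -
  define D where "D = (\<lambda>j. fps_const (\<i> * of_real pi) * (fps_X * fps_deriv (A j)))"
  have D_eq: "fps_const (\<i> * of_real pi) * (fps_X * fps_deriv (A j)) = D j" for j
    by (simp add: D_def)
  have Ac: "fps_conv_radius (A j) \<ge> 1" for j using A by (simp add: jacobi_like_def)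
  have Dc: "fps_conv_radius (D j) \<ge> 1" for j unfolding D_def using Ac by (intro conv_radius_ge) auto
  have AT: "qev (A j) (- 1 / \<tau>) = (\<Sum>i\<le>j. \<mu> ^ i / fact i * \<tau> ^ (k + 2 * j - i) * qev (A (j - i)) \<tau>)" if "Im \<tau> > 0" for j \<tau>
    using A that by (simp add: jacobi_like_def)
  have Dd: "(qev (A j) has_field_derivative qev (D j) \<tau>) (at \<tau>)" if "Im \<tau> > 0" for j \<tau>
    unfolding D_def by (rule qev_has_derivative[OF Ac that])
  have hs: "qev (heat_step k \<mu> A j) \<tau> = \<mu> * qev (D j) \<tau> - of_nat ((j + 1) * (k + j)) * qev (A (j + 1)) \<tau>"
    if "Im \<tau> > 0" for j \<tau>
    unfolding heat_step_def D_eq using that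
    by (subst qev_diff) (auto simp: qev_mult Ac Dc intro!: conv_radius_ge)
  have DT: "qev (D j) (- 1 / \<tau>) =
     (\<Sum>i\<le>j. \<mu> ^ i / fact i * (of_nat (k + 2 * j - i) * \<tau> ^ (k + 2 * j + 1 - i) * qev (A (j - i)) \<tau>
        + \<tau> ^ (k + 2 * j + 2 - i) * qev (D (j - i)) \<tau>))" if \<tau>: "Im \<tau> > 0" for j \<tau>
  proof -
    have nz: "\<tau> \<noteq> 0" using \<tau> by auto
    have "((\<lambda>\<tau>. - 1 / \<tau>) has_field_derivative 1 / \<tau>\<^sup>2) (at \<tau>)"
      using nz by (auto intro!: derivative_eq_intros simp: power2_eq_square)
    from DERIV_chain2[OF Dd[OF uhp_inversion[OF \<tau>]] this]
    have 1: "((\<lambda>\<tau>. qev (A j) (- 1 / \<tau>)) has_field_derivative qev (D j) (- 1 / \<tau>) * (1 / \<tau>\<^sup>2)) (at \<tau>)" .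
    have 2: "((\<lambda>\<tau>. \<Sum>i\<le>j. \<mu> ^ i / fact i * \<tau> ^ (k + 2 * j - i) * qev (A (j - i)) \<tau>) has_field_derivative
       (\<Sum>i\<le>j. \<mu> ^ i / fact i * (of_nat (k + 2 * j - i) * \<tau> ^ (k + 2 * j - i - 1)) * qev (A (j - i)) \<tau>
          + \<mu> ^ i / fact i * \<tau> ^ (k + 2 * j - i) * qev (D (j - i)) \<tau>)) (at \<tau>)"
    proof (rule DERIV_sum)
      fix i
      define m where "m = k + 2 * j - i"
      have p: "((\<lambda>\<tau>. \<tau> ^ m) has_field_derivative of_nat m * \<tau> ^ (m - 1)) (at \<tau>)"
        by (auto intro!: derivative_eq_intros)
      show "((\<lambda>\<tau>. \<mu> ^ i / fact i * \<tau> ^ m * qev (A (j - i)) \<tau>) has_field_derivative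
        \<mu> ^ i / fact i * (of_nat m * \<tau> ^ (m - 1)) * qev (A (j - i)) \<tau>
          + \<mu> ^ i / fact i * \<tau> ^ m * qev (D (j - i)) \<tau>) (at \<tau>)"
        using DERIV_cmult[OF DERIV_mult[OF p Dd[OF \<tau>]], of "\<mu> ^ i / fact i" "j - i"]
        by (simp add: algebra_simps)
    qed
    have "((\<lambda>\<tau>. qev (A j) (- 1 / \<tau>)) has_field_derivative
       (\<Sum>i\<le>j. \<mu> ^ i / fact i * (of_nat (k + 2 * j - i) * \<tau> ^ (k + 2 * j - i - 1)) * qev (A (j - i)) \<tau>
          + \<mu> ^ i / fact i * \<tau> ^ (k + 2 * j - i) * qev (D (j - i)) \<tau>)) (at \<tau>)"
      by (rule has_field_derivative_transform_within_open[OF 2 open_uhp]) (use \<tau> AT in auto)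
    from DERIV_unique[OF 1 this]
    have "qev (D j) (- 1 / \<tau>) = \<tau>\<^sup>2 * (\<Sum>i\<le>j. \<mu> ^ i / fact i * (of_nat (k + 2 * j - i) * \<tau> ^ (k + 2 * j - i - 1)) * qev (A (j - i)) \<tau>
          + \<mu> ^ i / fact i * \<tau> ^ (k + 2 * j - i) * qev (D (j - i)) \<tau>)"
      using nz by (simp add: field_simps)
    also have "\<dots> = (\<Sum>i\<le>j. \<mu> ^ i / fact i * (of_nat (k + 2 * j - i) * \<tau> ^ (k + 2 * j + 1 - i) * qev (A (j - i)) \<tau>
        + \<tau> ^ (k + 2 * j + 2 - i) * qev (D (j - i)) \<tau>))"
      unfolding sum_distrib_left
    proof (rule sum.cong[OF refl])
      fix i assume "i \<in> {..j}"
      then have e: "k + 2 * j + 1 - i = 2 + (k + 2 * j - i - 1)" "k + 2 * j + 2 - i = 2 + (k + 2 * j - i)"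
        using k by auto
      show "\<tau>\<^sup>2 * (\<mu> ^ i / fact i * (of_nat (k + 2 * j - i) * \<tau> ^ (k + 2 * j - i - 1)) * qev (A (j - i)) \<tau>
          + \<mu> ^ i / fact i * \<tau> ^ (k + 2 * j - i) * qev (D (j - i)) \<tau>) =
        \<mu> ^ i / fact i * (of_nat (k + 2 * j - i) * \<tau> ^ (k + 2 * j + 1 - i) * qev (A (j - i)) \<tau>
        + \<tau> ^ (k + 2 * j + 2 - i) * qev (D (j - i)) \<tau>)"
        unfolding e power_add by (simp only: ring_distribs mult_ac)
    qed
    finally show ?thesis .
  qed
  show ?thesis
    unfolding jacobi_like_def
  proof (intro conjI allI impI)
    show "1 \<le> fps_conv_radius (heat_step k \<mu> A j)" for j
      unfolding heat_step_def using Ac by (intro conv_radius_ge) auto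
    fix j \<tau> assume \<tau>: "Im \<tau> > 0"
    define a where "a = (\<lambda>i. qev (A i) \<tau>)"
    define d where "d = (\<lambda>i. qev (D i) \<tau>)"
    have aj: "qev (A i) \<tau> = a i" and dj: "qev (D i) \<tau> = d i" for i
      by (simp_all add: a_def d_def)
    define B where "B = (\<lambda>j. of_nat ((j + 1) * (k + j)) :: complex)"
    \<comment> \<open>Amounts to (i + 1) (k + 2j - i) - (j + 1) (k + j) = - (j - i) (k + j - i - 1).
      The right-hand side is \<open>- B (j - (i + 1))\<close> for i < j and vanishes for i = j,
      which is why the sum later stops before \<open>j\<close>.\<close>
    have coeff: "\<mu> * (\<mu> ^ i / fact i) * of_nat (k + 2 * j - i) - B j * (\<mu> ^ (i + 1) / fact (i + 1))
        = - (\<mu> ^ (i + 1) / fact (i + 1) * (of_nat (j - i) * (of_nat (k + j) - of_nat (i + 1))))" if ij: "i \<le> j" for i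
    proof -
      define c where "c = \<mu> ^ (i + 1) / fact (i + 1)"
      define N where "N = (of_nat (k + 2 * j - i) :: complex)"
      define I where "I = (of_nat (i + 1) :: complex)"
      define X where "X = (of_nat (j - i) * (of_nat (k + j) - I) :: complex)"
      obtain l where l: "j = i + l" using le_Suc_ex[OF ij] by auto
      have "k + 2 * (i + l) - i = k + i + 2 * l" by simp
      then have e: "N * I = B j - X"
        unfolding N_def I_def X_def B_def l by (simp only: add_diff_cancel_left') (simp add: algebra_simps)
      have "I \<noteq> 0" unfolding I_def by (simp del: of_nat_Suc)
      moreover have "fact (i + 1) = I * fact i" unfolding I_def by simp
      ultimately have m: "\<mu> * (\<mu> ^ i / fact i) = c * I"
        unfolding c_def by simp
      have "\<mu> * (\<mu> ^ i / fact i) * N = c * (N * I)"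
        unfolding m by (simp only: mult_ac)
      then have "\<mu> * (\<mu> ^ i / fact i) * N - B j * c = - (c * X)"
        unfolding e by (simp add: right_diff_distrib mult.commute[of "B j"])
      then show ?thesis unfolding c_def N_def X_def I_def .
    qed
    have "qev (heat_step k \<mu> A j) (- 1 / \<tau>) = \<mu> * qev (D j) (- 1 / \<tau>) - B j * qev (A (j + 1)) (- 1 / \<tau>)"
      unfolding B_def by (rule hs[OF uhp_inversion[OF \<tau>]])
    also have "qev (A (j + 1)) (- 1 / \<tau>) = (\<Sum>i\<le>Suc j. \<mu> ^ i / fact i * \<tau> ^ (k + 2 * (j + 1) - i) * a (j + 1 - i))"
      using AT[OF \<tau>, of "j + 1"] by (simp add: a_def)
    also have "\<dots> = \<tau> ^ (k + 2 * j + 2) * a (j + 1) + (\<Sum>i\<le>j. \<mu> ^ (i + 1) / fact (i + 1) * \<tau> ^ (k + 2 * j + 1 - i) * a (j - i))"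
      by (subst sum.atMost_Suc_shift) simp
    also have "\<mu> * qev (D j) (- 1 / \<tau>) - B j * \<dots> =
       (\<Sum>i\<le>j. (\<mu> * (\<mu> ^ i / fact i) * of_nat (k + 2 * j - i) - B j * (\<mu> ^ (i + 1) / fact (i + 1))) * (\<tau> ^ (k + 2 * j + 1 - i) * a (j - i)))
       + (\<Sum>i\<le>j. \<mu> ^ i / fact i * \<tau> ^ (k + 2 * j + 2 - i) * (\<mu> * d (j - i))) - B j * (\<tau> ^ (k + 2 * j + 2) * a (j + 1))"
      unfolding DT[OF \<tau>] aj dj
      by (rule sum_rearrange)
    also have "(\<Sum>i\<le>j. (\<mu> * (\<mu> ^ i / fact i) * of_nat (k + 2 * j - i) - B j * (\<mu> ^ (i + 1) / fact (i + 1))) * (\<tau> ^ (k + 2 * j + 1 - i) * a (j - i)))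
       = - (\<Sum>i\<le>j. \<mu> ^ (i + 1) / fact (i + 1) * (of_nat (j - i) * (of_nat (k + j) - of_nat (i + 1))) * (\<tau> ^ (k + 2 * j + 1 - i) * a (j - i)))"
      unfolding sum_negf[symmetric] by (intro sum.cong refl) (simp only: coeff atMost_iff minus_mult_left)
    also have "(\<Sum>i\<le>j. \<mu> ^ (i + 1) / fact (i + 1) * (of_nat (j - i) * (of_nat (k + j) - of_nat (i + 1))) * (\<tau> ^ (k + 2 * j + 1 - i) * a (j - i)))
       = (\<Sum>i<j. \<mu> ^ (i + 1) / fact (i + 1) * \<tau> ^ (k + 2 * j + 1 - i) * (B (j - (i + 1)) * a (j - i)))"
    proof -
      have "(\<Sum>i\<le>j. \<mu> ^ (i + 1) / fact (i + 1) * (of_nat (j - i) * (of_nat (k + j) - of_nat (i + 1))) * (\<tau> ^ (k + 2 * j + 1 - i) * a (j - i)))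
        = (\<Sum>i<j. \<mu> ^ (i + 1) / fact (i + 1) * (of_nat (j - i) * (of_nat (k + j) - of_nat (i + 1))) * (\<tau> ^ (k + 2 * j + 1 - i) * a (j - i)))"
        by (rule sum.mono_neutral_right) auto
      also have "\<dots> = (\<Sum>i<j. \<mu> ^ (i + 1) / fact (i + 1) * \<tau> ^ (k + 2 * j + 1 - i) * (B (j - (i + 1)) * a (j - i)))"
      proof (rule sum.cong[OF refl])
        fix i assume "i \<in> {..<j}"
        then have "i + 1 \<le> j" by auto
        from le_Suc_ex[OF this] obtain l where l: "j = i + 1 + l" by auto
        have "B (j - (i + 1)) = of_nat (j - i) * (of_nat (k + j) - of_nat (i + 1))"
          unfolding l B_def by (simp add: algebra_simps)
        then show "\<mu> ^ (i + 1) / fact (i + 1) * (of_nat (j - i) * (of_nat (k + j) - of_nat (i + 1))) * (\<tau> ^ (k + 2 * j + 1 - i) * a (j - i))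
          = \<mu> ^ (i + 1) / fact (i + 1) * \<tau> ^ (k + 2 * j + 1 - i) * (B (j - (i + 1)) * a (j - i))"
          by (simp only: mult_ac)
      qed
      finally show ?thesis .
    qed
    also have "- (\<Sum>i<j. \<mu> ^ (i + 1) / fact (i + 1) * \<tau> ^ (k + 2 * j + 1 - i) * (B (j - (i + 1)) * a (j - i)))
        + (\<Sum>i\<le>j. \<mu> ^ i / fact i * \<tau> ^ (k + 2 * j + 2 - i) * (\<mu> * d (j - i))) - B j * (\<tau> ^ (k + 2 * j + 2) * a (j + 1)) =
       (\<Sum>i\<le>j. \<mu> ^ i / fact i * \<tau> ^ (k + 2 * j + 2 - i) * (\<mu> * d (j - i)))
        - (\<Sum>i\<le>j. \<mu> ^ i / fact i * \<tau> ^ (k + 2 * j + 2 - i) * (B (j - i) * a (j - i + 1)))"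
    proof -
      have "(\<Sum>i\<le>j. \<mu> ^ i / fact i * \<tau> ^ (k + 2 * j + 2 - i) * (B (j - i) * a (j - i + 1))) =
         (\<Sum>i<Suc j. \<mu> ^ i / fact i * \<tau> ^ (k + 2 * j + 2 - i) * (B (j - i) * a (j - i + 1)))"
        by (simp only: lessThan_Suc_atMost)
      also have "\<dots> = \<tau> ^ (k + 2 * j + 2) * (B j * a (j + 1)) +
         (\<Sum>i<j. \<mu> ^ Suc i / fact (Suc i) * \<tau> ^ (k + 2 * j + 2 - Suc i) * (B (j - Suc i) * a (j - Suc i + 1)))"
        by (subst sum.lessThan_Suc_shift) simp
      also have "(\<Sum>i<j. \<mu> ^ Suc i / fact (Suc i) * \<tau> ^ (k + 2 * j + 2 - Suc i) * (B (j - Suc i) * a (j - Suc i + 1))) =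
         (\<Sum>i<j. \<mu> ^ (i + 1) / fact (i + 1) * \<tau> ^ (k + 2 * j + 1 - i) * (B (j - (i + 1)) * a (j - i)))"
      proof (rule sum.cong[OF refl])
        fix i assume "i \<in> {..<j}"
        then have "j - Suc i + 1 = j - i" "k + 2 * j + 2 - Suc i = k + 2 * j + 1 - i" by auto
        then show "\<mu> ^ Suc i / fact (Suc i) * \<tau> ^ (k + 2 * j + 2 - Suc i) * (B (j - Suc i) * a (j - Suc i + 1)) =
          \<mu> ^ (i + 1) / fact (i + 1) * \<tau> ^ (k + 2 * j + 1 - i) * (B (j - (i + 1)) * a (j - i))"
          by (simp only: Suc_eq_plus1)
      qed
      finally show ?thesis by (simp add: algebra_simps del: fact_Suc power_Suc)
    qed
    also have "\<dots> = (\<Sum>i\<le>j. \<mu> ^ i / fact i * \<tau> ^ (k + 2 + 2 * j - i) * qev (heat_step k \<mu> A (j - i)) \<tau>)"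
      unfolding sum_subtractf[symmetric]
      by (intro sum.cong refl, subst hs[OF \<tau>]) (simp add: a_def d_def B_def ring_distribs add_ac)
    finally show "qev (heat_step k \<mu> A j) (- 1 / \<tau>) =
      (\<Sum>i\<le>j. \<mu> ^ i / fact i * \<tau> ^ (k + 2 + 2 * j - i) * qev (heat_step k \<mu> A (j - i)) \<tau>)" .
  qed
qed

subsection \<open>Zonal theta series\<close>

text \<open>The index set is arbitrary so that one construction yields both the weighted theta
  series of a lattice and the Jacobi theta functions indexed by the integers.\<close>

definition level_fps :: "'i set \<Rightarrow> ('i \<Rightarrow> nat) \<Rightarrow> ('i \<Rightarrow> complex) \<Rightarrow> complex fps" where
  "level_fps I q w = Abs_fps (\<lambda>m. \<Sum>i | i \<in> I \<and> q i = m. w i)"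

context
  fixes I :: "'i set" and q :: "'i \<Rightarrow> nat" and w :: "'i \<Rightarrow> complex"
  assumes summ: "\<And>r. 0 < r \<Longrightarrow> r < 1 \<Longrightarrow> (\<lambda>i. norm (w i) * r ^ q i) summable_on I"
    and fin: "\<And>m. finite {i \<in> I. q i = m}"
begin

lemma level_fps_sums:
  assumes z: "norm z < 1"
  shows "(\<lambda>m. fps_nth (level_fps I q w) m * z ^ m) sums (\<Sum>\<^sub>\<infinity>i\<in>I. w i * z ^ q i)"
proof -
  define r where "r = max (norm z) (1 / 2)"
  have r: "0 < r" "r < 1" "norm z \<le> r" using z by (auto simp: r_def)
  define g where "g = (\<lambda>(m, i). w i * z ^ q i)"
  have bij: "bij_betw snd (SIGMA m:UNIV. {i \<in> I. q i = m}) I"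
    by (rule bij_betwI[where g = "\<lambda>i. (q i, i)"]) auto
  have "(\<lambda>i. norm (w i * z ^ q i)) summable_on I"
  proof (rule summable_on_comparison_test[OF summ[OF r(1,2)]])
    fix i
    show "norm (w i * z ^ q i) \<le> norm (w i) * r ^ q i"
      unfolding norm_mult norm_power using r by (intro mult_left_mono power_mono) auto
  qed auto
  then have abs: "(\<lambda>i. w i * z ^ q i) summable_on I"
    by (rule abs_summable_summable)
  then have "(\<lambda>i. w (snd i) * z ^ q (snd i)) summable_on (SIGMA m:UNIV. {i \<in> I. q i = m})"
    using summable_on_reindex_bij_betw[OF bij, of "\<lambda>i. w i * z ^ q i"] by simp
  then have S: "(\<lambda>(m, i). w i * z ^ q i) summable_on (SIGMA m:UNIV. {i \<in> I. q i = m})"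
    by (simp add: case_prod_unfold)
  have inner: "(\<Sum>\<^sub>\<infinity>i | i \<in> I \<and> q i = m. w i * z ^ q i) = fps_nth (level_fps I q w) m * z ^ m" for m
    unfolding level_fps_def using fin[of m] by (simp add: sum_distrib_right)
  have "(\<lambda>m. fps_nth (level_fps I q w) m * z ^ m) summable_on UNIV"
    using summable_on_Sigma_banach[OF S] by (simp add: inner)
  then have "((\<lambda>m. fps_nth (level_fps I q w) m * z ^ m) has_sum (\<Sum>\<^sub>\<infinity>m. fps_nth (level_fps I q w) m * z ^ m)) UNIV"
    by (rule has_sum_infsum)
  moreover have "(\<Sum>\<^sub>\<infinity>m. fps_nth (level_fps I q w) m * z ^ m) = (\<Sum>\<^sub>\<infinity>i\<in>I. w i * z ^ q i)"
    using infsum_Sigma'_banach[OF S] infsum_reindex_bij_betw[OF bij, of "\<lambda>i. w i * z ^ q i"]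
    by (simp add: inner case_prod_unfold)
  ultimately show ?thesis by (auto dest: has_sum_imp_sums)
qed

lemma eval_level_fps: "norm z < 1 \<Longrightarrow> eval_fps (level_fps I q w) z = (\<Sum>\<^sub>\<infinity>i\<in>I. w i * z ^ q i)"
  using level_fps_sums[of z] by (simp add: eval_fps_def sums_iff)

lemma level_fps_conv_radius: "fps_conv_radius (level_fps I q w) \<ge> 1"
  unfolding fps_conv_radius_def
proof (rule conv_radius_geI_ex)
  fix r :: real assume "0 < r" "ereal r < 1"
  then show "\<exists>z. norm z = r \<and> summable (\<lambda>n. fps_nth (level_fps I q w) n * z ^ n)"
    using level_fps_sums[of "of_real r"] by (intro exI[of _ "of_real r"]) (auto simp: sums_iff)
qed

end

section \<open>Theta series of an even lattice with even powers of a linear form\<close>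

lemma qev_mult_fps_const: "Im \<tau> > 0 \<Longrightarrow> fps_conv_radius F \<ge> 1 \<Longrightarrow> qev (fps_const c * F) \<tau> = c * qev F \<tau>"
  by (simp add: qev_mult)

text \<open>The floor assigns a natural number to every vector; on an even lattice it changes
  nothing and provides the exponents of power series.\<close>

definition norm_level :: "'a::real_inner \<Rightarrow> nat" where
  "norm_level x = nat \<lfloor>x \<bullet> x\<rfloor>"

definition theta_coeffs :: "'a::real_inner set \<Rightarrow> 'a \<Rightarrow> nat \<Rightarrow> complex fps" where
  "theta_coeffs L v j = fps_const (of_real ((- (4 * pi\<^sup>2)) ^ j)) *
     level_fps L norm_level (\<lambda>x. of_real ((x \<bullet> v) ^ (2 * j) / fact (2 * j)))"

lemma even_lattice_norm_level:
  assumes "even_lattice L" "x \<in> L"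
  shows "x \<bullet> x = real (norm_level x)" "even (norm_level x)"
proof -
  obtain k :: int where k: "x \<bullet> x = 2 * of_int k"
    using assms by (auto simp: even_lattice_def)
  then have k0: "k \<ge> 0" using inner_ge_zero[of x] by simp
  have "\<lfloor>x \<bullet> x\<rfloor> = 2 * k" unfolding k by (simp add: floor_eq_iff)
  then have e: "norm_level x = nat (2 * k)" by (simp add: norm_level_def)
  show "x \<bullet> x = real (norm_level x)" unfolding e k using k0 by simp
  show "even (norm_level x)" unfolding e using k0 by (simp add: even_nat_iff)
qed

lemma even_lattice_level_iff:
  assumes "even_lattice L" "x \<in> L"
  shows "norm_level x = m \<longleftrightarrow> x \<bullet> x = real m"
  using even_lattice_norm_level[OF assms] by simp

lemma lgauss_level:
  assumes "even_lattice L" "x \<in> L"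
  shows "lgauss t x = exp (- (pi * t)) ^ norm_level x"
  unfolding lgauss_def exp_of_nat_mult[symmetric] even_lattice_norm_level(1)[OF assms] by simp

text \<open>Finiteness comes from convergence: \<open>lgauss 1\<close> is summable over
  \<open>L\<close> and is a positive constant on a shell.\<close>

lemma poisson_finite_shell:
  assumes P: "poisson_holds L n C" and ev: "even_lattice L"
  shows "finite {x \<in> L. norm_level x = m}"
proof (rule ccontr)
  assume inf: "infinite {x \<in> L. norm_level x = m}"
  have "lgauss 1 summable_on L"
    using poisson_holdsD(1)[OF P zero_less_one span_zero] by simp
  then have "lgauss 1 summable_on {x \<in> L. norm_level x = m}"
    by (rule summable_on_subset_banach) auto
  then have "(\<lambda>x::'a. exp (- (pi * 1)) ^ m) summable_on {x \<in> L. norm_level x = m}"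
    by (rule summable_on_cong[THEN iffD1, rotated]) (simp add: lgauss_level[OF ev])
  then show False using infsum_diverge_constant[OF inf, of "exp (- (pi * 1)) ^ m"] by simp
qed

text \<open>With \<open>r = exp (- (pi * t))\<close> the powers of \<open>r\<close> are Gaussian
  weights, and each even power with its factorial is one term of the \<open>cosh\<close>
  series.\<close>

lemma theta_level_summable:
  assumes P: "poisson_holds L n C" and ev: "even_lattice L" and v: "v \<in> span L" and r: "0 < r" "r < 1"
  shows "(\<lambda>x. norm (complex_of_real ((x \<bullet> v) ^ (2 * j) / fact (2 * j))) * r ^ norm_level x) summable_on L"
proof -
  define t where "t = - ln r / pi"
  have t: "t > 0" using r by (simp add: t_def divide_neg_pos)
  have rt: "exp (- (pi * t)) = r" using r by (simp add: t_def)
  show ?thesis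
  proof (rule summable_on_comparison_test[OF lgauss_cosh_summable[OF P v t, of 1]])
    fix x assume x: "x \<in> L"
    have nn: "(x \<bullet> v) ^ (2 * j) / fact (2 * j) \<ge> 0" for j
      by (intro divide_nonneg_nonneg zero_le_even_power) auto
    have "(x \<bullet> v) ^ (2 * j) / fact (2 * j) \<le> cosh (x \<bullet> v)"
      using sum_le_suminf[of "\<lambda>j. (x \<bullet> v) ^ (2 * j) / fact (2 * j)" "{j}"] cosh_sums[of "x \<bullet> v"] nn
      by (simp add: sums_iff)
    then show "norm (complex_of_real ((x \<bullet> v) ^ (2 * j) / fact (2 * j))) * r ^ norm_level x \<le> lgauss t x * cosh (1 * (x \<bullet> v))"
      unfolding norm_of_real abs_of_nonneg[OF nn] lgauss_level[OF ev x] rt mult_1_left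
      using r by (subst mult.commute) (intro mult_left_mono, auto)
  qed (use r in auto)
qed

context
  fixes L :: "'a::real_inner set" and n :: nat and v :: 'a
  assumes P: "poisson_holds L n 1" "dual_lattice L = L" "\<And>x. x \<in> L \<Longrightarrow> - x \<in> L"
    and ev: "even_lattice L" and v: "v \<in> span L"
begin

lemma theta_coeffs_conv_radius: "fps_conv_radius (theta_coeffs L v j) \<ge> 1"
  unfolding theta_coeffs_def
  by (intro conv_radius_ge level_fps_conv_radius theta_level_summable[OF P(1) ev v] poisson_finite_shell[OF P(1) ev]) auto

lemma theta_coeffs_imaginary:
  assumes t: "t > 0"
  shows "qev (theta_coeffs L v j) (\<i> * of_real t) = of_real ((- (4 * pi\<^sup>2)) ^ j * moment L v j t)"
proof -
  let ?w = "\<lambda>x. complex_of_real ((x \<bullet> v) ^ (2 * j) / fact (2 * j))"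
  note lv = theta_level_summable[OF P(1) ev v] poisson_finite_shell[OF P(1) ev]
  have lt: "norm (complex_of_real (exp (- (pi * t)))) < 1" using t by simp
  have "qev (theta_coeffs L v j) (\<i> * of_real t) = of_real ((- (4 * pi\<^sup>2)) ^ j) * qev (level_fps L norm_level ?w) (\<i> * of_real t)"
    unfolding theta_coeffs_def using t by (intro qev_mult_fps_const level_fps_conv_radius lv) auto
  also have "qev (level_fps L norm_level ?w) (\<i> * of_real t) = (\<Sum>\<^sub>\<infinity>x\<in>L. ?w x * of_real (exp (- (pi * t))) ^ norm_level x)"
    unfolding qev_def nome_imaginary by (rule eval_level_fps[OF lv lt])
  also have "\<dots> = (\<Sum>\<^sub>\<infinity>x\<in>L. complex_of_real (lgauss t x * ((x \<bullet> v) ^ (2 * j) / fact (2 * j))))"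
    by (intro infsum_cong) (simp add: lgauss_level[OF ev] mult.commute)
  also have "\<dots> = of_real (moment L v j t)"
    unfolding moment_def
  proof (rule infsum_complex_of_real)
    have e: "exp (- (pi * t)) > 0" "exp (- (pi * t)) < 1" using t by auto
    have nn: "(x \<bullet> v) ^ (2 * j) / fact (2 * j) \<ge> 0" for x
      by (intro divide_nonneg_nonneg zero_le_even_power) auto
    have "(\<lambda>x. (x \<bullet> v) ^ (2 * j) / fact (2 * j) * exp (- (pi * t)) ^ norm_level x) summable_on L"
      using theta_level_summable[OF P(1) ev v e, of j] unfolding norm_of_real abs_of_nonneg[OF nn] .
    then show "(\<lambda>x. lgauss t x * ((x \<bullet> v) ^ (2 * j) / fact (2 * j))) summable_on L"
      by (rule summable_on_cong[THEN iffD1, rotated]) (simp only: lgauss_level[OF ev] mult.commute)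
  qed
  finally show ?thesis by simp
qed

text \<open>On the imaginary axis this is \<open>moment_inversion\<close> at \<open>1 / y\<close>;
  the rest is analytic continuation. Divisibility of \<open>k\<close> by 4 gives \<i>^k = 1, so that
  the real factor y^k is the value of \<tau>^k.\<close>

lemma theta_jacobi_like:
  assumes n: "n = 2 * k" and k: "4 dvd k"
  shows "jacobi_like k (\<i> * of_real (pi * (v \<bullet> v))) (theta_coeffs L v)"
  unfolding jacobi_like_def
proof (intro conjI allI impI)
  show "1 \<le> fps_conv_radius (theta_coeffs L v j)" for j by (rule theta_coeffs_conv_radius)
  fix j \<tau> assume \<tau>: "Im \<tau> > 0"
  define s where "s = v \<bullet> v"
  show "qev (theta_coeffs L v j) (- 1 / \<tau>) = (\<Sum>i\<le>j. (\<i> * of_real (pi * (v \<bullet> v))) ^ i / fact i *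
     \<tau> ^ (k + 2 * j - i) * qev (theta_coeffs L v (j - i)) \<tau>)"
  proof (rule uhp_continuation[OF _ _ _ \<tau>])
    have "(\<lambda>\<tau>. - 1 / \<tau>) holomorphic_on uhp"
      by (intro holomorphic_intros) auto
    moreover have "(\<lambda>\<tau>. - 1 / \<tau>) ` uhp \<subseteq> uhp"
      using uhp_inversion by blast
    ultimately have "(qev (theta_coeffs L v j) \<circ> (\<lambda>\<tau>. - 1 / \<tau>)) holomorphic_on uhp"
      by (rule holomorphic_on_compose_gen[OF _ holomorphic_qev[OF theta_coeffs_conv_radius order_refl]])
    then show "(\<lambda>\<tau>. qev (theta_coeffs L v j) (- 1 / \<tau>)) holomorphic_on uhp"
      by (simp only: o_def)
    show "(\<lambda>\<tau>. \<Sum>i\<le>j. (\<i> * of_real (pi * (v \<bullet> v))) ^ i / fact i *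
     \<tau> ^ (k + 2 * j - i) * qev (theta_coeffs L v (j - i)) \<tau>) holomorphic_on uhp"
      by (intro holomorphic_intros theta_coeffs_conv_radius) auto
    fix y :: real assume y: "y > 0"
    have iy: "- 1 / (\<i> * of_real y) = \<i> * of_real (1 / y)"
      using y by (simp add: field_simps)
    have ik: "(\<i> * of_real y) ^ k = complex_of_real (y ^ k)"
    proof -
      obtain c where c: "k = 4 * c" using k by (auto elim: dvdE)
      have "\<i> ^ 4 = 1" by (simp add: eval_nat_numeral)
      then show ?thesis by (simp add: power_mult_distrib c power_mult)
    qed
    have trm: "(\<i> * of_real (pi * s)) ^ i / fact i * (\<i> * of_real y) ^ (k + 2 * j - i) *
        of_real ((- (4 * pi\<^sup>2)) ^ (j - i) * m) =
        complex_of_real (y ^ k * ((- (pi * s * y)) ^ i / fact i * ((4 * pi\<^sup>2 * y\<^sup>2) ^ (j - i) * m)))"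
      if i: "i \<le> j" for i m
    proof -
      have e: "k + 2 * j - i = k + (2 * (j - i) + i)" using i by auto
      have a: "(\<i> * of_real (pi * s)) ^ i * (\<i> * of_real y) ^ i = complex_of_real ((- (pi * s * y)) ^ i)"
        unfolding power_mult_distrib[symmetric] of_real_power[symmetric]
        by (rule trans[OF arg_cong[of _ _ "\<lambda>z. z ^ i"] of_real_power[symmetric]]) (simp add: complex_eq_iff)
      have b: "(\<i> * of_real y) ^ (2 * (j - i)) * of_real ((- (4 * pi\<^sup>2)) ^ (j - i)) = complex_of_real ((4 * pi\<^sup>2 * y\<^sup>2) ^ (j - i))"
        unfolding power_mult of_real_power power_mult_distrib[symmetric]
        by (rule arg_cong[of _ _ "\<lambda>z. z ^ (j - i)"]) (simp add: power_mult_distrib)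
      have "(\<i> * of_real (pi * s)) ^ i / fact i * (\<i> * of_real y) ^ (k + 2 * j - i) * of_real ((- (4 * pi\<^sup>2)) ^ (j - i) * m) =
        (\<i> * of_real y) ^ k * (((\<i> * of_real (pi * s)) ^ i * (\<i> * of_real y) ^ i) / fact i *
          (((\<i> * of_real y) ^ (2 * (j - i)) * of_real ((- (4 * pi\<^sup>2)) ^ (j - i))) * of_real m))"
        unfolding e power_add of_real_mult by (simp only: mult_ac times_divide_eq_left times_divide_eq_right)
      also have "\<dots> = complex_of_real (y ^ k * ((- (pi * s * y)) ^ i / fact i * ((4 * pi\<^sup>2 * y\<^sup>2) ^ (j - i) * m)))"
        unfolding a b ik by (simp only: of_real_mult of_real_divide of_real_fact)
      finally show ?thesis .
    qed
    have "qev (theta_coeffs L v j) (- 1 / (\<i> * of_real y)) = of_real ((- (4 * pi\<^sup>2)) ^ j * moment L v j (1 / y))"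
      unfolding iy using y by (intro theta_coeffs_imaginary) auto
    also have "(- (4 * pi\<^sup>2)) ^ j * moment L v j (1 / y) = (1 / sqrt (1 / y)) ^ n *
     (\<Sum>i\<le>j. (- (pi * (v \<bullet> v) / (1 / y))) ^ i / fact i * ((4 * pi\<^sup>2 / (1 / y)\<^sup>2) ^ (j - i) * moment L v (j - i) (1 / (1 / y))))"
      by (rule moment_inversion[OF P v]) (use y in auto)
    also have "\<dots> = (\<Sum>i\<le>j. y ^ k * ((- (pi * s * y)) ^ i / fact i * ((4 * pi\<^sup>2 * y\<^sup>2) ^ (j - i) * moment L v (j - i) y)))"
    proof -
      have "(1 / sqrt (1 / y)) ^ n = y ^ k"
        using y by (simp add: n power_mult real_sqrt_divide)
      then show ?thesis using y by (simp add: sum_distrib_left power_divide s_def)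
    qed
    also have "complex_of_real \<dots> = (\<Sum>i\<le>j. (\<i> * of_real (pi * s)) ^ i / fact i *
     (\<i> * of_real y) ^ (k + 2 * j - i) * of_real ((- (4 * pi\<^sup>2)) ^ (j - i) * moment L v (j - i) y))"
      unfolding of_real_sum by (intro sum.cong refl trm[symmetric]) auto
    also have "\<dots> = (\<Sum>i\<le>j. (\<i> * of_real (pi * (v \<bullet> v))) ^ i / fact i *
     (\<i> * of_real y) ^ (k + 2 * j - i) * qev (theta_coeffs L v (j - i)) (\<i> * of_real y))"
      by (intro sum.cong refl) (simp only: theta_coeffs_imaginary[OF y] s_def)
    finally show "qev (theta_coeffs L v j) (- 1 / (\<i> * of_real y)) =
      (\<Sum>i\<le>j. (\<i> * of_real (pi * (v \<bullet> v))) ^ i / fact i *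
     (\<i> * of_real y) ^ (k + 2 * j - i) * qev (theta_coeffs L v (j - i)) (\<i> * of_real y))" .
  qed
qed

end

section \<open>Iterated heat steps and zonal polynomials\<close>

fun heat_iter :: "nat \<Rightarrow> nat \<Rightarrow> complex \<Rightarrow> (nat \<Rightarrow> complex fps) \<Rightarrow> nat \<Rightarrow> complex fps" where
  "heat_iter 0 k \<mu> A = A"
| "heat_iter (Suc \<nu>) k \<mu> A = heat_iter \<nu> (k + 2) \<mu> (heat_step k \<mu> A)"

lemma jacobi_like_heat_iter:
  "jacobi_like k \<mu> A \<Longrightarrow> k > 0 \<Longrightarrow> jacobi_like (k + 2 * \<nu>) \<mu> (heat_iter \<nu> k \<mu> A)"
proof (induction \<nu> arbitrary: k A)
  case (Suc \<nu>)
  have "jacobi_like (k + 2 + 2 * \<nu>) \<mu> (heat_iter \<nu> (k + 2) \<mu> (heat_step k \<mu> A))"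
    by (rule Suc.IH) (use Suc.prems jacobi_like_heat_step in auto)
  then show ?case by simp
qed simp

text \<open>What \<open>heat_iter\<close> does to the coefficients of one fixed exponent m. The
  derivative multiplies them by m, so with a = (v \<bullet> v) * m each heat step becomes this
  recursion, up to a factor -pi^2 per step and \<open>(- (4 * pi\<^sup>2)) ^ j\<close>.\<close>

fun zonal_iter :: "nat \<Rightarrow> nat \<Rightarrow> real \<Rightarrow> (nat \<Rightarrow> real) \<Rightarrow> nat \<Rightarrow> real" where
  "zonal_iter 0 k a c = c"
| "zonal_iter (Suc \<nu>) k a c = zonal_iter \<nu> (k + 2) a (\<lambda>j. a * c j - 4 * of_nat ((j + 1) * (k + j)) * c (j + 1))"

lemma zonal_iter_sum:
  "zonal_iter \<nu> k a (\<lambda>j. \<Sum>x\<in>X. c x j) j = (\<Sum>x\<in>X. zonal_iter \<nu> k a (c x) j)"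
proof (induction \<nu> arbitrary: k c)
  case (Suc \<nu>)
  show ?case
    unfolding zonal_iter.simps Suc.IH[symmetric]
    by (simp add: sum_distrib_left sum_subtractf)
qed simp

lemma heat_iter_nth:
  assumes "\<And>j. fps_nth (A j) m = of_real (K * (- (4 * pi\<^sup>2)) ^ j * c j)"
  shows "fps_nth (heat_iter \<nu> k (\<i> * of_real (pi * s)) A j) m =
     of_real (K * (- (pi\<^sup>2)) ^ \<nu> * (- (4 * pi\<^sup>2)) ^ j * zonal_iter \<nu> k (s * real m) c j)"
  using assms
proof (induction \<nu> arbitrary: k A K c)
  case (Suc \<nu>)
  let ?\<mu> = "\<i> * of_real (pi * s)"
  have "fps_nth (heat_step k ?\<mu> A j) m = of_real ((K * (- (pi\<^sup>2))) * (- (4 * pi\<^sup>2)) ^ j *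
      ((s * real m) * c j - 4 * of_nat ((j + 1) * (k + j)) * c (j + 1)))" for j
  proof -
    have "fps_nth (fps_X * fps_deriv (A j)) m = of_nat m * fps_nth (A j) m"
      by (cases m) auto
    then have "fps_nth (heat_step k ?\<mu> A j) m = ?\<mu> * (\<i> * of_real pi * (of_nat m * fps_nth (A j) m))
       - of_nat ((j + 1) * (k + j)) * fps_nth (A (j + 1)) m"
      unfolding heat_step_def fps_sub_nth fps_mult_left_const_nth by simp
    also have "\<dots> = of_real ((K * (- (pi\<^sup>2))) * (- (4 * pi\<^sup>2)) ^ j *
      ((s * real m) * c j - 4 * of_nat ((j + 1) * (k + j)) * c (j + 1)))"
      unfolding Suc.prems by (simp add: complex_eq_iff power2_eq_square algebra_simps del: of_nat_Suc of_nat_add of_nat_mult)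
    finally show ?thesis .
  qed
  from Suc.IH[OF this, where k = "k + 2"] show ?case by (simp add: mult_ac)
qed simp

text \<open>
  Up to normalisation, \<open>zonal \<nu> k ((v \<bullet> v) * (x \<bullet> x)) (x \<bullet> v)\<close> is the zonal harmonic polynomial of
  degree \<open>2 * \<nu>\<close> in dimension \<open>2 * k\<close>.
\<close>

definition zonal :: "nat \<Rightarrow> nat \<Rightarrow> real \<Rightarrow> real \<Rightarrow> real" where
  "zonal \<nu> k a p = zonal_iter \<nu> k a (\<lambda>j. p ^ (2 * j) / fact (2 * j)) 0"

text \<open>Holomorphy on the half-plane and at infinity is built in, \<open>F\<close> being a power
  series in the nome that converges on the unit disk.\<close>

definition modular_form :: "nat \<Rightarrow> complex fps \<Rightarrow> bool" where
  "modular_form k F \<longleftrightarrow> fps_conv_radius F \<ge> 1 \<and>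
     (\<forall>\<tau>. Im \<tau> > 0 \<longrightarrow> qev F (\<tau> + 1) = qev F \<tau> \<and> qev F (- 1 / \<tau>) = \<tau> ^ k * qev F \<tau>)"

lemma qev_translate_even:
  assumes "\<And>m. odd m \<Longrightarrow> fps_nth F m = 0"
  shows "qev F (\<tau> + 1) = qev F \<tau>"
proof -
  have e: "fps_nth F m * (- z) ^ m = fps_nth F m * z ^ m" for m z
    using assms[of m] by (cases "even m") auto
  show ?thesis unfolding qev_def nome_plus_1 eval_fps_def e ..
qed

text \<open>The law of a Jacobi-like family has a single term for \<open>j = 0\<close>, so its first
  member is modular of the weight of the family. Here it is the first member of the \<nu>-fold heat
  iterate, divided by the constant \<open>K\<close> that the iteration accumulates.\<close>

theorem zonal_theta_modular:
  fixes L :: "'a::real_inner set"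
  assumes L: "type_II_lattice n L" and n: "n = 2 * k" and k: "4 dvd k" "k > 0" and v: "v \<in> span L"
  shows "\<exists>F. modular_form (k + 2 * \<nu>) F \<and>
    (\<forall>m. fps_nth F m = (\<Sum>x | x \<in> L \<and> x \<bullet> x = real m. of_real (zonal \<nu> k ((v \<bullet> v) * real m) (x \<bullet> v))))"
proof -
  have L': "lattice_of_rank n L" "even_lattice L" "self_dual L" using L by (auto simp: type_II_lattice_def)
  note P = self_dual_poisson[OF L'(1,3)]
  note ev = L'(2)
  define \<mu> where "\<mu> = \<i> * of_real (pi * (v \<bullet> v))"
  define K where "K = (- (pi\<^sup>2)) ^ \<nu>"
  have K: "K \<noteq> 0" by (simp add: K_def)
  define G where "G = heat_iter \<nu> k \<mu> (theta_coeffs L v) 0"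
  have J: "jacobi_like (k + 2 * \<nu>) \<mu> (heat_iter \<nu> k \<mu> (theta_coeffs L v))"
    using theta_jacobi_like[OF P ev v n k(1)] k(2) unfolding \<mu>_def by (intro jacobi_like_heat_iter)
  have Gc: "fps_conv_radius G \<ge> 1" using J by (simp add: jacobi_like_def G_def)
  have GS: "qev G (- 1 / \<tau>) = \<tau> ^ (k + 2 * \<nu>) * qev G \<tau>" if "Im \<tau> > 0" for \<tau>
    using J[unfolded jacobi_like_def, THEN conjunct2, rule_format, OF that, of 0] by (simp add: G_def)
  have nth: "fps_nth G m = of_real K * (\<Sum>x | x \<in> L \<and> x \<bullet> x = real m. of_real (zonal \<nu> k ((v \<bullet> v) * real m) (x \<bullet> v)))" for m
  proof -
    have set: "{x \<in> L. norm_level x = m} = {x \<in> L. x \<bullet> x = real m}"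
      using even_lattice_level_iff[OF ev] by auto
    have "fps_nth (theta_coeffs L v j) m = of_real (1 * (- (4 * pi\<^sup>2)) ^ j * (\<Sum>x | x \<in> L \<and> x \<bullet> x = real m. (x \<bullet> v) ^ (2 * j) / fact (2 * j)))" for j
      unfolding theta_coeffs_def fps_mult_left_const_nth level_fps_def fps_nth_Abs_fps set by (simp only: of_real_mult of_real_sum of_real_1 mult_1_left)
    from heat_iter_nth[OF this, of \<nu> k "v \<bullet> v" 0]
    show ?thesis by (simp add: G_def \<mu>_def K_def zonal_def zonal_iter_sum)
  qed
  define F where "F = fps_const (of_real (1 / K)) * G"
  have Fn: "fps_nth F m = (\<Sum>x | x \<in> L \<and> x \<bullet> x = real m. of_real (zonal \<nu> k ((v \<bullet> v) * real m) (x \<bullet> v)))" for m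
    unfolding F_def fps_mult_left_const_nth nth using K by simp
  have Fc: "fps_conv_radius F \<ge> 1" unfolding F_def by (intro conv_radius_ge Gc) auto
  have "fps_nth F m = 0" if "odd m" for m
  proof -
    have "x \<bullet> x \<noteq> real m" if x: "x \<in> L" for x
      using even_lattice_norm_level[OF ev x] \<open>odd m\<close> by auto
    then show ?thesis unfolding Fn by (intro sum.neutral) auto
  qed
  then have T: "qev F (\<tau> + 1) = qev F \<tau>" for \<tau> by (rule qev_translate_even)
  have S: "qev F (- 1 / \<tau>) = \<tau> ^ (k + 2 * \<nu>) * qev F \<tau>" if "Im \<tau> > 0" for \<tau>
    unfolding F_def qev_mult_fps_const[OF uhp_inversion[OF that] Gc] qev_mult_fps_const[OF that Gc] GS[OF that]
    by (simp only: mult_ac)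
  show ?thesis
    using Fc T S Fn unfolding modular_form_def by (intro exI[of _ F] conjI allI impI)
qed

section \<open>Algebra of modular forms and their expansions\<close>

lemma modular_formD:
  assumes "modular_form k F"
  shows "fps_conv_radius F \<ge> 1" "Im \<tau> > 0 \<Longrightarrow> qev F (\<tau> + 1) = qev F \<tau>"
    "Im \<tau> > 0 \<Longrightarrow> qev F (- 1 / \<tau>) = \<tau> ^ k * qev F \<tau>"
  using assms by (simp_all only: modular_form_def)

lemma uhp_translate: "Im \<tau> > 0 \<Longrightarrow> Im (\<tau> + 1) > 0"
  by simp

lemma modular_form_mult:
  assumes F: "modular_form k F" and G: "modular_form l G"
  shows "modular_form (k + l) (F * G)"
  unfolding modular_form_def
proof (intro conjI allI impI)
  note c = modular_formD(1)[OF F] modular_formD(1)[OF G]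
  show "1 \<le> fps_conv_radius (F * G)" by (intro conv_radius_ge c)
  fix \<tau> assume t: "Im \<tau> > 0"
  show "qev (F * G) (\<tau> + 1) = qev (F * G) \<tau>"
    by (simp only: qev_mult[OF t c] qev_mult[OF uhp_translate[OF t] c] modular_formD(2)[OF F t] modular_formD(2)[OF G t])
  show "qev (F * G) (- 1 / \<tau>) = \<tau> ^ (k + l) * qev (F * G) \<tau>"
    by (simp only: qev_mult[OF t c] qev_mult[OF uhp_inversion[OF t] c] modular_formD(3)[OF F t] modular_formD(3)[OF G t] power_add mult_ac)
qed

lemma modular_form_diff:
  assumes F: "modular_form k F" and G: "modular_form k G"
  shows "modular_form k (F - G)"
  unfolding modular_form_def
proof (intro conjI allI impI)
  note c = modular_formD(1)[OF F] modular_formD(1)[OF G]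
  show "1 \<le> fps_conv_radius (F - G)" by (intro conv_radius_ge c)
  fix \<tau> assume t: "Im \<tau> > 0"
  show "qev (F - G) (\<tau> + 1) = qev (F - G) \<tau>"
    by (simp only: qev_diff[OF t c] qev_diff[OF uhp_translate[OF t] c] modular_formD(2)[OF F t] modular_formD(2)[OF G t])
  show "qev (F - G) (- 1 / \<tau>) = \<tau> ^ k * qev (F - G) \<tau>"
    by (simp only: qev_diff[OF t c] qev_diff[OF uhp_inversion[OF t] c] modular_formD(3)[OF F t] modular_formD(3)[OF G t] right_diff_distrib)
qed

lemma modular_form_const: "modular_form 0 (fps_const c)"
  by (simp add: modular_form_def)

lemma modular_form_power: "modular_form k F \<Longrightarrow> modular_form (m * k) (F ^ m)"
  using modular_form_const[of 1] by (induction m) (auto intro: modular_form_mult)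

lemma eventually_uhp: "eventually (\<lambda>\<tau>. Im \<tau> > 0) at_ii"
  unfolding eventually_at_ii by (rule exI[of _ 1]) auto

lemma qev_shift_decomp:
  assumes F: "fps_conv_radius F \<ge> 1" and z: "\<And>m. m < e \<Longrightarrow> fps_nth F m = 0" and t: "Im \<tau> > 0"
  shows "qev F \<tau> = nome \<tau> ^ e * qev (fps_shift e F) \<tau>"
proof -
  have "F = fps_X ^ e * fps_shift e F"
    by (rule fps_ext) (simp add: fps_X_power_mult_nth z)
  then have "qev F \<tau> = qev (fps_X ^ e * fps_shift e F) \<tau>" by simp
  also have "\<dots> = nome \<tau> ^ e * qev (fps_shift e F) \<tau>"
    using t F by (subst qev_mult) auto
  finally show ?thesis .
qed

text \<open>Once the lower coefficients vanish, a power of the nome can be divided out, and the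
  limit at infinity of the quotient is the next coefficient.\<close>

lemma qev_zero_imp_zero:
  assumes F: "fps_conv_radius F \<ge> 1" and z: "\<And>\<tau>. Im \<tau> > 0 \<Longrightarrow> qev F \<tau> = 0"
  shows "F = 0"
proof (rule fps_ext, unfold fps_zero_nth)
  fix n show "fps_nth F n = 0"
  proof (induction n rule: less_induct)
    case (less n)
    have "eventually (\<lambda>\<tau>. qev (fps_shift n F) \<tau> = 0) at_ii"
      using eventually_uhp
    proof eventually_elim
      case (elim \<tau>)
      then have "nome \<tau> ^ n * qev (fps_shift n F) \<tau> = 0"
        using qev_shift_decomp[OF F less elim] z[OF elim] by simp
      then show ?case by simp
    qed
    then have "(qev (fps_shift n F) \<longlongrightarrow> 0) at_ii" by (rule tendsto_eventually)
    moreover have "(qev (fps_shift n F) \<longlongrightarrow> fps_nth (fps_shift n F) 0) at_ii"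
      using F by (intro qev_tendsto) simp
    ultimately have "fps_nth (fps_shift n F) 0 = 0"
      using tendsto_unique[OF at_ii_neq_bot] by blast
    then show ?case by simp
  qed
qed

subsection \<open>Jacobi theta functions\<close>

definition theta3 :: "complex fps" where
  "theta3 = level_fps (UNIV :: int set) (\<lambda>n. nat (n\<^sup>2)) (\<lambda>_. 1)"

definition theta4 :: "complex fps" where
  "theta4 = level_fps (UNIV :: int set) (\<lambda>n. nat (n\<^sup>2)) (\<lambda>n. if even n then 1 else - 1)"

text \<open>The classical \<open>\<theta>\<^sub>2\<close> is \<open>nome (\<tau> / 4)\<close> times this series.\<close>

definition theta2 :: "complex fps" where
  "theta2 = level_fps (UNIV :: int set) (\<lambda>n. nat (n\<^sup>2 + n)) (\<lambda>_. 1)"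

lemma int_square_plus_nonneg: "(n::int)\<^sup>2 + n \<ge> 0"
proof -
  have "n\<^sup>2 + n = n * (n + 1)" by (simp add: power2_eq_square algebra_simps)
  moreover have "n * (n + 1) \<ge> 0" by (cases "n \<ge> 0") (auto simp: zero_le_mult_iff)
  ultimately show ?thesis by simp
qed

lemma square_fiber: "\<exists>a. {n::int. nat (n\<^sup>2) = m} \<subseteq> {a, - a}"
proof (cases "{n::int. nat (n\<^sup>2) = m} = {}")
  case False
  then obtain a :: int where a: "nat (a\<^sup>2) = m" by auto
  have "n = a \<or> n = - a" if "nat (n\<^sup>2) = m" for n
    using that a by (metis nat_eq_iff2 power2_eq_iff zero_le_power2 nat_0_le)
  then show ?thesis by auto
qed auto

lemma square_plus_fiber: "\<exists>a. {n::int. nat (n\<^sup>2 + n) = m} \<subseteq> {a, - 1 - a}"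
proof (cases "{n::int. nat (n\<^sup>2 + n) = m} = {}")
  case False
  then obtain a :: int where a: "nat (a\<^sup>2 + a) = m" by auto
  have "n = a \<or> n = - 1 - a" if "nat (n\<^sup>2 + n) = m" for n
  proof -
    have "n\<^sup>2 + n = a\<^sup>2 + a"
      using that a int_square_plus_nonneg[of n] int_square_plus_nonneg[of a] by linarith
    then have "(n - a) * (n + a + 1) = 0"
      by (simp add: power2_eq_square algebra_simps)
    then show ?thesis by auto
  qed
  then show ?thesis by blast
qed auto

lemma finite_square_fiber: "finite {n. n \<in> (UNIV :: int set) \<and> nat (n\<^sup>2) = m}"
  using square_fiber[of m] finite_subset[of _ "{a, - a}" for a :: int] by auto

lemma finite_square_plus_fiber: "finite {n. n \<in> (UNIV :: int set) \<and> nat (n\<^sup>2 + n) = m}"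
  using square_plus_fiber[of m] finite_subset[of _ "{a, - 1 - a}" for a :: int] by auto

lemma power_exp_square: "exp (- (pi * t)) ^ nat (n\<^sup>2) = exp (- (pi * t * (of_int n + 0)\<^sup>2))"
  unfolding exp_of_nat_mult[symmetric] by simp

lemma power_exp_square_plus:
  "exp (- (pi * t)) ^ nat (n\<^sup>2 + n) = exp (pi * t / 4) * exp (- (pi * t * (of_int n + 1 / 2)\<^sup>2))"
proof -
  have "real (nat (n\<^sup>2 + n)) = (of_int n)\<^sup>2 + of_int n"
    using int_square_plus_nonneg[of n] by simp
  then show ?thesis
    unfolding exp_of_nat_mult[symmetric] exp_add[symmetric]
    by (intro arg_cong[of _ _ exp]) (simp add: power2_eq_square algebra_simps)
qed

lemma nome_parameter:
  fixes r :: real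
  assumes "0 < r" "r < 1"
  obtains t where "t > 0" "exp (- (pi * t)) = r"
proof
  show "- ln r / pi > 0" using assms by (simp add: divide_neg_pos)
  show "exp (- (pi * (- ln r / pi))) = r" using assms by simp
qed

lemma summable_square_powers:
  fixes r :: real
  assumes "0 < r" "r < 1"
  shows "(\<lambda>n::int. r ^ nat (n\<^sup>2)) summable_on UNIV" "(\<lambda>n::int. r ^ nat (n\<^sup>2 + n)) summable_on UNIV"
proof -
  obtain t where t: "t > 0" "exp (- (pi * t)) = r" using nome_parameter[OF assms] .
  show "(\<lambda>n::int. r ^ nat (n\<^sup>2)) summable_on UNIV"
    unfolding t(2)[symmetric] power_exp_square by (rule summable_gaussian_int[OF t(1)])
  show "(\<lambda>n::int. r ^ nat (n\<^sup>2 + n)) summable_on UNIV"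
    unfolding t(2)[symmetric] power_exp_square_plus by (intro summable_on_cmult_right summable_gaussian_int[OF t(1)])
qed

lemma theta3_summable: "0 < r \<Longrightarrow> r < 1 \<Longrightarrow> (\<lambda>n::int. norm (1::complex) * r ^ nat (n\<^sup>2)) summable_on UNIV"
  using summable_square_powers(1) by simp

lemma theta4_summable: "0 < r \<Longrightarrow> r < 1 \<Longrightarrow> (\<lambda>n::int. norm (if even n then 1 else - 1 :: complex) * r ^ nat (n\<^sup>2)) summable_on UNIV"
proof -
  have "norm (if even n then 1 else - 1 :: complex) = 1" for n :: int by simp
  then show "0 < r \<Longrightarrow> r < 1 \<Longrightarrow> ?thesis" using summable_square_powers(1) by (simp only: mult_1_left)
qed

lemma theta2_summable: "0 < r \<Longrightarrow> r < 1 \<Longrightarrow> (\<lambda>n::int. norm (1::complex) * r ^ nat (n\<^sup>2 + n)) summable_on UNIV"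
  using summable_square_powers(2) by simp

lemmas theta3_level = theta3_summable finite_square_fiber
lemmas theta4_level = theta4_summable finite_square_fiber
lemmas theta2_level = theta2_summable finite_square_plus_fiber

lemma theta_conv_radius:
  "fps_conv_radius theta3 \<ge> 1" "fps_conv_radius theta4 \<ge> 1" "fps_conv_radius theta2 \<ge> 1"
  unfolding theta2_def theta3_def theta4_def
  by (rule level_fps_conv_radius[OF theta3_level], assumption+)
     (rule level_fps_conv_radius[OF theta4_level] level_fps_conv_radius[OF theta2_level], assumption+)+

lemma eval_theta:
  assumes "norm z < 1"
  shows "eval_fps theta3 z = (\<Sum>\<^sub>\<infinity>n::int. 1 * z ^ nat (n\<^sup>2))"
    "eval_fps theta4 z = (\<Sum>\<^sub>\<infinity>n::int. (if even n then 1 else - 1) * z ^ nat (n\<^sup>2))"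
    "eval_fps theta2 z = (\<Sum>\<^sub>\<infinity>n::int. 1 * z ^ nat (n\<^sup>2 + n))"
  unfolding theta2_def theta3_def theta4_def
  by (rule eval_level_fps[OF theta3_level assms], assumption+)
     (rule eval_level_fps[OF theta4_level assms] eval_level_fps[OF theta2_level assms], assumption+)+

lemma power_minus_square: "(- z) ^ nat (n\<^sup>2) = (if even n then 1 else - 1) * (z::complex) ^ nat (n\<^sup>2)"
proof -
  have "even (nat (n\<^sup>2)) \<longleftrightarrow> even n" by (simp add: even_nat_iff)
  then show ?thesis by (cases "even n") simp_all
qed

lemma power_minus_square_plus: "(- z) ^ nat (n\<^sup>2 + n) = (z::complex) ^ nat (n\<^sup>2 + n)"
proof -
  have "even (nat (n\<^sup>2 + n))" using int_square_plus_nonneg[of n] by (simp add: even_nat_iff)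
  then show ?thesis by simp
qed

lemma theta_translate:
  assumes "Im \<tau> > 0"
  shows "qev theta3 (\<tau> + 1) = qev theta4 \<tau>" "qev theta4 (\<tau> + 1) = qev theta3 \<tau>" "qev theta2 (\<tau> + 1) = qev theta2 \<tau>"
proof -
  have n: "norm (nome \<tau>) < 1" "norm (- nome \<tau>) < 1" using norm_nome_less_1[OF assms] by simp_all
  have s: "(if even k then 1 else - 1) * ((if even k then 1 else - 1) * w) = (1 :: complex) * w" for k :: int and w by simp
  show "qev theta3 (\<tau> + 1) = qev theta4 \<tau>" "qev theta4 (\<tau> + 1) = qev theta3 \<tau>" "qev theta2 (\<tau> + 1) = qev theta2 \<tau>"
    unfolding qev_def nome_plus_1 eval_theta[OF n(1)] eval_theta[OF n(2)] power_minus_square power_minus_square_plus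
    by (simp_all only: s mult_1_left)
qed

text \<open>Poisson summation without twist, at shift 0 for \<theta>3 and at shift 1/2 for
  \<theta>2. The half shift becomes the sign (-1)^m on the other side, which is \<theta>4; the
  factor exp (- pi * t / 4) comes from (n + 1/2)^2 = n^2 + n + 1/4.\<close>

lemma theta_imaginary:
  assumes t: "t > 0"
  shows "qev theta3 (\<i> * of_real t) = of_real (1 / sqrt t) * qev theta3 (\<i> * of_real (1 / t))"
    "of_real (exp (- (pi * t / 4))) * qev theta2 (\<i> * of_real t) = of_real (1 / sqrt t) * qev theta4 (\<i> * of_real (1 / t))"
proof -
  have n: "norm (complex_of_real (exp (- (pi * t)))) < 1" "norm (complex_of_real (exp (- (pi * (1 / t))))) < 1"
    using t by simp_all
  have p: "complex_of_real x ^ k = of_real (x ^ k)" for x k by simp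
  have r: "pi * (1 / t) * (of_int m + 0)\<^sup>2 = pi * (of_int m - 0)\<^sup>2 / t" for m :: int by simp
  have c0: "cis (2 * pi * 0 * y) = 1" "cis (2 * pi * of_int m * 0) = 1" for y and m :: int by simp_all
  show "qev theta3 (\<i> * of_real t) = of_real (1 / sqrt t) * qev theta3 (\<i> * of_real (1 / t))"
    unfolding qev_def nome_imaginary eval_theta[OF n(1)] eval_theta[OF n(2)] p power_exp_square r
    using poisson_gaussian_int[OF t, where z = 0 and w = 0] by (simp only: c0 mult_1_left mult_1_right)
  have ch: "cis (2 * pi * of_int m * (1 / 2)) = (if even m then 1 else - 1)" for m :: int
  proof (cases "even m")
    case True
    then obtain k where "m = 2 * k" by (elim evenE)
    then show ?thesis using cis_multiple_2pi[of "of_int k"] by (simp add: mult_ac)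
  next
    case False
    then obtain k where k: "m = 2 * k + 1" by (elim oddE)
    have "2 * pi * of_int m * (1 / 2) = 2 * pi * of_int k + pi" by (simp add: k algebra_simps)
    then have "cis (2 * pi * of_int m * (1 / 2)) = cis (2 * pi * of_int k) * cis pi" by (simp only: cis_mult)
    then show ?thesis using cis_multiple_2pi[of "of_int k"] False by simp
  qed
  have e: "complex_of_real (exp (- (pi * t / 4))) * (\<Sum>\<^sub>\<infinity>n::int. complex_of_real (exp (pi * t / 4) * f n)) = (\<Sum>\<^sub>\<infinity>n. complex_of_real (f n))" for f
    unfolding infsum_cmult_right'[symmetric] of_real_mult[symmetric] mult.assoc[symmetric] exp_add[symmetric] by simp
  show "of_real (exp (- (pi * t / 4))) * qev theta2 (\<i> * of_real t) = of_real (1 / sqrt t) * qev theta4 (\<i> * of_real (1 / t))"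
    unfolding qev_def nome_imaginary eval_theta[OF n(1)] eval_theta[OF n(2)] p power_exp_square power_exp_square_plus r mult_1_left e
    using poisson_gaussian_int[OF t, where z = "1 / 2" and w = 0] by (simp only: c0 ch mult_1_right) (simp only: mult.commute)
qed

text \<open>
  The translation exchanges \<open>tA\<close> and \<open>tB\<close>, the inversion exchanges \<open>tB\<close> and \<open>tC\<close>; hence symmetric
  polynomials in the three series are modular for the full modular group.
\<close>

definition tA :: "complex fps" where "tA = theta3 ^ 8"
definition tB :: "complex fps" where "tB = theta4 ^ 8"
definition tC :: "complex fps" where "tC = fps_X ^ 2 * theta2 ^ 8"

lemma theta8_conv_radius: "fps_conv_radius tA \<ge> 1" "fps_conv_radius tB \<ge> 1" "fps_conv_radius tC \<ge> 1"
  unfolding tA_def tB_def tC_def by (intro conv_radius_ge theta_conv_radius; simp)+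

lemma theta8_translate:
  assumes t: "Im \<tau> > 0"
  shows "qev tA (\<tau> + 1) = qev tB \<tau>" "qev tB (\<tau> + 1) = qev tA \<tau>" "qev tC (\<tau> + 1) = qev tC \<tau>"
proof -
  note c = theta_conv_radius
  note t1 = uhp_translate[OF t]
  show "qev tA (\<tau> + 1) = qev tB \<tau>" "qev tB (\<tau> + 1) = qev tA \<tau>"
    unfolding tA_def tB_def qev_power[OF t c(1)] qev_power[OF t c(2)] qev_power[OF t1 c(1)] qev_power[OF t1 c(2)] theta_translate[OF t] by rule+
  have "qev tC \<sigma> = nome \<sigma> ^ 2 * qev theta2 \<sigma> ^ 8" if "Im \<sigma> > 0" for \<sigma>
    unfolding tC_def using that c(3) by (subst qev_mult) (auto simp: qev_power conv_radius_ge)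
  then show "qev tC (\<tau> + 1) = qev tC \<tau>"
    using t t1 by (simp only: theta_translate[OF t] nome_plus_1 power2_minus)
qed

text \<open>Eighth powers make both awkward factors integral: the root of \<open>t\<close> becomes
  t^4, and exp (- pi * t / 4) becomes the square of the nome.\<close>

lemma theta8_imaginary:
  assumes t: "t > 0"
  shows "qev tA (\<i> * of_real t) = of_real ((1 / t) ^ 4) * qev tA (\<i> * of_real (1 / t))"
    "qev tC (\<i> * of_real t) = of_real ((1 / t) ^ 4) * qev tB (\<i> * of_real (1 / t))"
proof -
  note c = theta_conv_radius
  have t': "Im (\<i> * of_real t) > 0" "Im (\<i> * of_real (1 / t)) > 0" using t by simp_all
  have "(1 / sqrt t) ^ 8 = ((1 / sqrt t)\<^sup>2) ^ 4" by (simp only: power_mult[symmetric]) simp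
  also have "\<dots> = (1 / t) ^ 4" using t by (simp add: power_divide)
  finally have s: "complex_of_real (1 / sqrt t) ^ 8 = of_real ((1 / t) ^ 4)" by (simp only: of_real_power[symmetric])
  show "qev tA (\<i> * of_real t) = of_real ((1 / t) ^ 4) * qev tA (\<i> * of_real (1 / t))"
    unfolding tA_def qev_power[OF t'(1) c(1)] qev_power[OF t'(2) c(1)] theta_imaginary(1)[OF t] power_mult_distrib s ..
  have e: "exp (- (pi * t)) ^ 2 = exp (- (pi * t / 4)) ^ 8"
    unfolding exp_of_nat_mult[symmetric] by simp
  have "qev tC (\<i> * of_real t) = nome (\<i> * of_real t) ^ 2 * qev theta2 (\<i> * of_real t) ^ 8"
    unfolding tC_def using t'(1) c(3) by (subst qev_mult) (auto simp: qev_power conv_radius_ge simp del: Im_i_times)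
  also have "\<dots> = (of_real (exp (- (pi * t / 4))) * qev theta2 (\<i> * of_real t)) ^ 8"
    unfolding nome_imaginary power_mult_distrib of_real_power[symmetric] e ..
  also have "\<dots> = of_real ((1 / t) ^ 4) * qev tB (\<i> * of_real (1 / t))"
    unfolding theta_imaginary(2)[OF t] tB_def qev_power[OF t'(2) c(2)] power_mult_distrib s ..
  finally show "qev tC (\<i> * of_real t) = of_real ((1 / t) ^ 4) * qev tB (\<i> * of_real (1 / t))" .
qed

lemma weight_4_continuation:
  assumes c: "fps_conv_radius F \<ge> 1" "fps_conv_radius G \<ge> 1"
    and i: "\<And>t. t > 0 \<Longrightarrow> qev F (\<i> * of_real t) = of_real ((1 / t) ^ 4) * qev G (\<i> * of_real (1 / t))"
    and t: "Im \<tau> > 0"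
  shows "qev F (- 1 / \<tau>) = \<tau> ^ 4 * qev G \<tau>"
proof (rule uhp_continuation[OF _ _ _ t])
  have "(\<lambda>\<tau>. - 1 / \<tau>) holomorphic_on uhp"
    by (intro holomorphic_intros) auto
  moreover have "(\<lambda>\<tau>. - 1 / \<tau>) ` uhp \<subseteq> uhp"
    using uhp_inversion by blast
  ultimately have "(qev F \<circ> (\<lambda>\<tau>. - 1 / \<tau>)) holomorphic_on uhp"
    by (rule holomorphic_on_compose_gen[OF _ holomorphic_qev[OF c(1) order_refl]])
  then show "(\<lambda>\<tau>. qev F (- 1 / \<tau>)) holomorphic_on uhp"
    by (simp only: o_def)
  show "(\<lambda>\<tau>. \<tau> ^ 4 * qev G \<tau>) holomorphic_on uhp"
    by (intro holomorphic_intros c(2)) auto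
  fix y :: real assume y: "y > 0"
  have iy: "- 1 / (\<i> * of_real y) = \<i> * of_real (1 / y)"
    using y by (simp add: field_simps)
  have "(\<i> * of_real y) ^ 4 = complex_of_real (y ^ 4)"
  proof -
    have "\<i> ^ 4 = 1" by (simp add: eval_nat_numeral)
    then show ?thesis by (simp add: power_mult_distrib)
  qed
  then show "qev F (- 1 / (\<i> * of_real y)) = (\<i> * of_real y) ^ 4 * qev G (\<i> * of_real y)"
    unfolding iy using i[of "1 / y"] y by simp
qed

lemma theta8_invert:
  assumes t: "Im \<tau> > 0"
  shows "qev tA (- 1 / \<tau>) = \<tau> ^ 4 * qev tA \<tau>" "qev tB (- 1 / \<tau>) = \<tau> ^ 4 * qev tC \<tau>" "qev tC (- 1 / \<tau>) = \<tau> ^ 4 * qev tB \<tau>"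
proof -
  note c = theta8_conv_radius
  show "qev tA (- 1 / \<tau>) = \<tau> ^ 4 * qev tA \<tau>"
    by (rule weight_4_continuation[OF c(1,1) theta8_imaginary(1) t])
  show "qev tC (- 1 / \<tau>) = \<tau> ^ 4 * qev tB \<tau>"
    by (rule weight_4_continuation[OF c(3,2) theta8_imaginary(2) t])
  show "qev tB (- 1 / \<tau>) = \<tau> ^ 4 * qev tC \<tau>"
  proof (rule weight_4_continuation[OF c(2,3) _ t])
    fix t :: real assume t: "t > 0"
    then have "qev tC (\<i> * of_real (1 / t)) = of_real ((1 / (1 / t)) ^ 4) * qev tB (\<i> * of_real (1 / (1 / t)))"
      by (intro theta8_imaginary(2)) simp
    moreover have "complex_of_real ((1 / t) ^ 4) * of_real ((1 / (1 / t)) ^ 4) = 1"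
      unfolding of_real_mult[symmetric] power_mult_distrib[symmetric] using t by simp
    ultimately show "qev tB (\<i> * of_real t) = of_real ((1 / t) ^ 4) * qev tC (\<i> * of_real (1 / t))"
      using t by (simp add: mult.assoc[symmetric])
  qed
qed

text \<open>Jacobi's formula \<Delta> = (\<theta>2 \<theta>3 \<theta>4)^8 / 256 without its leading
  power. Taken as the definition, it makes the transformation laws and the nonvanishing of \<Delta>
  consequences of those of the theta functions; 256 = 2^8 cancels the constant term 2 of
  \<open>theta2\<close>.\<close>

definition Delta_unit :: "complex fps" where
  "Delta_unit = fps_const (1 / 256) * ((theta3 * theta4) ^ 8 * theta2 ^ 8)"

text \<open>All series are in \<open>exp (\<i> * pi * \<tau>)\<close>, so that \<open>\<Delta>\<close> starts with the square of the variable.\<close>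

definition Delta :: "complex fps" where
  "Delta = fps_X ^ 2 * Delta_unit"

text \<open>The classical expression of the Eisenstein series E4 by theta functions, again symmetric
  in the three eighth powers.\<close>

definition Eis4 :: "complex fps" where
  "Eis4 = fps_const (1 / 2) * (tA + tB + tC)"

lemma Delta_unit_conv_radius: "fps_conv_radius Delta_unit \<ge> 1"
  unfolding Delta_unit_def by (intro conv_radius_ge theta_conv_radius) simp

lemma Delta_conv_radius: "fps_conv_radius Delta \<ge> 1"
  unfolding Delta_def by (intro conv_radius_ge Delta_unit_conv_radius) simp

lemma Delta_eq: "Delta = fps_const (1 / 256) * (tA * (tB * tC))"
  unfolding Delta_def Delta_unit_def tA_def tB_def tC_def by (simp only: power_mult_distrib mult_ac)

lemma qev_Delta: "Im \<tau> > 0 \<Longrightarrow> qev Delta \<tau> = 1 / 256 * (qev tA \<tau> * (qev tB \<tau> * qev tC \<tau>))"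
  unfolding Delta_eq by (simp add: qev_mult conv_radius_ge theta8_conv_radius)

lemma qev_Eis4: "Im \<tau> > 0 \<Longrightarrow> qev Eis4 \<tau> = 1 / 2 * (qev tA \<tau> + qev tB \<tau> + qev tC \<tau>)"
  unfolding Eis4_def by (simp add: qev_mult qev_add conv_radius_ge theta8_conv_radius)

lemma modular_form_Delta: "modular_form 12 Delta"
  unfolding modular_form_def
proof (intro conjI allI impI)
  fix \<tau> assume t: "Im \<tau> > 0"
  show "qev Delta (\<tau> + 1) = qev Delta \<tau>"
    unfolding qev_Delta[OF t] qev_Delta[OF uhp_translate[OF t]] theta8_translate[OF t] by (simp only: mult_ac)
  have "\<tau> ^ 12 = \<tau> ^ 4 * (\<tau> ^ 4 * \<tau> ^ 4)" by (simp only: power_add[symmetric]) simp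
  then show "qev Delta (- 1 / \<tau>) = \<tau> ^ 12 * qev Delta \<tau>"
    unfolding qev_Delta[OF t] qev_Delta[OF uhp_inversion[OF t]] theta8_invert[OF t] by (simp only: mult_ac)
qed (rule Delta_conv_radius)

lemma modular_form_Eis4: "modular_form 4 Eis4"
  unfolding modular_form_def
proof (intro conjI allI impI)
  fix \<tau> assume t: "Im \<tau> > 0"
  show "qev Eis4 (\<tau> + 1) = qev Eis4 \<tau>"
    unfolding qev_Eis4[OF t] qev_Eis4[OF uhp_translate[OF t]] theta8_translate[OF t] by (simp only: add_ac)
  show "qev Eis4 (- 1 / \<tau>) = \<tau> ^ 4 * qev Eis4 \<tau>"
    unfolding qev_Eis4[OF t] qev_Eis4[OF uhp_inversion[OF t]] theta8_invert[OF t] by (simp add: algebra_simps)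
qed (unfold Eis4_def, intro conv_radius_ge theta8_conv_radius, simp)

section \<open>Nonvanishing and first coefficients of the discriminant\<close>

lemma norm_sum_unit_le:
  fixes a b :: int and c :: "int \<Rightarrow> complex"
  assumes "X \<subseteq> {a, b}" "\<And>n. norm (c n) \<le> 1"
  shows "norm (sum c X) \<le> 2"
proof -
  have "norm (sum c X) \<le> of_nat (card X) * 1"
    using assms(2) by (intro sum_norm_bound)
  moreover have "card X \<le> card {a, b}" by (intro card_mono assms(1)) simp
  moreover have "card {a, b} \<le> 2" by (simp add: card_insert_if)
  ultimately show ?thesis by simp
qed

text \<open>Each exponent is attained by at most two integers. The bound feeds the nonvanishing
  criterion \<open>eval_fps_nonzero\<close>.\<close>

lemma theta_nth_le: "norm (fps_nth theta3 m) \<le> 2" "norm (fps_nth theta4 m) \<le> 2" "norm (fps_nth theta2 m) \<le> 2"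
proof -
  obtain a where a: "{n::int. nat (n\<^sup>2) = m} \<subseteq> {a, - a}" using square_fiber by blast
  obtain b where b: "{n::int. nat (n\<^sup>2 + n) = m} \<subseteq> {b, - 1 - b}" using square_plus_fiber by blast
  show "norm (fps_nth theta3 m) \<le> 2" "norm (fps_nth theta4 m) \<le> 2" "norm (fps_nth theta2 m) \<le> 2"
    unfolding theta2_def theta3_def theta4_def level_fps_def fps_nth_Abs_fps
    using a b by (intro norm_sum_unit_le; force)+
qed

lemma fiber_0_1_2:
  "{n::int. nat (n\<^sup>2) = 0} = {0}" "{n::int. nat (n\<^sup>2) = 1} = {1, -1}" "{n::int. nat (n\<^sup>2) = 2} = {}"
  "{n::int. nat (n\<^sup>2 + n) = 0} = {0, -1}" "{n::int. nat (n\<^sup>2 + n) = 1} = {}" "{n::int. nat (n\<^sup>2 + n) = 2} = {1, -2}"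
proof -
  have nn: "n\<^sup>2 \<ge> 0" "n\<^sup>2 + n \<ge> 0" for n :: int
    using int_square_plus_nonneg[of n] by auto
  show "{n::int. nat (n\<^sup>2) = 0} = {0}" by auto
  have 1: "nat (n\<^sup>2) = 1 \<longleftrightarrow> n = 1 \<or> n = - 1" for n :: int
    by (simp add: nat_eq_iff power2_eq_1_iff)
  show "{n::int. nat (n\<^sup>2) = 1} = {1, -1}" unfolding 1 by auto
  have 2: "nat (n\<^sup>2) \<noteq> 2" for n :: int
  proof
    assume "nat (n\<^sup>2) = 2"
    then have 2: "n\<^sup>2 = 2" by (simp add: nat_eq_iff)
    then have "\<not> 2 \<le> \<bar>n\<bar>" using abs_le_square_iff[of 2 n] by simp
    then have "n = -1 \<or> n = 0 \<or> n = 1" by linarith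
    then show False using 2 by auto
  qed
  then show "{n::int. nat (n\<^sup>2) = 2} = {}" by simp
  have e: "n\<^sup>2 + n = n * (n + 1)" for n :: int
    by (simp add: power2_eq_square distrib_left)
  have 3: "nat (n\<^sup>2 + n) = 0 \<longleftrightarrow> n = 0 \<or> n = - 1" for n :: int
  proof -
    have "nat (n\<^sup>2 + n) = 0 \<longleftrightarrow> n\<^sup>2 + n = 0" using nn(2)[of n] by simp
    also have "\<dots> \<longleftrightarrow> n = 0 \<or> n + 1 = 0" unfolding e by (rule mult_eq_0_iff)
    also have "\<dots> \<longleftrightarrow> n = 0 \<or> n = - 1" by auto
    finally show ?thesis .
  qed
  show "{n::int. nat (n\<^sup>2 + n) = 0} = {0, -1}" unfolding 3 by auto
  have 4: "nat (n\<^sup>2 + n) \<noteq> 1" for n :: int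
  proof
    assume "nat (n\<^sup>2 + n) = 1"
    then have "int (nat (n\<^sup>2 + n)) = 1" by simp
    then have "n\<^sup>2 + n = 1" using nn(2)[of n] by simp
    moreover have "even (n\<^sup>2 + n)" by simp
    ultimately show False by simp
  qed
  then show "{n::int. nat (n\<^sup>2 + n) = 1} = {}" by simp
  have 5: "nat (n\<^sup>2 + n) = 2 \<longleftrightarrow> n = 1 \<or> n = - 2" for n :: int
  proof -
    have "(n - 1) * (n + 2) = n\<^sup>2 + n - 2" by (simp add: power2_eq_square algebra_simps)
    then have "nat (n\<^sup>2 + n) = 2 \<longleftrightarrow> (n - 1) * (n + 2) = 0" by (simp only: nat_eq_iff) auto
    also have "\<dots> \<longleftrightarrow> n - 1 = 0 \<or> n + 2 = 0" by (rule mult_eq_0_iff)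
    also have "\<dots> \<longleftrightarrow> n = 1 \<or> n = - 2" by auto
    finally show ?thesis .
  qed
  show "{n::int. nat (n\<^sup>2 + n) = 2} = {1, -2}" unfolding 5 by auto
qed

lemma theta_nth:
  "fps_nth theta3 0 = 1" "fps_nth theta3 1 = 2" "fps_nth theta3 2 = 0"
  "fps_nth theta4 0 = 1" "fps_nth theta4 1 = - 2" "fps_nth theta4 2 = 0"
  "fps_nth theta2 0 = 2" "fps_nth theta2 1 = 0" "fps_nth theta2 2 = 2"
  unfolding theta2_def theta3_def theta4_def level_fps_def fps_nth_Abs_fps
  by (simp_all only: UNIV_I simp_thms fiber_0_1_2) simp_all

text \<open>The tail is at most 2r / (1 - r) with r = |z|, and this is below 1 exactly when r <
  1/3.\<close>

lemma eval_fps_nonzero: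
  fixes F :: "complex fps"
  assumes c: "fps_conv_radius F \<ge> 1" and b: "\<And>m. norm (fps_nth F m) \<le> 2" "norm (fps_nth F 0) \<ge> 1"
    and z: "norm z < 1 / 3"
  shows "eval_fps F z \<noteq> 0"
proof
  assume 0: "eval_fps F z = 0"
  define r where "r = norm z"
  have r: "0 \<le> r" "r < 1 / 3" using z by (auto simp: r_def)
  have "ereal (norm z) < 1" using z by simp
  then have "ereal (norm z) < fps_conv_radius F" using c by (rule less_le_trans)
  then have "(\<lambda>m. fps_nth F m * z ^ m) sums eval_fps F z" by (rule sums_eval_fps)
  then have "(\<lambda>m. fps_nth F (Suc m) * z ^ Suc m) sums (0 - fps_nth F 0 * z ^ 0)"
    unfolding 0 by (subst sums_Suc_iff) simp
  then have s: "(\<lambda>m. fps_nth F (Suc m) * z ^ Suc m) sums (- fps_nth F 0)" by simp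
  have g: "(\<lambda>m. 2 * r * r ^ m) sums (2 * r * (1 / (1 - r)))"
    using r by (intro sums_mult geometric_sums) simp
  have "norm (- fps_nth F 0) \<le> 2 * r * (1 / (1 - r))"
  proof -
    have "norm (\<Sum>m. fps_nth F (Suc m) * z ^ Suc m) \<le> (\<Sum>m. 2 * r * r ^ m)"
    proof (rule norm_suminf_le)
      fix m
      have "norm (fps_nth F (Suc m)) * r ^ Suc m \<le> 2 * r ^ Suc m"
        using b(1) r by (intro mult_right_mono) auto
      then show "norm (fps_nth F (Suc m) * z ^ Suc m) \<le> 2 * r * r ^ m"
        by (simp add: norm_mult norm_power r_def mult_ac)
    qed (use g in \<open>simp add: sums_iff\<close>)
    then show ?thesis using g s by (simp only: sums_iff)
  qed
  also have "\<dots> < 1" using r by (simp add: field_simps)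
  finally show False using b(2) by simp
qed

text \<open>Nonvanishing is invariant under the modular group, so height at least 1/2 may be
  assumed. There the nome has modulus below 1/3, and the three theta series are visibly
  nonzero.\<close>

lemma Delta_nonzero:
  assumes "Im \<tau> > 0"
  shows "qev Delta \<tau> \<noteq> 0"
  using assms
proof (induction rule: modular_reduction)
  case (translate \<tau>)
  then show ?case by (simp only: modular_formD(2)[OF modular_form_Delta])
next
  case (invert \<tau>)
  then show ?case using modular_formD(3)[OF modular_form_Delta invert(1)] by auto
next
  case (fundamental \<tau>)
  have t: "Im \<tau> > 0" using fundamental by simp
  \<comment> \<open>pi * Im \<tau> is at least 3/2, and the quadratic Taylor polynomial of exp at
    3/2 already equals 29/8.\<close>
  have "3 < exp (pi * Im \<tau>)"
  proof -
    have "3 / 2 \<le> pi * Im \<tau>"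
      using mult_mono[of 3 pi "1 / 2" "Im \<tau>"] pi_gt3 fundamental by simp
    moreover have "1 + 3 / 2 + (3 / 2)\<^sup>2 / 2 \<le> exp (3 / 2 :: real)"
      by (rule exp_lower_Taylor_quadratic) simp
    ultimately have "1 + 3 / 2 + (3 / 2)\<^sup>2 / 2 \<le> exp (pi * Im \<tau>)"
      by (meson exp_le_cancel_iff order_trans)
    then show ?thesis by (simp add: power2_eq_square)
  qed
  then have n: "norm (nome \<tau>) < 1 / 3"
    unfolding norm_nome exp_minus by (simp add: field_simps)
  have nz: "qev theta3 \<tau> \<noteq> 0" "qev theta4 \<tau> \<noteq> 0" "qev theta2 \<tau> \<noteq> 0"
    unfolding qev_def
    by (rule eval_fps_nonzero[OF theta_conv_radius(1) theta_nth_le(1) _ n], simp add: theta_nth)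
       (rule eval_fps_nonzero[OF theta_conv_radius(2) theta_nth_le(2) _ n] eval_fps_nonzero[OF theta_conv_radius(3) theta_nth_le(3) _ n], simp add: theta_nth)+
  have "qev Delta_unit \<tau> = 1 / 256 * ((qev theta3 \<tau> * qev theta4 \<tau>) ^ 8 * qev theta2 \<tau> ^ 8)"
    unfolding Delta_unit_def using t by (simp add: qev_mult qev_power conv_radius_ge theta_conv_radius)
  then have "qev Delta_unit \<tau> \<noteq> 0" by (simp only:) (use nz in simp)
  moreover have "qev Delta \<tau> = nome \<tau> ^ 2 * qev Delta_unit \<tau>"
    unfolding Delta_def using t by (simp add: qev_mult Delta_unit_conv_radius)
  ultimately show ?case by simp
qed

lemma fps_mult_nth_012:
  fixes F G :: "complex fps"
  shows "fps_nth (F * G) 0 = fps_nth F 0 * fps_nth G 0"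
    "fps_nth (F * G) 1 = fps_nth F 0 * fps_nth G 1 + fps_nth F 1 * fps_nth G 0"
    "fps_nth (F * G) 2 = fps_nth F 0 * fps_nth G 2 + fps_nth F 1 * fps_nth G 1 + fps_nth F 2 * fps_nth G 0"
  by (simp_all add: fps_mult_nth numeral_2_eq_2)

lemma fps_power8_nth:
  fixes F :: "complex fps"
  assumes "fps_nth F 0 = a" "fps_nth F 1 = b" "fps_nth F 2 = c"
  shows "fps_nth (F ^ 8) 0 = a ^ 8" "fps_nth (F ^ 8) 1 = 8 * a ^ 7 * b" "fps_nth (F ^ 8) 2 = 8 * a ^ 7 * c + 28 * a ^ 6 * b ^ 2"
proof -
  have e: "F ^ 8 = ((F * F) * (F * F)) * ((F * F) * (F * F))" by (simp add: eval_nat_numeral mult_ac)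
  show "fps_nth (F ^ 8) 0 = a ^ 8" "fps_nth (F ^ 8) 1 = 8 * a ^ 7 * b" "fps_nth (F ^ 8) 2 = 8 * a ^ 7 * c + 28 * a ^ 6 * b ^ 2"
    unfolding e fps_mult_nth_012 assms by algebra+
qed

lemma Delta_unit_nth: "fps_nth Delta_unit 0 = 1" "fps_nth Delta_unit 1 = 0" "fps_nth Delta_unit 2 = - 24"
proof -
  have m: "fps_nth (theta3 * theta4) 0 = 1" "fps_nth (theta3 * theta4) 1 = 0" "fps_nth (theta3 * theta4) 2 = - 4"
    unfolding fps_mult_nth_012 theta_nth by simp_all
  note p = fps_power8_nth[OF m] fps_power8_nth[OF theta_nth(7-9)]
  show "fps_nth Delta_unit 0 = 1" "fps_nth Delta_unit 1 = 0" "fps_nth Delta_unit 2 = - 24"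
    unfolding Delta_unit_def fps_mult_left_const_nth fps_mult_nth_012 p by simp_all
qed

lemma Eis4_nth: "fps_nth Eis4 0 = 1" "fps_nth Eis4 1 = 0" "fps_nth Eis4 2 = 240"
proof -
  note p = fps_power8_nth[OF theta_nth(1-3)] fps_power8_nth[OF theta_nth(4-6)] fps_power8_nth[OF theta_nth(7-9)]
  show "fps_nth Eis4 0 = 1" "fps_nth Eis4 1 = 0" "fps_nth Eis4 2 = 240"
    unfolding Eis4_def tA_def tB_def tC_def fps_mult_left_const_nth fps_add_nth p fps_X_power_mult_nth by (simp_all add: p)
qed

lemma fps_power_nth_012:
  fixes F :: "complex fps"
  assumes "fps_nth F 0 = 1" "fps_nth F 1 = 0" "fps_nth F 2 = c"
  shows "fps_nth (F ^ m) 0 = 1 \<and> fps_nth (F ^ m) 1 = 0 \<and> fps_nth (F ^ m) 2 = of_nat m * c"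
proof (induction m)
  case (Suc m)
  then show ?case unfolding power_Suc fps_mult_nth_012 assms by (simp add: algebra_simps)
qed simp

text \<open>With Q the square of the nome, \<Delta> = Q (1 - 24 Q + ...) and E4 = 1 + 240 Q + ...;
  this is where all ratios between the two shells come from.\<close>

lemma Delta_power_nth:
  "fps_nth (Delta ^ m) (2 * m) = 1" "fps_nth (Delta ^ m) (2 * m + 2) = - 24 * of_nat m"
  "fps_nth (Eis4 * Delta ^ m) (2 * m) = 1" "fps_nth (Eis4 * Delta ^ m) (2 * m + 2) = 240 - 24 * of_nat m"
  "j < 2 * m \<Longrightarrow> fps_nth (Delta ^ m) j = 0" "j < 2 * m \<Longrightarrow> fps_nth (Eis4 * Delta ^ m) j = 0"
proof -
  have p: "fps_nth (Delta_unit ^ m) 0 = 1" "fps_nth (Delta_unit ^ m) 1 = 0" "fps_nth (Delta_unit ^ m) 2 = of_nat m * - 24"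
    using fps_power_nth_012[OF Delta_unit_nth, of m] by blast+
  have D: "Delta ^ m = fps_X ^ (2 * m) * Delta_unit ^ m"
    unfolding Delta_def power_mult_distrib power_mult ..
  have E: "Eis4 * Delta ^ m = fps_X ^ (2 * m) * (Eis4 * Delta_unit ^ m)"
    unfolding D by (simp only: mult_ac)
  show "fps_nth (Delta ^ m) (2 * m) = 1" "fps_nth (Delta ^ m) (2 * m + 2) = - 24 * of_nat m"
    "j < 2 * m \<Longrightarrow> fps_nth (Delta ^ m) j = 0"
    unfolding D fps_X_power_mult_nth by (simp_all add: p)
  show "fps_nth (Eis4 * Delta ^ m) (2 * m) = 1" "fps_nth (Eis4 * Delta ^ m) (2 * m + 2) = 240 - 24 * of_nat m"
    "j < 2 * m \<Longrightarrow> fps_nth (Eis4 * Delta ^ m) j = 0"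
    unfolding E fps_X_power_mult_nth
    by (simp_all add: fps_mult_nth_012[unfolded One_nat_def] p[unfolded One_nat_def] Eis4_nth[unfolded One_nat_def])
qed

subsection \<open>Modular forms vanishing to high order at infinity\<close>

lemma qev_Delta_unit: "Im \<tau> > 0 \<Longrightarrow> qev Delta \<tau> = nome \<tau> ^ 2 * qev Delta_unit \<tau>"
  unfolding Delta_def by (subst qev_mult) (simp_all add: Delta_unit_conv_radius)

text \<open>The quotient of F^12 by \<Delta>^k has weight 0 for every \<open>k\<close>, so the
  weight need not be a multiple of 12, and the bound on \<open>k\<close> makes it vanish at
  infinity.\<close>

theorem modular_form_vanishes:
  assumes F: "modular_form k F" and e: "\<And>m. m < e \<Longrightarrow> fps_nth F m = 0" and k: "k < 6 * e"
  shows "F = 0"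
proof (rule qev_zero_imp_zero[OF modular_formD(1)[OF F]])
  note Fc = modular_formD(1)[OF F]
  fix \<tau> :: complex assume t: "Im \<tau> > 0"
  define h where "h = (\<lambda>\<tau>. qev F \<tau> ^ 12 / qev Delta \<tau> ^ k)"
  have "h \<tau> = 0"
  proof (rule modular_function_vanishes[OF _ _ _ _ t])
    show "h holomorphic_on uhp"
      unfolding h_def using Delta_nonzero by (intro holomorphic_intros Fc Delta_conv_radius) auto
    fix \<tau> :: complex assume t: "Im \<tau> > 0"
    show "h (\<tau> + 1) = h \<tau>"
      unfolding h_def by (simp only: modular_formD(2)[OF F t] modular_formD(2)[OF modular_form_Delta t])
    have "\<tau> \<noteq> 0" using t by auto
    moreover have "(\<tau> ^ k) ^ 12 = (\<tau> ^ 12) ^ k" by (simp only: power_mult[symmetric] mult.commute)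
    ultimately show "h (- 1 / \<tau>) = h \<tau>"
      unfolding h_def modular_formD(3)[OF F t] modular_formD(3)[OF modular_form_Delta t] power_mult_distrib by simp
  next
    \<comment> \<open>Order of the quotient at infinity: F^12 contributes at least 12e, and
      \<Delta>^k has order 2k, since \<Delta> starts with the square of the nome.\<close>
    define l where "l = 12 * e - 2 * k"
    have l: "12 * e = l + 2 * k" "l > 0" using k by (auto simp: l_def)
    have "((\<lambda>\<tau>. nome \<tau> ^ l * qev (fps_shift e F) \<tau> ^ 12 / qev Delta_unit \<tau> ^ k) \<longlongrightarrow>
      0 ^ l * fps_nth (fps_shift e F) 0 ^ 12 / fps_nth Delta_unit 0 ^ k) at_ii"
      by (intro tendsto_intros nome_tendsto qev_tendsto) (use Fc Delta_unit_conv_radius in \<open>auto simp: Delta_unit_nth\<close>)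
    moreover have "eventually (\<lambda>\<tau>. nome \<tau> ^ l * qev (fps_shift e F) \<tau> ^ 12 / qev Delta_unit \<tau> ^ k = h \<tau>) at_ii"
      using eventually_uhp
    proof eventually_elim
      case (elim \<tau>)
      have "(nome \<tau> ^ e) ^ 12 = nome \<tau> ^ l * (nome \<tau> ^ 2) ^ k"
        using l(1) by (simp only: power_mult[symmetric] power_add[symmetric] mult.commute)
      moreover have "qev F \<tau> = nome \<tau> ^ e * qev (fps_shift e F) \<tau>"
        by (rule qev_shift_decomp[OF Fc _ elim]) (rule e)
      ultimately have num: "qev F \<tau> ^ 12 = nome \<tau> ^ l * (nome \<tau> ^ 2) ^ k * qev (fps_shift e F) \<tau> ^ 12"
        by (simp only: power_mult_distrib)
      show ?case
        unfolding h_def num qev_Delta_unit[OF elim] power_mult_distrib by simp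
    qed
    moreover have "(0::complex) ^ l = 0" using l(2) by (rule zero_power)
    ultimately show "(h \<longlongrightarrow> 0) at_ii"
      by (simp add: tendsto_cong)
  qed
  then show "qev F \<tau> = 0" using Delta_nonzero[OF t] by (simp add: h_def)
qed

lemma modular_form_cmult: "modular_form k F \<Longrightarrow> modular_form k (fps_const c * F)"
  using modular_form_mult[OF modular_form_const] by simp

text \<open>Subtracting the multiple of \<Delta>^m with the same leading coefficient raises the
  order to 2m + 1, and the weight 12m is below 6 (2m + 1).\<close>

lemma cusp_form_weight_0:
  assumes F: "modular_form (12 * m) F" and z: "\<And>j. j < 2 * m \<Longrightarrow> fps_nth F j = 0"
  shows "fps_nth F (2 * m + 2) = - 24 * of_nat m * fps_nth F (2 * m)"
proof -
  define c where "c = fps_nth F (2 * m)"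
  have "F - fps_const c * Delta ^ m = 0"
  proof (rule modular_form_vanishes)
    show "modular_form (12 * m) (F - fps_const c * Delta ^ m)"
      using modular_form_power[OF modular_form_Delta, of m]
      by (intro modular_form_diff F modular_form_cmult) (simp add: mult.commute)
    show "fps_nth (F - fps_const c * Delta ^ m) j = 0" if "j < 2 * m + 1" for j
      using that z[of j] by (cases "j = 2 * m") (auto simp: Delta_power_nth c_def)
  qed simp
  then have "F = fps_const c * Delta ^ m" by simp
  then have "fps_nth F (2 * m + 2) = c * fps_nth (Delta ^ m) (2 * m + 2)" by simp
  then show ?thesis unfolding Delta_power_nth by (simp add: c_def)
qed

text \<open>As in weight 12m, with E4 * \<Delta>^m in place of \<Delta>^m; the weight 12m + 4 is
  still below 6 (2m + 1).\<close>

lemma cusp_form_weight_4: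
  assumes F: "modular_form (12 * m + 4) F" and z: "\<And>j. j < 2 * m \<Longrightarrow> fps_nth F j = 0"
  shows "fps_nth F (2 * m + 2) = (240 - 24 * of_nat m) * fps_nth F (2 * m)"
proof -
  define c where "c = fps_nth F (2 * m)"
  have "F - fps_const c * (Eis4 * Delta ^ m) = 0"
  proof (rule modular_form_vanishes)
    have "modular_form (4 + m * 12) (Eis4 * Delta ^ m)"
      by (intro modular_form_mult modular_form_Eis4 modular_form_power modular_form_Delta)
    then show "modular_form (12 * m + 4) (F - fps_const c * (Eis4 * Delta ^ m))"
      by (intro modular_form_diff F modular_form_cmult) (simp add: mult.commute add.commute)
    show "fps_nth (F - fps_const c * (Eis4 * Delta ^ m)) j = 0" if "j < 2 * m + 1" for j
      using that z[of j] unfolding fps_sub_nth fps_mult_left_const_nth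
      by (cases "j = 2 * m") (auto simp: Delta_power_nth c_def)
  qed simp
  then have "F = fps_const c * (Eis4 * Delta ^ m)" by simp
  then have "fps_nth F (2 * m + 2) = c * fps_nth (Eis4 * Delta ^ m) (2 * m + 2)"
    by (simp only: fps_mult_left_const_nth)
  then show ?thesis unfolding Delta_power_nth by (simp add: c_def)
qed

text \<open>Order 2m alone does not satisfy the bound of \<open>modular_form_vanishes\<close>.
  Dividing by \<Delta>^m gives a form of weight 2, whose value at infinity is 0 by
  \<open>weight_2_limit_zero\<close>; this raises the order to 2m + 1, which suffices.\<close>

lemma cusp_form_weight_2:
  assumes F: "modular_form (12 * m + 2) F" and z: "\<And>j. j < 2 * m \<Longrightarrow> fps_nth F j = 0"
  shows "F = 0"
proof -
  note Fc = modular_formD(1)[OF F]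
  define g where "g = (\<lambda>\<tau>. qev F \<tau> / qev Delta \<tau> ^ m)"
  have c0: "fps_nth F (2 * m) = 0"
  proof (rule weight_2_limit_zero[of g])
    show "g holomorphic_on uhp"
      unfolding g_def using Delta_nonzero by (intro holomorphic_intros Fc Delta_conv_radius) auto
    fix \<tau> :: complex assume t: "Im \<tau> > 0"
    show "g (\<tau> + 1) = g \<tau>"
      unfolding g_def by (simp only: modular_formD(2)[OF F t] modular_formD(2)[OF modular_form_Delta t])
    have "\<tau> \<noteq> 0" using t by auto
    moreover have "\<tau> ^ (12 * m + 2) = (\<tau> ^ 12) ^ m * \<tau>\<^sup>2" by (simp only: power_mult power_add)
    ultimately show "g (- 1 / \<tau>) = \<tau>\<^sup>2 * g \<tau>"
      unfolding g_def modular_formD(3)[OF F t] modular_formD(3)[OF modular_form_Delta t] power_mult_distrib by simp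
  next
    have "((\<lambda>\<tau>. qev (fps_shift (2 * m) F) \<tau> / qev Delta_unit \<tau> ^ m) \<longlongrightarrow>
      fps_nth (fps_shift (2 * m) F) 0 / fps_nth Delta_unit 0 ^ m) at_ii"
      by (intro tendsto_intros qev_tendsto) (use Fc Delta_unit_conv_radius in \<open>auto simp: Delta_unit_nth\<close>)
    moreover have "eventually (\<lambda>\<tau>. qev (fps_shift (2 * m) F) \<tau> / qev Delta_unit \<tau> ^ m = g \<tau>) at_ii"
      using eventually_uhp
    proof eventually_elim
      case (elim \<tau>)
      have "qev F \<tau> = nome \<tau> ^ (2 * m) * qev (fps_shift (2 * m) F) \<tau>"
        by (rule qev_shift_decomp[OF Fc _ elim]) (rule z)
      then have num: "qev F \<tau> = (nome \<tau> ^ 2) ^ m * qev (fps_shift (2 * m) F) \<tau>"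
        by (simp only: power_mult)
      show ?case
        unfolding g_def num qev_Delta_unit[OF elim] power_mult_distrib by simp
    qed
    ultimately show "(g \<longlongrightarrow> fps_nth F (2 * m)) at_ii"
      by (simp add: tendsto_cong Delta_unit_nth)
  qed
  show ?thesis
  proof (rule modular_form_vanishes[OF F])
    show "fps_nth F j = 0" if "j < 2 * m + 1" for j
      using that z[of j] c0 by (cases "j = 2 * m") auto
  qed simp
qed

subsection \<open>Linear programming certificates\<close>

lemma Suc_mult_choose_Suc: "Suc i * (n choose Suc i) = (n - i) * (n choose i)"
  by (simp only: binomial_absorption binomial_absorb_comp)

text \<open>Makes the recursion explicit so that single polynomials can be computed. The induction
  needs general \<open>j\<close> and \<open>k\<close>, because one step of the recursion moves
  both.\<close>

lemma zonal_iter_closed_form: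
  "zonal_iter \<nu> k a c j = (\<Sum>i\<le>\<nu>. (- 4) ^ i * of_nat (\<nu> choose i) * a ^ (\<nu> - i) *
     (pochhammer (of_nat j + 1) i * pochhammer (of_nat (k + j + \<nu>) - 1) i) * c (j + i))"
proof (induction \<nu> arbitrary: k c)
  case (Suc \<nu>)
  define K where "K = real (k + j + \<nu>)"
  define w where "w = (\<lambda>i. (- 4) ^ i * of_nat (\<nu> choose i) * a ^ (\<nu> - i) *
     (pochhammer (of_nat j + 1) i * pochhammer (K + 1) i))"
  define v where "v = (\<lambda>i. (- 4) ^ i * of_nat (Suc \<nu> choose i) * a ^ (Suc \<nu> - i) *
     (pochhammer (of_nat j + 1) i * pochhammer K i))"
  have v0: "v 0 = w 0 * a" by (simp add: v_def w_def)
  \<comment> \<open>Once the common factor \<open>E\<close> is removed, this is Pascal's rule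
    together with (i + 1) C(\<nu>, i + 1) = (\<nu> - i) C(\<nu>, i).\<close>
  have vS: "v (Suc i) = w (Suc i) * a - w i * (4 * of_nat ((j + i + 1) * (k + (j + i))))" if i: "i \<le> \<nu>" for i
  proof -
    define E where "E = (- 4) ^ i * a ^ (\<nu> - i) * (pochhammer (of_nat j + 1) i * pochhammer (K + 1) i) * (of_nat j + 1 + of_nat i)"
    have 1: "v (Suc i) = - 4 * E * (of_nat (Suc \<nu> choose Suc i) * K)"
      by (simp add: v_def E_def pochhammer_rec[of K] pochhammer_Suc[of "of_nat j + 1"] mult_ac del: binomial_Suc_Suc)
    have 2: "w (Suc i) * a = - 4 * E * (of_nat (\<nu> choose Suc i) * (K + 1 + of_nat i))"
    proof (cases "i = \<nu>")
      case False
      then have "\<nu> - i = Suc (\<nu> - Suc i)" using i by simp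
      then show ?thesis by (simp add: w_def E_def pochhammer_Suc mult_ac)
    qed (simp add: w_def)
    have 3: "w i * (4 * of_nat ((j + i + 1) * (k + (j + i)))) = 4 * E * (of_nat (\<nu> choose i) * (K - (of_nat \<nu> - of_nat i)))"
    proof -
      have "real ((j + i + 1) * (k + (j + i))) = (of_nat j + 1 + of_nat i) * (K - (of_nat \<nu> - of_nat i))"
        by (simp add: K_def algebra_simps)
      then show ?thesis by (simp only: w_def E_def mult_ac)
    qed
    have "real (Suc i * (\<nu> choose Suc i)) = real ((\<nu> - i) * (\<nu> choose i))"
      by (simp only: Suc_mult_choose_Suc)
    then have c: "of_nat (\<nu> choose Suc i) * (1 + real i) = of_nat (\<nu> choose i) * (of_nat \<nu> - of_nat i)"
      using i by (simp add: of_nat_diff algebra_simps)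
    have "of_nat (Suc \<nu> choose Suc i) * K = of_nat (\<nu> choose Suc i) * (K + 1 + real i) + of_nat (\<nu> choose i) * (K - (of_nat \<nu> - of_nat i))"
      using c by (simp add: algebra_simps)
    then show ?thesis unfolding 1 2 3 by (simp add: algebra_simps)
  qed
  have wz: "w (Suc \<nu>) = 0" by (simp add: w_def)
  have e: "real (k + 2 + j + \<nu>) - 1 = K + 1" "real (k + j + Suc \<nu>) - 1 = K" by (simp_all add: K_def)
  have "zonal_iter (Suc \<nu>) k a c j = (\<Sum>i\<le>\<nu>. w i * (a * c (j + i) - 4 * of_nat ((j + i + 1) * (k + (j + i))) * c (j + i + 1)))"
    unfolding zonal_iter.simps Suc.IH e w_def ..
  also have "\<dots> = (\<Sum>i\<le>\<nu>. w i * a * c (j + i)) - (\<Sum>i\<le>\<nu>. w i * (4 * of_nat ((j + i + 1) * (k + (j + i)))) * c (j + Suc i))"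
    unfolding sum_subtractf[symmetric] by (intro sum.cong refl) (simp add: algebra_simps)
  also have "(\<Sum>i\<le>\<nu>. w i * a * c (j + i)) = (\<Sum>i\<le>Suc \<nu>. w i * a * c (j + i))"
    by (simp add: wz)
  also have "\<dots> = w 0 * a * c (j + 0) + (\<Sum>i\<le>\<nu>. w (Suc i) * a * c (j + Suc i))"
    by (rule sum.atMost_Suc_shift)
  also have "\<dots> - (\<Sum>i\<le>\<nu>. w i * (4 * of_nat ((j + i + 1) * (k + (j + i)))) * c (j + Suc i)) =
     v 0 * c (j + 0) + (\<Sum>i\<le>\<nu>. v (Suc i) * c (j + Suc i))"
    unfolding add_diff_eq[symmetric] sum_subtractf[symmetric] v0
    by (intro arg_cong2[of _ _ _ _ "(+)"] refl sum.cong) (simp add: vS left_diff_distrib)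
  also have "\<dots> = (\<Sum>i\<le>Suc \<nu>. v i * c (j + i))"
    by (rule sum.atMost_Suc_shift[symmetric])
  finally show ?case unfolding e v_def .
qed simp

lemma zonal_expansion:
  "zonal \<nu> k a p = (\<Sum>i\<le>\<nu>. (- 4) ^ i * of_nat (\<nu> choose i) * a ^ (\<nu> - i) *
     (fact i * pochhammer (of_nat (k + \<nu>) - 1) i) * ((p\<^sup>2) ^ i / fact (2 * i)))"
  unfolding zonal_def zonal_iter_closed_form by (simp add: power_mult pochhammer_fact add.commute)

section \<open>Zonal polynomials and certificates in rank 40\<close>

lemma zonal_20_1: "zonal 1 20 a p = a - 40 * p\<^sup>2"
  unfolding zonal_expansion
  by (simp add: atMost_nat_numeral binomial_fact fact_numeral pochhammer_prod eval_nat_numeral algebra_simps)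

lemma zonal_20_2: "zonal 2 20 a p = a ^ 2 - 84 * a * p\<^sup>2 + 616 * (p\<^sup>2) ^ 2"
  unfolding zonal_expansion
  by (simp add: atMost_nat_numeral binomial_fact fact_numeral pochhammer_prod eval_nat_numeral algebra_simps)

text \<open>The factor 5, like 7 and 77 in the other instances, clears the denominators of the
  coefficients.\<close>

lemma zonal_20_3: "5 * zonal 3 20 a p = 5 * a ^ 3 - 660 * a ^ 2 * p\<^sup>2 + 10120 * a * (p\<^sup>2) ^ 2 - 32384 * (p\<^sup>2) ^ 3"
  unfolding zonal_expansion
  by (simp add: atMost_nat_numeral binomial_fact fact_numeral pochhammer_prod eval_nat_numeral algebra_simps)

lemma zonal_20_4: "7 * zonal 4 20 a p = 7 * a ^ 4 - 1288 * a ^ 3 * p\<^sup>2 + 30912 * a ^ 2 * (p\<^sup>2) ^ 2 - 206080 * a * (p\<^sup>2) ^ 3 + 382720 * (p\<^sup>2) ^ 4"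
  unfolding zonal_expansion
  by (simp add: atMost_nat_numeral binomial_fact fact_numeral pochhammer_prod eval_nat_numeral algebra_simps)

lemmas zonal_20 = zonal_20_1 zonal_20_2 zonal_20_3 zonal_20_4

text \<open>
  The multipliers solve the linear system expressing that \<open>f1\<close> is constant on the admissible
  values of \<open>(p x)\<^sup>2\<close> and that \<open>f2\<close> vanishes at all of them but the largest; the denominators are
  cleared. Shifting \<open>t\<close> by its lower bound makes all coefficients of \<open>K\<close> and \<open>Q\<close> nonnegative.
\<close>

lemma inconsistent_moments_40:
  fixes S1 :: "'b set" and S2 :: "'b set" and p :: "'b \<Rightarrow> real" and t :: real
  assumes fin: "finite S1" "S1 \<noteq> {}"
    and S1: "\<And>x. x \<in> S1 \<Longrightarrow> (p x)\<^sup>2 \<in> {0, 1, 4}"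
    and S2: "\<And>x. x \<in> S2 \<Longrightarrow> (p x)\<^sup>2 \<in> {0, 1, 4, 9}"
    and t: "t \<ge> 4"
    and rel: "(\<Sum>x\<in>S1. zonal 1 20 (8 * t) (p x)) = 0" "(\<Sum>x\<in>S2. zonal 1 20 (12 * t) (p x)) = 0"
      "(\<Sum>x\<in>S1. zonal 3 20 (8 * t) (p x)) = 0" "(\<Sum>x\<in>S2. zonal 3 20 (12 * t) (p x)) = 0"
      "(\<Sum>x\<in>S2. zonal 2 20 (12 * t) (p x)) = - 48 * (\<Sum>x\<in>S1. zonal 2 20 (8 * t) (p x))"
      "(\<Sum>x\<in>S2. zonal 4 20 (12 * t) (p x)) = 192 * (\<Sum>x\<in>S1. zonal 4 20 (8 * t) (p x))"
  shows False
proof -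
  define A1 where "A1 = 572603006976 + t * ((- 2615289870336) + t * (4534093943808 + t * ((- 3915570048000) + t * (1792470650880 + t * ((- 413583206400) + t * (37487923200))))))"
  define A3 where "A3 = (- 707266560) + t * (1391580960 + t * ((- 1009547280) + t * (322660800 + t * ((- 38556000)))))"
  define B1 where "B1 = t * ((- 2323875840) + t * (8739793920 + t * ((- 11022336000) + t * (6329232000 + t * ((- 1710072000) + t * (176904000))))))"
  define B2 where "B2 = 193656320 + t * ((- 1004592160) + t * (1583800608 + t * ((- 1089381384) + t * (343586880 + t * ((- 40687920))))))"
  define B3 where "B3 = 4604600 + t * ((- 12397000) + t * (11422950 + t * ((- 4435200) + t * (623700))))"
  define B4 where "B4 = 77924 + t * ((- 122452) + t * (64515 + t * ((- 11385))))"
  define K where "K = t * (4580824055808 + t * ((- 20327406747648) + t * (31376042041344 + t * ((- 23325651148800) + t * (9082845757440 + t * ((- 1782311731200) + t * (138881433600)))))))"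
  define Q where "Q = 96626757427200 + t * ((- 161044595712000) + t * (100286861875200 + t * ((- 27689485824000) + t * (2864429568000))))"
  \<comment> \<open>The factors 48 and -192 are forced: by \<open>rel\<close>, the degree 2 and
    degree 4 terms then cancel against those of \<open>f2\<close> with multipliers \<open>B2\<close>
    and \<open>B4\<close>. The multipliers of degrees 1 and 3 are free on each shell, since those
    sums vanish.\<close>
  define f1 where "f1 = (\<lambda>p. A1 * zonal 1 20 (8 * t) p + 48 * B2 * zonal 2 20 (8 * t) p + A3 * (5 * zonal 3 20 (8 * t) p) + (- 192) * B4 * (7 * zonal 4 20 (8 * t) p))"
  define f2 where "f2 = (\<lambda>p. B1 * zonal 1 20 (12 * t) p + B2 * zonal 2 20 (12 * t) p + B3 * (5 * zonal 3 20 (12 * t) p) + B4 * (7 * zonal 4 20 (12 * t) p))"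
  have f1_0: "f1 y = K" if "y\<^sup>2 = 0" for y
    unfolding f1_def K_def A1_def A3_def B1_def B2_def B3_def B4_def zonal_20 that by (simp add: algebra_simps eval_nat_numeral)
  have f1_1: "f1 y = K" if "y\<^sup>2 = 1" for y
    unfolding f1_def K_def A1_def A3_def B1_def B2_def B3_def B4_def zonal_20 that by (simp add: algebra_simps eval_nat_numeral)
  have f1_4: "f1 y = K" if "y\<^sup>2 = 4" for y
    unfolding f1_def K_def A1_def A3_def B1_def B2_def B3_def B4_def zonal_20 that by algebra
  have f1: "f1 y = K" if "y\<^sup>2 \<in> {0, 1, 4}" for y
    using that by (elim insertE emptyE) (rule f1_0 f1_1 f1_4, assumption)+
  have f2_0: "f2 y = 0" if "y\<^sup>2 = 0" for y
    unfolding f2_def A1_def A3_def B1_def B2_def B3_def B4_def zonal_20 that by (simp add: algebra_simps eval_nat_numeral)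
  have f2_1: "f2 y = 0" if "y\<^sup>2 = 1" for y
    unfolding f2_def A1_def A3_def B1_def B2_def B3_def B4_def zonal_20 that by (simp add: algebra_simps eval_nat_numeral)
  have f2_4: "f2 y = 0" if "y\<^sup>2 = 4" for y
    unfolding f2_def A1_def A3_def B1_def B2_def B3_def B4_def zonal_20 that by algebra
  have f2_9: "f2 y = Q" if "y\<^sup>2 = 9" for y
    unfolding f2_def Q_def A1_def A3_def B1_def B2_def B3_def B4_def zonal_20 that by algebra
  obtain u where u: "t = u + 4" "u \<ge> 0" using t by (auto intro: that[of "t - 4"])
  have "K = 5703397539840 + u * (34172651175936 + u * (72373172551680 + u * (74439573970944 + u * (41670859776000 + u * (12971525898240 + u * (2106368409600 + u * (138881433600)))))))"
    unfolding K_def u by algebra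
  then have K: "K > 0" using u(2) by (simp only:) (intro add_pos_nonneg mult_nonneg_nonneg add_nonneg_nonneg; simp)
  have "Q = 18205041254400 + u * (45448949145600 + u * (42998270515200 + u * (18141387264000 + u * (2864429568000))))"
    unfolding Q_def u by algebra
  then have Q: "Q \<ge> 0" using u(2) by (simp only:) (intro mult_nonneg_nonneg add_nonneg_nonneg; simp)
  have f2: "f2 y \<ge> 0" if "y\<^sup>2 \<in> {0, 1, 4, 9}" for y
    using that by (elim insertE emptyE) (simp_all only: order_refl zero_le_numeral Q f2_0 f2_1 f2_4 f2_9)
  have "(\<Sum>x\<in>S1. f1 (p x)) + (\<Sum>x\<in>S2. f2 (p x)) = 0"
    unfolding f1_def f2_def sum.distrib sum_distrib_left[symmetric] rel by simp
  moreover have "(\<Sum>x\<in>S1. f1 (p x)) > 0"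
    using fin K f1[OF S1] by (intro sum_pos) simp_all
  moreover have "(\<Sum>x\<in>S2. f2 (p x)) \<ge> 0"
    by (intro sum_nonneg f2 S2)
  ultimately show False by simp
qed

text \<open>
  Here \<open>f1\<close> vanishes except at \<open>x0\<close> and its negative, and \<open>f2\<close> except at the largest admissible value.
\<close>

lemma inconsistent_moments_40_minimal:
  fixes S1 :: "'b set" and S2 :: "'b set" and p :: "'b \<Rightarrow> real"
  assumes fin: "finite S1" "x0 \<in> S1" "(p x0)\<^sup>2 = 16"
    and S1: "\<And>x. x \<in> S1 \<Longrightarrow> (p x)\<^sup>2 \<in> {0, 1, 4, 16}"
    and S2: "\<And>x. x \<in> S2 \<Longrightarrow> (p x)\<^sup>2 \<in> {0, 1, 9}"
    and rel: "(\<Sum>x\<in>S1. zonal 1 20 16 (p x)) = 0" "(\<Sum>x\<in>S2. zonal 1 20 24 (p x)) = 0"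
      "(\<Sum>x\<in>S1. zonal 3 20 16 (p x)) = 0" "(\<Sum>x\<in>S2. zonal 3 20 24 (p x)) = 0"
      "(\<Sum>x\<in>S2. zonal 2 20 24 (p x)) = - 48 * (\<Sum>x\<in>S1. zonal 2 20 16 (p x))"
      "(\<Sum>x\<in>S2. zonal 4 20 24 (p x)) = 192 * (\<Sum>x\<in>S1. zonal 4 20 16 (p x))"
  shows False
proof -
  \<comment> \<open>The norm of \<open>v\<close> is 4, hence the arguments 16 = 4 * 4 and 24 = 4 *
    6. Cancellation in degrees 2 and 4 requires 1563334656 = 48 * 32569472 and 1797312 = (-192) *
    (-9361).\<close>
  define f1 where "f1 = (\<lambda>p. 78491811840 * zonal 1 20 16 p + 1563334656 * zonal 2 20 16 p + (- 121123200) * (5 * zonal 3 20 16 p) + 1797312 * (7 * zonal 4 20 16 p))"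
  define f2 where "f2 = (\<lambda>p. 539185920 * zonal 1 20 24 p + 32569472 * zonal 2 20 24 p + (- 144100) * (5 * zonal 3 20 24 p) + (- 9361) * (7 * zonal 4 20 24 p))"
  have f1_0: "f1 y = 0" if "y\<^sup>2 = 0" for y
    unfolding f1_def zonal_20 that by simp
  have f1_1: "f1 y = 0" if "y\<^sup>2 = 1" for y
    unfolding f1_def zonal_20 that by simp
  have f1_4: "f1 y = 0" if "y\<^sup>2 = 4" for y
    unfolding f1_def zonal_20 that by simp
  have f1_16: "f1 y = 35831304054374400" if "y\<^sup>2 = 16" for y
    unfolding f1_def zonal_20 that by simp
  have f2_0: "f2 y = 0" if "y\<^sup>2 = 0" for y
    unfolding f2_def zonal_20 that by simp
  have f2_1: "f2 y = 0" if "y\<^sup>2 = 1" for y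
    unfolding f2_def zonal_20 that by simp
  have f2_9: "f2 y = 145494835200" if "y\<^sup>2 = 9" for y
    unfolding f2_def zonal_20 that by simp
  have f1: "f1 y \<ge> 0" if "y\<^sup>2 \<in> {0, 1, 4, 16}" for y
    using that by (elim insertE emptyE) (simp_all only: order_refl zero_le_numeral f1_0 f1_1 f1_4 f1_16)
  have f2: "f2 y \<ge> 0" if "y\<^sup>2 \<in> {0, 1, 9}" for y
    using that by (elim insertE emptyE) (simp_all only: order_refl zero_le_numeral f2_0 f2_1 f2_9)
  have "(\<Sum>x\<in>S1. f1 (p x)) + (\<Sum>x\<in>S2. f2 (p x)) = 0"
    unfolding f1_def f2_def sum.distrib sum_distrib_left[symmetric] rel by simp
  moreover have "(\<Sum>x\<in>S1. f1 (p x)) > 0"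
    by (rule sum_pos2[OF fin(1,2)]) (simp add: f1_16[OF fin(3)], intro f1 S1)
  moreover have "(\<Sum>x\<in>S2. f2 (p x)) \<ge> 0"
    by (intro sum_nonneg f2 S2)
  ultimately show False by simp
qed

section \<open>Zonal polynomials and certificates in rank 80\<close>

lemma zonal_40_1: "zonal 1 40 a p = a - 80 * p\<^sup>2"
  unfolding zonal_expansion
  by (simp add: atMost_nat_numeral binomial_fact fact_numeral pochhammer_prod eval_nat_numeral algebra_simps)

lemma zonal_40_2: "zonal 2 40 a p = a ^ 2 - 164 * a * p\<^sup>2 + 2296 * (p\<^sup>2) ^ 2"
  unfolding zonal_expansion
  by (simp add: atMost_nat_numeral binomial_fact fact_numeral pochhammer_prod eval_nat_numeral algebra_simps)

lemma zonal_40_3: "5 * zonal 3 40 a p = 5 * a ^ 3 - 1260 * a ^ 2 * p\<^sup>2 + 36120 * a * (p\<^sup>2) ^ 2 - 211904 * (p\<^sup>2) ^ 3"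
  unfolding zonal_expansion
  by (simp add: atMost_nat_numeral binomial_fact fact_numeral pochhammer_prod eval_nat_numeral algebra_simps)

lemma zonal_40_4: "7 * zonal 4 40 a p = 7 * a ^ 4 - 2408 * a ^ 3 * p\<^sup>2 + 105952 * a ^ 2 * (p\<^sup>2) ^ 2 - 1271424 * a * (p\<^sup>2) ^ 3 + 4177536 * (p\<^sup>2) ^ 4"
  unfolding zonal_expansion
  by (simp add: atMost_nat_numeral binomial_fact fact_numeral pochhammer_prod eval_nat_numeral algebra_simps)

lemma zonal_40_5: "7 * zonal 5 40 a p = 7 * a ^ 5 - 3080 * a ^ 4 * p\<^sup>2 + 184800 * a ^ 3 * (p\<^sup>2) ^ 2 - 3400320 * a ^ 2 * (p\<^sup>2) ^ 3 + 22830720 * a * (p\<^sup>2) ^ 4 - 48705536 * (p\<^sup>2) ^ 5"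
  unfolding zonal_expansion
  by (simp add: atMost_nat_numeral binomial_fact fact_numeral pochhammer_prod eval_nat_numeral algebra_simps)

lemma zonal_40_6: "77 * zonal 6 40 a p = 77 * a ^ 6 - 41580 * a ^ 5 * p\<^sup>2 + 3187800 * a ^ 4 * (p\<^sup>2) ^ 2 - 79907520 * a ^ 3 * (p\<^sup>2) ^ 3 + 821905920 * a ^ 2 * (p\<^sup>2) ^ 4 - 3579856896 * a * (p\<^sup>2) ^ 5 + 5424025600 * (p\<^sup>2) ^ 6"
  unfolding zonal_expansion
  by (simp add: atMost_nat_numeral binomial_fact fact_numeral pochhammer_prod eval_nat_numeral algebra_simps)

lemmas zonal_40 = zonal_40_1 zonal_40_2 zonal_40_3 zonal_40_4 zonal_40_5 zonal_40_6

text \<open>Again \<open>f1\<close> is made constant on the admissible values and \<open>f2\<close>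
  zero at all of them but the largest: ten conditions on ten multipliers and the constant
  \<open>K\<close>. The parameter \<open>t\<close> is half the norm of \<open>v\<close>, and its
  lower bound 6 is the shift that makes all coefficients of \<open>K\<close> and \<open>Q\<close>
  positive.\<close>

lemma inconsistent_moments_80:
  fixes S1 :: "'b set" and S2 :: "'b set" and p :: "'b \<Rightarrow> real" and t :: real
  assumes fin: "finite S1" "S1 \<noteq> {}"
    and S1: "\<And>x. x \<in> S1 \<Longrightarrow> (p x)\<^sup>2 \<in> {0, 1, 4, 9, 16}"
    and S2: "\<And>x. x \<in> S2 \<Longrightarrow> (p x)\<^sup>2 \<in> {0, 1, 4, 9, 16, 25}"
    and t: "t \<ge> 6"
    and rel: "(\<Sum>x\<in>S1. zonal 1 40 (16 * t) (p x)) = 0" "(\<Sum>x\<in>S2. zonal 1 40 (20 * t) (p x)) = 0"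
      "(\<Sum>x\<in>S1. zonal 2 40 (16 * t) (p x)) = 0" "(\<Sum>x\<in>S2. zonal 2 40 (20 * t) (p x)) = 0"
      "(\<Sum>x\<in>S1. zonal 3 40 (16 * t) (p x)) = 0" "(\<Sum>x\<in>S2. zonal 3 40 (20 * t) (p x)) = 0"
      "(\<Sum>x\<in>S1. zonal 5 40 (16 * t) (p x)) = 0" "(\<Sum>x\<in>S2. zonal 5 40 (20 * t) (p x)) = 0"
      "(\<Sum>x\<in>S2. zonal 4 40 (20 * t) (p x)) = - 96 * (\<Sum>x\<in>S1. zonal 4 40 (16 * t) (p x))"
      "(\<Sum>x\<in>S2. zonal 6 40 (20 * t) (p x)) = 144 * (\<Sum>x\<in>S1. zonal 6 40 (16 * t) (p x))"
  shows False
proof -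
  define A1 where "A1 = 3359360798101029613731840 + t * ((- 11649349579082374934691840) + t * (17133548660436385695006720 + t * ((- 14274283839253429655961600) + t * (7535723315611959666278400 + t * ((- 2653294457653702988267520) + t * (634353035815931561902080 + t * ((- 102089294018331475968000) + t * (10616001208039342080000 + t * ((- 645611258707968000000) + t * (17469022470144000000))))))))))"
  define A2 where "A2 = 158917318538306833612800 + t * ((- 430657405450466800435200) + t * (508178220811607806771200 + t * ((- 343565193243925482700800) + t * (146987863223078492160000 + t * ((- 41348019442993213440000) + t * (7659658019510784000000 + t * ((- 902187539258880000000) + t * (61369001164800000000 + t * ((- 1838247936000000000))))))))))"
  define A3 where "A3 = 482056941971998310400 + t * ((- 1126666635753235046400) + t * (1132747892925939763200 + t * ((- 641859967230588288000) + t * (224700713288932608000 + t * ((- 49846143323692800000) + t * (6850517129568000000 + t * ((- 533693260800000000) + t * (18052070400000000))))))))"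
  define A5 where "A5 = (- 9369025926220800) + t * (12789790205899392 + t * ((- 7252742782225248) + t * (2189678671210800 + t * ((- 371602664748000) + t * (33639097800000 + t * ((- 1269888900000)))))))"
  define B1 where "B1 = t * ((- 1071894678466461696000) + t * (3816720586374119424000 + t * ((- 5088954817918976000000) + t * (3640426469611520000000 + t * ((- 1593012966773760000000) + t * (449684116001120000000 + t * ((- 82672893968000000000) + t * (9602819100000000000 + t * ((- 642076400000000000) + t * (18884600000000000))))))))))"
  define B2 where "B2 = 53594733923323084800 + t * ((- 273505701811352371200) + t * (469531098262190080000 + t * ((- 409319877964433920000) + t * (210821892603616000000 + t * ((- 68366485697720000000) + t * (14180418645400000000 + t * ((- 1832354657000000000) + t * (134763720000000000 + t * ((- 4319350000000000))))))))))"
  define B3 where "B3 = 826696724926464000 + t * ((- 2541739267877376000) + t * (3075503500755840000 + t * ((- 1993578109185600000) + t * (772934507478000000 + t * ((- 185742074910000000) + t * (27221819415000000 + t * ((- 2236017000000000) + t * (79104375000000))))))))"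
  define B4 where "B4 = 13960917650534400 + t * ((- 31293104424153600) + t * (28672166448080000 + t * ((- 14137188651300000) + t * (4088309951875000 + t * ((- 697482467500000) + t * (65253037500000 + t * ((- 2589406250000))))))))"
  define B5 where "B5 = 131587442784000 + t * ((- 224656138596960) + t * (157138059626240 + t * ((- 57973855997750) + t * (11944730490000 + t * ((- 1306603375000) + t * (59391062500))))))"
  define B6 where "B6 = 39386717568 + t * ((- 50874510192) + t * (26517988200 + t * ((- 6974207625) + t * (925575000 + t * ((- 49584375))))))"
  define K where "K = t * (53749772769616473819709440 + t * ((- 145706759719511449550192640) + t * (173761008943249195605688320 + t * ((- 120754208106683805833625600) + t * (54370637149246613146828800 + t * ((- 16619832225922674138808320) + t * (3500050307136327914618880 + t * ((- 502216029015766990848000) + t * (47047145206649978880000 + t * ((- 2600866270937088000000) + t * (64484287709184000000)))))))))))"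
  define Q where "Q = 9690463840676046962688000000 + t * ((- 12800472459462119758233600000) + t * (7075905040302394009190400000 + t * ((- 2096575064398273536000000000) + t * (351408712789216051200000000 + t * ((- 31610084483755008000000000) + t * (1192833376745472000000000))))))"
  \<comment> \<open>The factors 96 and -144 cancel the degree 4 and degree 6 terms against those of
    \<open>f2\<close>, by the two relations linking the shells; the other degrees vanish on each
    shell separately.\<close>
  define f1 where "f1 = (\<lambda>p. A1 * zonal 1 40 (16 * t) p + A2 * zonal 2 40 (16 * t) p + A3 * (5 * zonal 3 40 (16 * t) p) + 96 * B4 * (7 * zonal 4 40 (16 * t) p) + A5 * (7 * zonal 5 40 (16 * t) p) + (- 144) * B6 * (77 * zonal 6 40 (16 * t) p))"
  define f2 where "f2 = (\<lambda>p. B1 * zonal 1 40 (20 * t) p + B2 * zonal 2 40 (20 * t) p + B3 * (5 * zonal 3 40 (20 * t) p) + B4 * (7 * zonal 4 40 (20 * t) p) + B5 * (7 * zonal 5 40 (20 * t) p) + B6 * (77 * zonal 6 40 (20 * t) p))"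
  have f1_0: "f1 y = K" if "y\<^sup>2 = 0" for y
    unfolding f1_def K_def A1_def A2_def A3_def A5_def B1_def B2_def B3_def B4_def B5_def B6_def zonal_40 that by (simp add: algebra_simps eval_nat_numeral)
  have f1_1: "f1 y = K" if "y\<^sup>2 = 1" for y
    unfolding f1_def K_def A1_def A2_def A3_def A5_def B1_def B2_def B3_def B4_def B5_def B6_def zonal_40 that by (simp add: algebra_simps eval_nat_numeral)
  have f1_4: "f1 y = K" if "y\<^sup>2 = 4" for y
    unfolding f1_def K_def A1_def A2_def A3_def A5_def B1_def B2_def B3_def B4_def B5_def B6_def zonal_40 that by algebra
  have f1_9: "f1 y = K" if "y\<^sup>2 = 9" for y
    unfolding f1_def K_def A1_def A2_def A3_def A5_def B1_def B2_def B3_def B4_def B5_def B6_def zonal_40 that by algebra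
  have f1_16: "f1 y = K" if "y\<^sup>2 = 16" for y
    unfolding f1_def K_def A1_def A2_def A3_def A5_def B1_def B2_def B3_def B4_def B5_def B6_def zonal_40 that by algebra
  have f1: "f1 y = K" if "y\<^sup>2 \<in> {0, 1, 4, 9, 16}" for y
    using that by (elim insertE emptyE) (rule f1_0 f1_1 f1_4 f1_9 f1_16, assumption)+
  have f2_0: "f2 y = 0" if "y\<^sup>2 = 0" for y
    unfolding f2_def A1_def A2_def A3_def A5_def B1_def B2_def B3_def B4_def B5_def B6_def zonal_40 that by (simp add: algebra_simps eval_nat_numeral)
  have f2_1: "f2 y = 0" if "y\<^sup>2 = 1" for y
    unfolding f2_def A1_def A2_def A3_def A5_def B1_def B2_def B3_def B4_def B5_def B6_def zonal_40 that by (simp add: algebra_simps eval_nat_numeral)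
  have f2_4: "f2 y = 0" if "y\<^sup>2 = 4" for y
    unfolding f2_def A1_def A2_def A3_def A5_def B1_def B2_def B3_def B4_def B5_def B6_def zonal_40 that by algebra
  have f2_9: "f2 y = 0" if "y\<^sup>2 = 9" for y
    unfolding f2_def A1_def A2_def A3_def A5_def B1_def B2_def B3_def B4_def B5_def B6_def zonal_40 that by algebra
  have f2_16: "f2 y = 0" if "y\<^sup>2 = 16" for y
    unfolding f2_def A1_def A2_def A3_def A5_def B1_def B2_def B3_def B4_def B5_def B6_def zonal_40 that by algebra
  have f2_25: "f2 y = Q" if "y\<^sup>2 = 25" for y
    unfolding f2_def Q_def A1_def A2_def A3_def A5_def B1_def B2_def B3_def B4_def B5_def B6_def zonal_40 that by algebra
  obtain u where u: "t = u + 6" "u \<ge> 0" using t by (auto intro: that[of "t - 6"])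
  have "K = 265747935837751533895680 + u * (1463359684112636927016960 + u * (3583385342189438710579200 + u * (5194718693619515334328320 + u * (4984177439038196573798400 + u * (3331007394355194164674560 + u * (1580739163825348427120640 + u * (530967526972377142394880 + u * (123146467180567068672000 + u * (18674058614609018880000 + u * (1655096717869056000000 + u * (64484287709184000000)))))))))))"
    unfolding K_def u by algebra
  then have K: "K > 0" using u(2) by (simp only:) (intro add_pos_nonneg mult_nonneg_nonneg add_nonneg_nonneg; simp)
  have "Q = 38505479344230747340800000 + u * (116895489740024492851200000 + u * (152734202625295820390400000 + u * (110643815931547852800000000 + u * (47236201719120691200000000 + u * (11331917079081984000000000 + u * (1192833376745472000000000))))))"
    unfolding Q_def u by algebra
  then have Q: "Q \<ge> 0" using u(2) by (simp only:) (intro mult_nonneg_nonneg add_nonneg_nonneg; simp)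
  have f2: "f2 y \<ge> 0" if "y\<^sup>2 \<in> {0, 1, 4, 9, 16, 25}" for y
    using that by (elim insertE emptyE) (simp_all only: order_refl zero_le_numeral Q f2_0 f2_1 f2_4 f2_9 f2_16 f2_25)
  have "(\<Sum>x\<in>S1. f1 (p x)) + (\<Sum>x\<in>S2. f2 (p x)) = 0"
    unfolding f1_def f2_def sum.distrib sum_distrib_left[symmetric] rel by simp
  moreover have "(\<Sum>x\<in>S1. f1 (p x)) > 0"
    using fin K f1[OF S1] by (intro sum_pos) simp_all
  moreover have "(\<Sum>x\<in>S2. f2 (p x)) \<ge> 0"
    by (intro sum_nonneg f2 S2)
  ultimately show False by simp
qed

text \<open>Nine conditions on ten multipliers: \<open>f1\<close> vanishes at every admissible value
  except 64, attained at \<open>x0\<close>, and \<open>f2\<close> at every one except 25. The value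
  16 is absent on \<open>S2\<close>, and this makes room for the additional value on
  \<open>S1\<close>.\<close>

lemma inconsistent_moments_80_minimal:
  fixes S1 :: "'b set" and S2 :: "'b set" and p :: "'b \<Rightarrow> real"
  assumes fin: "finite S1" "x0 \<in> S1" "(p x0)\<^sup>2 = 64"
    and S1: "\<And>x. x \<in> S1 \<Longrightarrow> (p x)\<^sup>2 \<in> {0, 1, 4, 9, 16, 64}"
    and S2: "\<And>x. x \<in> S2 \<Longrightarrow> (p x)\<^sup>2 \<in> {0, 1, 4, 9, 25}"
    and rel: "(\<Sum>x\<in>S1. zonal 1 40 64 (p x)) = 0" "(\<Sum>x\<in>S2. zonal 1 40 80 (p x)) = 0"
      "(\<Sum>x\<in>S1. zonal 2 40 64 (p x)) = 0" "(\<Sum>x\<in>S2. zonal 2 40 80 (p x)) = 0"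
      "(\<Sum>x\<in>S1. zonal 3 40 64 (p x)) = 0" "(\<Sum>x\<in>S2. zonal 3 40 80 (p x)) = 0"
      "(\<Sum>x\<in>S1. zonal 5 40 64 (p x)) = 0" "(\<Sum>x\<in>S2. zonal 5 40 80 (p x)) = 0"
      "(\<Sum>x\<in>S2. zonal 4 40 80 (p x)) = - 96 * (\<Sum>x\<in>S1. zonal 4 40 64 (p x))"
      "(\<Sum>x\<in>S2. zonal 6 40 80 (p x)) = 144 * (\<Sum>x\<in>S1. zonal 6 40 64 (p x))"
  shows False
proof -
  \<comment> \<open>Norm 8 of \<open>v\<close> gives the arguments 64 = 8 * 8 and 80 = 8 * 10.
    Cancellation in degrees 4 and 6 requires 425360678400 = 96 * 4430840400 and 16774128 = (-144) *
    (-116487).\<close>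
  define f1 where "f1 = (\<lambda>p. 221916114085478400 * zonal 1 40 64 p + 26869962276864000 * zonal 2 40 64 p + 144578997964800 * (5 * zonal 3 40 64 p) + 425360678400 * (7 * zonal 4 40 64 p) + (- 60200394912) * (7 * zonal 5 40 64 p) + 16774128 * (77 * zonal 6 40 64 p))"
  define f2 where "f2 = (\<lambda>p. 737025069056000 * zonal 1 40 80 p + 58835031116800 * zonal 2 40 80 p + 518603064000 * (5 * zonal 3 40 80 p) + 4430840400 * (7 * zonal 4 40 80 p) + (- 29743315) * (7 * zonal 5 40 80 p) + (- 116487) * (77 * zonal 6 40 80 p))"
  have f1_0: "f1 y = 0" if "y\<^sup>2 = 0" for y
    unfolding f1_def zonal_40 that by simp
  have f1_1: "f1 y = 0" if "y\<^sup>2 = 1" for y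
    unfolding f1_def zonal_40 that by simp
  have f1_4: "f1 y = 0" if "y\<^sup>2 = 4" for y
    unfolding f1_def zonal_40 that by simp
  have f1_9: "f1 y = 0" if "y\<^sup>2 = 9" for y
    unfolding f1_def zonal_40 that by simp
  have f1_16: "f1 y = 0" if "y\<^sup>2 = 16" for y
    unfolding f1_def zonal_40 that by simp
  have f1_64: "f1 y = 4880316164034396369715200000" if "y\<^sup>2 = 64" for y
    unfolding f1_def zonal_40 that by simp
  have f2_0: "f2 y = 0" if "y\<^sup>2 = 0" for y
    unfolding f2_def zonal_40 that by simp
  have f2_1: "f2 y = 0" if "y\<^sup>2 = 1" for y
    unfolding f2_def zonal_40 that by simp
  have f2_4: "f2 y = 0" if "y\<^sup>2 = 4" for y
    unfolding f2_def zonal_40 that by simp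
  have f2_9: "f2 y = 0" if "y\<^sup>2 = 9" for y
    unfolding f2_def zonal_40 that by simp
  have f2_25: "f2 y = 17733179120025600000" if "y\<^sup>2 = 25" for y
    unfolding f2_def zonal_40 that by simp
  have f1: "f1 y \<ge> 0" if "y\<^sup>2 \<in> {0, 1, 4, 9, 16, 64}" for y
    using that by (elim insertE emptyE) (simp_all only: order_refl zero_le_numeral f1_0 f1_1 f1_4 f1_9 f1_16 f1_64)
  have f2: "f2 y \<ge> 0" if "y\<^sup>2 \<in> {0, 1, 4, 9, 25}" for y
    using that by (elim insertE emptyE) (simp_all only: order_refl zero_le_numeral f2_0 f2_1 f2_4 f2_9 f2_25)
  have "(\<Sum>x\<in>S1. f1 (p x)) + (\<Sum>x\<in>S2. f2 (p x)) = 0"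
    unfolding f1_def f2_def sum.distrib sum_distrib_left[symmetric] rel by simp
  moreover have "(\<Sum>x\<in>S1. f1 (p x)) > 0"
    by (rule sum_pos2[OF fin(1,2)]) (simp add: f1_64[OF fin(3)], intro f1 S1)
  moreover have "(\<Sum>x\<in>S2. f2 (p x)) \<ge> 0"
    by (intro sum_nonneg f2 S2)
  ultimately show False by simp
qed

subsection \<open>Generation by the second shell\<close>

text \<open>The zero vector is the only one of norm 0, so in positive degree the zonal theta series
  has no constant term.\<close>

lemma zonal_zero: "\<nu> > 0 \<Longrightarrow> zonal \<nu> k 0 0 = 0"
  unfolding zonal_expansion by (intro sum.neutral) (auto simp: power_0_left)

text \<open>The gap leaves only the zero vector below norm 2m, and its zonal value is 0; hence the
  series vanishes to order 2m and falls under one of the classifications by weight.\<close>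

lemma zonal_shell_sums:
  fixes L :: "'a::real_inner set" and v :: 'a
  assumes L: "type_II_lattice n L" and n: "n = 2 * k" and k: "4 dvd k" "k > 0" and v: "v \<in> L"
    and gap: "\<And>x. x \<in> L \<Longrightarrow> x \<noteq> 0 \<Longrightarrow> real (2 * m) \<le> x \<bullet> x" and \<nu>: "\<nu> > 0"
  defines "Z \<equiv> \<lambda>j. \<Sum>x | x \<in> L \<and> x \<bullet> x = real j. zonal \<nu> k ((v \<bullet> v) * real j) (x \<bullet> v)"
  shows "k + 2 * \<nu> < 12 * m \<or> k + 2 * \<nu> = 12 * m + 2 \<Longrightarrow> Z j = 0"
    and "k + 2 * \<nu> = 12 * m \<Longrightarrow> Z (2 * m + 2) = - 24 * of_nat m * Z (2 * m)"
    and "k + 2 * \<nu> = 12 * m + 4 \<Longrightarrow> Z (2 * m + 2) = (240 - 24 * of_nat m) * Z (2 * m)"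
proof -
  obtain F where F: "modular_form (k + 2 * \<nu>) F" "\<And>j. fps_nth F j = of_real (Z j)"
    using zonal_theta_modular[OF L n k span_base[OF v], of \<nu>] unfolding Z_def of_real_sum by blast
  have zero: "fps_nth F j = 0" if "j < 2 * m" for j
  proof -
    have "x = 0" if "x \<in> L" "x \<bullet> x = real j" for x
      using gap[OF that(1)] that(2) \<open>j < 2 * m\<close> by (cases "x = 0") auto
    then have "zonal \<nu> k ((v \<bullet> v) * real j) (x \<bullet> v) = 0" if "x \<in> L" "x \<bullet> x = real j" for x
      using that zonal_zero[OF \<nu>] by force
    then show ?thesis unfolding F(2) Z_def by (simp add: sum.neutral)
  qed
  show "Z j = 0" if "k + 2 * \<nu> < 12 * m \<or> k + 2 * \<nu> = 12 * m + 2"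
  proof -
    have "F = 0" using that
    proof
      assume "k + 2 * \<nu> < 12 * m"
      then show ?thesis using modular_form_vanishes[OF F(1), of "2 * m"] zero by simp
    next
      assume "k + 2 * \<nu> = 12 * m + 2"
      then show ?thesis using cusp_form_weight_2[of m F] F(1) zero by simp
    qed
    then show ?thesis using F(2)[of j] by simp
  qed
  show "Z (2 * m + 2) = - 24 * of_nat m * Z (2 * m)" if "k + 2 * \<nu> = 12 * m"
  proof -
    have "of_real (Z (2 * m + 2)) = (of_real (- 24 * of_nat m * Z (2 * m)) :: complex)"
      using cusp_form_weight_0[of m F] F(1) zero that unfolding F(2) by simp
    then show ?thesis unfolding of_real_eq_iff .
  qed
  show "Z (2 * m + 2) = (240 - 24 * of_nat m) * Z (2 * m)" if "k + 2 * \<nu> = 12 * m + 4"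
  proof -
    have "of_real (Z (2 * m + 2)) = (of_real ((240 - 24 * of_nat m) * Z (2 * m)) :: complex)"
      using cusp_form_weight_4[of m F] F(1) zero that unfolding F(2) by simp
    then show ?thesis unfolding of_real_eq_iff .
  qed
qed

section \<open>Self-dual lattices and their short vectors\<close>

lemma self_dual_iff: "self_dual L \<Longrightarrow> x \<in> L \<longleftrightarrow> x \<in> span L \<and> (\<forall>y\<in>L. y \<bullet> x \<in> \<int>)"
  unfolding self_dual_def dual_lattice_def by (drule arg_cong[of _ _ "\<lambda>S. x \<in> S"]) simp

lemma self_dual_add: "self_dual L \<Longrightarrow> x \<in> L \<Longrightarrow> y \<in> L \<Longrightarrow> x + y \<in> L"
  by (simp add: self_dual_iff[of L "x + y"]) (simp add: self_dual_iff[of L x] self_dual_iff[of L y] inner_add_right span_add)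

lemma self_dual_inner_Ints: "self_dual L \<Longrightarrow> x \<in> L \<Longrightarrow> y \<in> L \<Longrightarrow> x \<bullet> y \<in> \<int>"
  using self_dual_iff by blast

lemma self_dual_scale_int: "self_dual L \<Longrightarrow> x \<in> L \<Longrightarrow> of_int c *\<^sub>R x \<in> L"
  by (simp add: self_dual_iff[of L "of_int c *\<^sub>R x"]) (simp add: self_dual_iff[of L x] span_scale)

lemma self_dual_zero: "self_dual L \<Longrightarrow> 0 \<in> L"
  by (simp add: self_dual_iff[of L 0] span_zero)

lemma int_span_base: "x \<in> S \<Longrightarrow> x \<in> int_span S"
  unfolding int_span_def by (rule module.span_base[OF module_int_scaleR])

lemma int_span_add: "x \<in> int_span S \<Longrightarrow> y \<in> int_span S \<Longrightarrow> x + y \<in> int_span S"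
  unfolding int_span_def by (rule module.span_add[OF module_int_scaleR])

lemma int_span_diff: "x \<in> int_span S \<Longrightarrow> y \<in> int_span S \<Longrightarrow> x - y \<in> int_span S"
  unfolding int_span_def by (rule module.span_diff[OF module_int_scaleR])

lemma self_dual_int_span_subset:
  assumes "self_dual L" "S \<subseteq> L"
  shows "int_span S \<subseteq> L"
  unfolding int_span_def
  by (rule module.span_minimal[OF module_int_scaleR assms(2)])
     (simp add: module.subspace_def[OF module_int_scaleR] self_dual_add self_dual_scale_int self_dual_zero assms(1))

text \<open>\<open>min_norm\<close> is a \<open>LEAST\<close> over the reals and means something
  only if the minimum is attained; it is, because norms in an even lattice are natural
  numbers.\<close>

lemma min_norm_attained:
  assumes "even_lattice L" "x \<in> L" "x \<noteq> 0"
  shows "\<exists>u\<in>L. u \<noteq> 0 \<and> u \<bullet> u = min_norm L" "\<And>y. y \<in> L \<Longrightarrow> y \<noteq> 0 \<Longrightarrow> min_norm L \<le> y \<bullet> y"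
proof -
  obtain u where u: "u \<in> L" "u \<noteq> 0" and least: "\<And>y. y \<in> L \<Longrightarrow> y \<noteq> 0 \<Longrightarrow> norm_level u \<le> norm_level y"
    using ex_has_least_nat[of "\<lambda>y. y \<in> L \<and> y \<noteq> 0" x norm_level] assms by blast
  have le: "u \<bullet> u \<le> y \<bullet> y" if "y \<in> L" "y \<noteq> 0" for y
    using least[OF that] by (simp add: even_lattice_norm_level(1)[OF assms(1)] u that)
  have eq: "min_norm L = u \<bullet> u"
    unfolding min_norm_def using u le by (intro Least_equality) auto
  show "\<exists>u\<in>L. u \<noteq> 0 \<and> u \<bullet> u = min_norm L" using u eq by auto
  show "min_norm L \<le> y \<bullet> y" if "y \<in> L" "y \<noteq> 0" for y using le[OF that] eq by simp
qed

lemma lattice_nonzero_vector: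
  assumes "lattice_of_rank n L" "n > 0"
  shows "\<exists>x\<in>L. x \<noteq> 0"
proof -
  obtain B where B: "finite B" "independent B" "card B = n" "L = int_span B"
    using assms by (auto simp: lattice_of_rank_def)
  then obtain b where "b \<in> B" using assms(2) by fastforce
  then show ?thesis using B(2,4) int_span_base[of b B] dependent_zero[of B] by metis
qed

lemma Ints_square_cases:
  fixes p :: real
  assumes "p \<in> \<int>" "\<bar>p\<bar> \<le> real c"
  shows "\<exists>i\<le>c. \<bar>p\<bar> = real i \<and> p\<^sup>2 = (real i)\<^sup>2"
proof -
  obtain j where j: "p = of_int j" using assms(1) by (auto elim: Ints_cases)
  have "nat \<bar>j\<bar> \<le> c" using assms(2) unfolding j by linarith
  moreover have e: "\<bar>p\<bar> = real (nat \<bar>j\<bar>)" by (simp add: j)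
  moreover have "p\<^sup>2 = (real (nat \<bar>j\<bar>))\<^sup>2" unfolding e[symmetric] by simp
  ultimately show ?thesis by blast
qed

text \<open>
  A shortest vector \<open>v\<close> outside the span \<open>M\<close> of the second shell is no longer than any of its
  translates by \<open>M\<close>, so \<open>\<bar>2 * (x \<bullet> v)\<bar> \<le> x \<bullet> x\<close> for all \<open>x \<in> M\<close>.
\<close>
lemma short_vector_outside_shell_span:
  fixes L :: "'a::real_inner set"
  assumes L: "type_II_lattice n L"
    and gap: "\<forall>x\<in>L. x \<noteq> 0 \<longrightarrow> real (2 * m) \<le> x \<bullet> x"
    and ne: "int_span {x \<in> L. x \<bullet> x = real (2 * m) + 2} \<noteq> L"
  obtains (minimal) v where "v \<in> L" "v \<bullet> v = real (2 * m)"
      "\<And>x. x \<in> L \<Longrightarrow> x \<bullet> x = real (2 * m) \<Longrightarrow> \<bar>x \<bullet> v\<bar> \<le> real m \<or> \<bar>x \<bullet> v\<bar> = real (2 * m)"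
      "\<And>x. x \<in> L \<Longrightarrow> x \<bullet> x = real (2 * m + 2) \<Longrightarrow> \<bar>x \<bullet> v\<bar> \<le> real (m + 1) \<and> \<bar>x \<bullet> v\<bar> \<noteq> real m"
  | (long) v where "v \<in> L" "v \<bullet> v \<ge> real (2 * m) + 4"
      "\<And>x. x \<in> L \<Longrightarrow> x \<bullet> x = real (2 * m) \<Longrightarrow> \<bar>x \<bullet> v\<bar> \<le> real m"
      "\<And>x. x \<in> L \<Longrightarrow> x \<bullet> x = real (2 * m + 2) \<Longrightarrow> \<bar>x \<bullet> v\<bar> \<le> real (m + 1)"
proof -
  define M where "M = int_span {x \<in> L. x \<bullet> x = real (2 * m) + 2}"
  have sd: "self_dual L" and ev: "even_lattice L" using L by (auto simp: type_II_lattice_def)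
  have sub: "M \<subseteq> L" unfolding M_def by (rule self_dual_int_span_subset[OF sd]) auto
  then obtain w where "w \<in> L" "w \<notin> M" using ne unfolding M_def by blast
  then obtain v where v: "v \<in> L" "v \<notin> M" and least: "\<And>y. y \<in> L \<Longrightarrow> y \<notin> M \<Longrightarrow> norm_level v \<le> norm_level y"
    using ex_has_least_nat[of "\<lambda>y. y \<in> L \<and> y \<notin> M" w norm_level] by blast
  have le: "v \<bullet> v \<le> y \<bullet> y" if "y \<in> L" "y \<notin> M" for y
    using least[OF that] by (simp add: even_lattice_norm_level(1)[OF ev] v that)
  have sh2: "x \<in> M" if "x \<in> L" "x \<bullet> x = real (2 * m) + 2" for x
    unfolding M_def using that by (intro int_span_base) auto
  have neg: "- x \<in> L" if "x \<in> L" for x using self_dual_scale_int[OF sd that, of "- 1"] by simp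
  have sq: "(v - x) \<bullet> (v - x) = v \<bullet> v + x \<bullet> x - 2 * (x \<bullet> v)" "(v + x) \<bullet> (v + x) = v \<bullet> v + x \<bullet> x + 2 * (x \<bullet> v)" for x
    by (simp_all add: inner_diff inner_add inner_commute)
  have dL: "v - x \<in> L" "v + x \<in> L" if "x \<in> L" for x
    using self_dual_add[OF sd v(1) neg[OF that]] self_dual_add[OF sd v(1) that] by simp_all
  have notM: "v - x \<notin> M" "v + x \<notin> M" if "x \<in> M" for x
  proof -
    show "v - x \<notin> M"
    proof
      assume "v - x \<in> M"
      then have "(v - x) + x \<in> M" using that unfolding M_def by (rule int_span_add)
      then show False using v(2) by simp
    qed
    show "v + x \<notin> M"
    proof
      assume "v + x \<in> M"
      then have "(v + x) - x \<in> M" using that unfolding M_def by (rule int_span_diff)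
      then show False using v(2) by simp
    qed
  qed
  have red: "\<bar>x \<bullet> v\<bar> \<le> (x \<bullet> x) / 2" if "x \<in> M" for x
    using le[OF dL(1) notM(1), OF _ that] le[OF dL(2) notM(2), OF _ that] that sub
    unfolding sq by (auto simp: abs_le_iff)
  have b2: "\<bar>x \<bullet> v\<bar> \<le> real (m + 1)" if "x \<in> L" "x \<bullet> x = real (2 * m + 2)" for x
    using red[of x] sh2[of x] that by simp
  have v0: "v \<noteq> 0" using v(2) int_span_diff[of _ "{x \<in> L. x \<bullet> x = real (2 * m) + 2}"]
    unfolding M_def int_span_def using module.span_zero[OF module_int_scaleR] by blast
  show thesis
  proof (cases "v \<bullet> v = real (2 * m)")
    case True
    show thesis
    proof (rule minimal[OF v(1) True])
      fix x assume x: "x \<in> L" "x \<bullet> x = real (2 * m)"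
      \<comment> \<open>If x differs from v and from -v, the vectors v - x and v + x are nonzero and
        have norm at least 2m, which bounds the inner product by m; the two exceptions give 2m and
        -2m.\<close>
      have "x \<bullet> v \<le> real m" if "v - x \<noteq> 0"
        using gap[rule_format, OF dL(1)[OF x(1)] that] unfolding sq True x(2) by linarith
      moreover have "- (x \<bullet> v) \<le> real m" if "v + x \<noteq> 0"
        using gap[rule_format, OF dL(2)[OF x(1)] that] unfolding sq True x(2) by linarith
      moreover have "x \<bullet> v = real (2 * m)" if "v - x = 0" using that True by simp
      moreover have "x \<bullet> v = - real (2 * m)" if "v + x = 0"
        using that True by (metis add.inverse_inverse add_eq_0_iff inner_minus_left)
      ultimately show "\<bar>x \<bullet> v\<bar> \<le> real m \<or> \<bar>x \<bullet> v\<bar> = real (2 * m)" by linarith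
    next
      fix x assume x: "x \<in> L" "x \<bullet> x = real (2 * m + 2)"
      have xM: "x \<in> M" using sh2[of x] x by simp
      \<comment> \<open>If the inner product were m or -m, then v - x or v + x would have norm 2m +
        (2m + 2) - 2m = 2m + 2. It would lie in the second shell, hence in \<open>M\<close>, and
        with it \<open>v\<close>.\<close>
      have "\<bar>x \<bullet> v\<bar> \<noteq> real m"
      proof
        assume "\<bar>x \<bullet> v\<bar> = real m"
        then have "(v - x) \<bullet> (v - x) = real (2 * m) + 2 \<or> (v + x) \<bullet> (v + x) = real (2 * m) + 2"
          unfolding sq True x(2) by linarith
        then show False using sh2[OF dL(1)[OF x(1)]] sh2[OF dL(2)[OF x(1)]] notM[OF xM] by blast
      qed
      then show "\<bar>x \<bullet> v\<bar> \<le> real (m + 1) \<and> \<bar>x \<bullet> v\<bar> \<noteq> real m" using b2[OF x] by blast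
    qed
  next
    case False
    have lv: "v \<bullet> v = real (norm_level v)" "even (norm_level v)"
      using even_lattice_norm_level[OF ev v(1)] by auto
    \<comment> \<open>Norm 2m + 2 would put \<open>v\<close> into \<open>M\<close>, and norms are
      even, so the next possible value after 2m is 2m + 4.\<close>
    have "norm_level v \<noteq> 2 * m" "norm_level v \<noteq> 2 * m + 2" "2 * m \<le> norm_level v"
      using False sh2[OF v(1)] v(2) gap[rule_format, OF v(1) v0] unfolding lv(1) by auto
    then have "norm_level v \<ge> 2 * m + 4" using lv(2) by presburger
    then have big: "v \<bullet> v \<ge> real (2 * m) + 4" unfolding lv(1) by linarith
    show thesis
    proof (rule long[OF v(1) big _ b2])
      fix x assume x: "x \<in> L" "x \<bullet> x = real (2 * m)"
      \<comment> \<open>A minimal vector is now shorter than \<open>v\<close>, the shortest vector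
        outside \<open>M\<close>, so the bound \<open>red\<close> also covers the first
        shell.\<close>
      have "x \<in> M" using le[OF x(1)] x(2) big by force
      from red[OF this] show "\<bar>x \<bullet> v\<bar> \<le> real m" using x(2) by simp
    qed
  qed
qed

lemma type_II_finite_shell:
  assumes "type_II_lattice n L"
  shows "finite {x \<in> L. x \<bullet> x = real m}"
proof -
  have ev: "even_lattice L" and P: "poisson_holds L n 1"
    using assms self_dual_poisson by (auto simp: type_II_lattice_def)
  have "{x \<in> L. x \<bullet> x = real m} = {x \<in> L. norm_level x = m}"
    using even_lattice_level_iff[OF ev] by auto
  then show ?thesis using poisson_finite_shell[OF P ev] by simp
qed

text \<open>For \<nu> = 1, 2, 3, 4 the weights are 22, 24, 26, 28, to be compared with 24, the
  weight of \<Delta>^2. So \<nu> = 1 and 3 give vanishing sums, \<nu> = 2 gives the ratio -48 and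
  \<nu> = 4 the ratio 240 - 48 = 192.\<close>

lemma generated_by_second_shell_40:
  assumes L: "type_II_lattice 40 L"
    and gap: "\<And>x. x \<in> L \<Longrightarrow> x \<noteq> 0 \<Longrightarrow> 4 \<le> x \<bullet> x" and ex: "\<exists>u\<in>L. u \<bullet> u = 4"
  shows "int_span {x \<in> L. x \<bullet> x = 6} = L"
proof (rule ccontr)
  assume ne: "int_span {x \<in> L. x \<bullet> x = 6} \<noteq> L"
  have sd: "self_dual L" using L by (auto simp: type_II_lattice_def)
  have sq: "\<exists>i\<le>c. \<bar>x \<bullet> v\<bar> = real i \<and> (x \<bullet> v)\<^sup>2 = (real i)\<^sup>2"
    if "\<bar>x \<bullet> v\<bar> \<le> real c" "x \<in> L" "v \<in> L" for x v c
    using self_dual_inner_Ints[OF sd that(2,3)] that(1) by (rule Ints_square_cases)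
  have fin: "finite {x \<in> L. x \<bullet> x = 4}" using type_II_finite_shell[OF L, of 4] by simp
  note Z = zonal_shell_sums[OF L, of 20 _ 2, simplified, OF _ gap]
  have rel: "(\<Sum>x | x \<in> L \<and> x \<bullet> x = 4. zonal 1 20 ((v \<bullet> v) * 4) (x \<bullet> v)) = 0" "(\<Sum>x | x \<in> L \<and> x \<bullet> x = 6. zonal 1 20 ((v \<bullet> v) * 6) (x \<bullet> v)) = 0"
      "(\<Sum>x | x \<in> L \<and> x \<bullet> x = 4. zonal 3 20 ((v \<bullet> v) * 4) (x \<bullet> v)) = 0" "(\<Sum>x | x \<in> L \<and> x \<bullet> x = 6. zonal 3 20 ((v \<bullet> v) * 6) (x \<bullet> v)) = 0"
      "(\<Sum>x | x \<in> L \<and> x \<bullet> x = 6. zonal 2 20 ((v \<bullet> v) * 6) (x \<bullet> v)) =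
         - 48 * (\<Sum>x | x \<in> L \<and> x \<bullet> x = 4. zonal 2 20 ((v \<bullet> v) * 4) (x \<bullet> v))"
      "(\<Sum>x | x \<in> L \<and> x \<bullet> x = 6. zonal 4 20 ((v \<bullet> v) * 6) (x \<bullet> v)) =
         192 * (\<Sum>x | x \<in> L \<and> x \<bullet> x = 4. zonal 4 20 ((v \<bullet> v) * 4) (x \<bullet> v))" if "v \<in> L" for v
    using Z(1)[OF that, of 1 4] Z(1)[OF that, of 1 6]
      Z(1)[OF that, of 3 4] Z(1)[OF that, of 3 6]
      Z(2)[OF that, of 2] Z(3)[OF that, of 4] by simp_all
  have ne': "int_span {x \<in> L. x \<bullet> x = real (2 * 2) + 2} \<noteq> L" using ne by simp
  have gap': "\<forall>x\<in>L. x \<noteq> 0 \<longrightarrow> real (2 * 2) \<le> x \<bullet> x" using gap by simp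
  show False
  proof (cases rule: short_vector_outside_shell_span[OF L gap' ne', case_names minimal long])
    case (minimal v)
    show False
    proof (rule inconsistent_moments_40_minimal[where p = "\<lambda>x. x \<bullet> v" and ?x0.0 = v])
      show "(x \<bullet> v)\<^sup>2 \<in> {0, 1, 4, 16}" if "x \<in> {x \<in> L. x \<bullet> x = 4}" for x
      proof (cases "\<bar>x \<bullet> v\<bar> = real (2 * 2)")
        case True
        then have "\<bar>x \<bullet> v\<bar>\<^sup>2 = (real (2 * 2))\<^sup>2" by (rule arg_cong)
        then show ?thesis by simp
      next
        case False
        have x: "x \<in> L" using that by simp
        from False have "\<bar>x \<bullet> v\<bar> \<le> real 2" using minimal(3)[of x] that by simp
        then obtain i where i: "i \<le> 2" "(x \<bullet> v)\<^sup>2 = (real i)\<^sup>2"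
          using sq[OF _ x minimal(1)] by blast
        then have "i = 0 \<or> i = 1 \<or> i = 2" by linarith
        then show ?thesis unfolding i(2) by (elim disjE) simp_all
      qed
      show "(x \<bullet> v)\<^sup>2 \<in> {0, 1, 9}" if "x \<in> {x \<in> L. x \<bullet> x = 6}" for x
      proof -
        have x: "x \<in> L" using that by simp
        have b: "\<bar>x \<bullet> v\<bar> \<le> real 3" "\<bar>x \<bullet> v\<bar> \<noteq> real 2" using minimal(4)[of x] that by simp_all
        then obtain i where i: "i \<le> 3" "\<bar>x \<bullet> v\<bar> = real i" "(x \<bullet> v)\<^sup>2 = (real i)\<^sup>2"
          using sq[OF _ x minimal(1)] by blast
        then have "i \<noteq> 2" using b(2) by auto
        then have "i = 0 \<or> i = 1 \<or> i = 3" using i(1) by linarith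
        then show ?thesis unfolding i(3) by (elim disjE) simp_all
      qed
    qed (use minimal rel[OF minimal(1)] fin in simp_all)
  next
    case (long v)
    show False
    \<comment> \<open>With \<open>t\<close> half the norm of \<open>v\<close>, the arguments (v
      \<bullet> v) * 4 and (v \<bullet> v) * 6 are 8t and 12t, and norm at least 8 means
      \<open>t\<close> at least 4.\<close>
    proof (rule inconsistent_moments_40[where p = "\<lambda>x. x \<bullet> v" and t = "(v \<bullet> v) / 2"])
      show "(x \<bullet> v)\<^sup>2 \<in> {0, 1, 4}" if "x \<in> {x \<in> L. x \<bullet> x = 4}" for x
      proof -
        have x: "x \<in> L" using that by simp
        have "\<bar>x \<bullet> v\<bar> \<le> real 2" using long(3)[of x] that by simp
        then obtain i where i: "i \<le> 2" "(x \<bullet> v)\<^sup>2 = (real i)\<^sup>2"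
          using sq[OF _ x long(1)] by blast
        then have "i = 0 \<or> i = 1 \<or> i = 2" by linarith
        then show ?thesis unfolding i(2) by (elim disjE) simp_all
      qed
      show "(x \<bullet> v)\<^sup>2 \<in> {0, 1, 4, 9}" if "x \<in> {x \<in> L. x \<bullet> x = 6}" for x
      proof -
        have x: "x \<in> L" using that by simp
        have "\<bar>x \<bullet> v\<bar> \<le> real 3" using long(4)[of x] that by simp
        then obtain i where i: "i \<le> 3" "(x \<bullet> v)\<^sup>2 = (real i)\<^sup>2"
          using sq[OF _ x long(1)] by blast
        then have "i = 0 \<or> i = 1 \<or> i = 2 \<or> i = 3" by linarith
        then show ?thesis unfolding i(2) by (elim disjE) simp_all
      qed
    qed (use long rel[OF long(1)] fin ex in \<open>simp_all add: mult.commute Bex_def\<close>)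
  qed
qed

text \<open>For \<nu> from 1 to 6 the weights are 42, 44, 46, 48, 50, 52, to be compared with 48,
  the weight of \<Delta>^4. So \<nu> = 1, 2, 3 and 5 give vanishing sums, \<nu> = 4 gives the ratio
  -96 and \<nu> = 6 the ratio 240 - 96 = 144.\<close>

lemma generated_by_second_shell_80:
  assumes L: "type_II_lattice 80 L"
    and gap: "\<And>x. x \<in> L \<Longrightarrow> x \<noteq> 0 \<Longrightarrow> 8 \<le> x \<bullet> x" and ex: "\<exists>u\<in>L. u \<bullet> u = 8"
  shows "int_span {x \<in> L. x \<bullet> x = 10} = L"
proof (rule ccontr)
  assume ne: "int_span {x \<in> L. x \<bullet> x = 10} \<noteq> L"
  have sd: "self_dual L" using L by (auto simp: type_II_lattice_def)
  have sq: "\<exists>i\<le>c. \<bar>x \<bullet> v\<bar> = real i \<and> (x \<bullet> v)\<^sup>2 = (real i)\<^sup>2"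
    if "\<bar>x \<bullet> v\<bar> \<le> real c" "x \<in> L" "v \<in> L" for x v c
    using self_dual_inner_Ints[OF sd that(2,3)] that(1) by (rule Ints_square_cases)
  have fin: "finite {x \<in> L. x \<bullet> x = 8}" using type_II_finite_shell[OF L, of 8] by simp
  note Z = zonal_shell_sums[OF L, of 40 _ 4, simplified, OF _ gap]
  have rel: "(\<Sum>x | x \<in> L \<and> x \<bullet> x = 8. zonal 1 40 ((v \<bullet> v) * 8) (x \<bullet> v)) = 0" "(\<Sum>x | x \<in> L \<and> x \<bullet> x = 10. zonal 1 40 ((v \<bullet> v) * 10) (x \<bullet> v)) = 0"
      "(\<Sum>x | x \<in> L \<and> x \<bullet> x = 8. zonal 2 40 ((v \<bullet> v) * 8) (x \<bullet> v)) = 0" "(\<Sum>x | x \<in> L \<and> x \<bullet> x = 10. zonal 2 40 ((v \<bullet> v) * 10) (x \<bullet> v)) = 0"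
      "(\<Sum>x | x \<in> L \<and> x \<bullet> x = 8. zonal 3 40 ((v \<bullet> v) * 8) (x \<bullet> v)) = 0" "(\<Sum>x | x \<in> L \<and> x \<bullet> x = 10. zonal 3 40 ((v \<bullet> v) * 10) (x \<bullet> v)) = 0"
      "(\<Sum>x | x \<in> L \<and> x \<bullet> x = 8. zonal 5 40 ((v \<bullet> v) * 8) (x \<bullet> v)) = 0" "(\<Sum>x | x \<in> L \<and> x \<bullet> x = 10. zonal 5 40 ((v \<bullet> v) * 10) (x \<bullet> v)) = 0"
      "(\<Sum>x | x \<in> L \<and> x \<bullet> x = 10. zonal 4 40 ((v \<bullet> v) * 10) (x \<bullet> v)) =
         - 96 * (\<Sum>x | x \<in> L \<and> x \<bullet> x = 8. zonal 4 40 ((v \<bullet> v) * 8) (x \<bullet> v))"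
      "(\<Sum>x | x \<in> L \<and> x \<bullet> x = 10. zonal 6 40 ((v \<bullet> v) * 10) (x \<bullet> v)) =
         144 * (\<Sum>x | x \<in> L \<and> x \<bullet> x = 8. zonal 6 40 ((v \<bullet> v) * 8) (x \<bullet> v))" if "v \<in> L" for v
    using Z(1)[OF that, of 1 8] Z(1)[OF that, of 1 10]
      Z(1)[OF that, of 2 8] Z(1)[OF that, of 2 10]
      Z(1)[OF that, of 3 8] Z(1)[OF that, of 3 10]
      Z(1)[OF that, of 5 8] Z(1)[OF that, of 5 10]
      Z(2)[OF that, of 4] Z(3)[OF that, of 6] by simp_all
  have ne': "int_span {x \<in> L. x \<bullet> x = real (2 * 4) + 2} \<noteq> L" using ne by simp
  have gap': "\<forall>x\<in>L. x \<noteq> 0 \<longrightarrow> real (2 * 4) \<le> x \<bullet> x" using gap by simp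
  show False
  proof (cases rule: short_vector_outside_shell_span[OF L gap' ne', case_names minimal long])
    case (minimal v)
    show False
    proof (rule inconsistent_moments_80_minimal[where p = "\<lambda>x. x \<bullet> v" and ?x0.0 = v])
      show "(x \<bullet> v)\<^sup>2 \<in> {0, 1, 4, 9, 16, 64}" if "x \<in> {x \<in> L. x \<bullet> x = 8}" for x
      proof (cases "\<bar>x \<bullet> v\<bar> = real (2 * 4)")
        case True
        then have "\<bar>x \<bullet> v\<bar>\<^sup>2 = (real (2 * 4))\<^sup>2" by (rule arg_cong)
        then show ?thesis by simp
      next
        case False
        have x: "x \<in> L" using that by simp
        from False have "\<bar>x \<bullet> v\<bar> \<le> real 4" using minimal(3)[of x] that by simp
        then obtain i where i: "i \<le> 4" "(x \<bullet> v)\<^sup>2 = (real i)\<^sup>2"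
          using sq[OF _ x minimal(1)] by blast
        then have "i = 0 \<or> i = 1 \<or> i = 2 \<or> i = 3 \<or> i = 4" by linarith
        then show ?thesis unfolding i(2) by (elim disjE) simp_all
      qed
      show "(x \<bullet> v)\<^sup>2 \<in> {0, 1, 4, 9, 25}" if "x \<in> {x \<in> L. x \<bullet> x = 10}" for x
      proof -
        have x: "x \<in> L" using that by simp
        have b: "\<bar>x \<bullet> v\<bar> \<le> real 5" "\<bar>x \<bullet> v\<bar> \<noteq> real 4" using minimal(4)[of x] that by simp_all
        then obtain i where i: "i \<le> 5" "\<bar>x \<bullet> v\<bar> = real i" "(x \<bullet> v)\<^sup>2 = (real i)\<^sup>2"
          using sq[OF _ x minimal(1)] by blast
        then have "i \<noteq> 4" using b(2) by auto
        then have "i = 0 \<or> i = 1 \<or> i = 2 \<or> i = 3 \<or> i = 5" using i(1) by linarith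
        then show ?thesis unfolding i(3) by (elim disjE) simp_all
      qed
    qed (use minimal rel[OF minimal(1)] fin in simp_all)
  next
    case (long v)
    show False
    proof (rule inconsistent_moments_80[where p = "\<lambda>x. x \<bullet> v" and t = "(v \<bullet> v) / 2"])
      show "(x \<bullet> v)\<^sup>2 \<in> {0, 1, 4, 9, 16}" if "x \<in> {x \<in> L. x \<bullet> x = 8}" for x
      proof -
        have x: "x \<in> L" using that by simp
        have "\<bar>x \<bullet> v\<bar> \<le> real 4" using long(3)[of x] that by simp
        then obtain i where i: "i \<le> 4" "(x \<bullet> v)\<^sup>2 = (real i)\<^sup>2"
          using sq[OF _ x long(1)] by blast
        then have "i = 0 \<or> i = 1 \<or> i = 2 \<or> i = 3 \<or> i = 4" by linarith
        then show ?thesis unfolding i(2) by (elim disjE) simp_all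
      qed
      show "(x \<bullet> v)\<^sup>2 \<in> {0, 1, 4, 9, 16, 25}" if "x \<in> {x \<in> L. x \<bullet> x = 10}" for x
      proof -
        have x: "x \<in> L" using that by simp
        have "\<bar>x \<bullet> v\<bar> \<le> real 5" using long(4)[of x] that by simp
        then obtain i where i: "i \<le> 5" "(x \<bullet> v)\<^sup>2 = (real i)\<^sup>2"
          using sq[OF _ x long(1)] by blast
        then have "i = 0 \<or> i = 1 \<or> i = 2 \<or> i = 3 \<or> i = 4 \<or> i = 5" by linarith
        then show ?thesis unfolding i(2) by (elim disjE) simp_all
      qed
    qed (use long rel[OF long(1)] fin ex in \<open>simp_all add: mult.commute Bex_def\<close>)
  qed
qed

theorem theorem2:
  fixes L :: "'a::real_inner set" and n :: nat
  assumes "n = 40 \<or> n = 80"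
    and "extremal_type_II n L"
  shows "int_span {x \<in> L. x \<bullet> x = min_norm L + 2} = L"
proof -
  have L: "type_II_lattice n L" and mn: "min_norm L = 2 * of_int \<lfloor>real n / 24\<rfloor> + 2"
    using assms(2) by (auto simp: extremal_type_II_def)
  then have ev: "even_lattice L" and "lattice_of_rank n L" by (auto simp: type_II_lattice_def)
  then obtain x where "x \<in> L" "x \<noteq> 0" using lattice_nonzero_vector[of n L] assms(1) by auto
  note mins = min_norm_attained[OF ev this]
  from assms(1) show ?thesis
  proof
    assume n: "n = 40"
    then have "min_norm L = 4" unfolding mn by (simp add: floor_unique)
    then show ?thesis using generated_by_second_shell_40[of L] L mins unfolding n by auto
  next
    assume n: "n = 80"
    then have "min_norm L = 8" unfolding mn by (simp add: floor_unique)
    then show ?thesis using generated_by_second_shell_80[of L] L mins unfolding n by auto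
  qed
qed

end
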